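(* Let $k,n$ be integers with $3\le k<n<2k$. Then $\mathrm{Conf}_k(\mathbb{R},n)$ has the homotopy type of a wedge of $\beta(k,n)$ spheres of dimension $k-2$, where $$\beta(k,n)=\sum_{i=k}^{n}\binom{n}{i}\binom{i-1}{k-1}.$$
   Context: $\mathrm{Conf}_k(\mathbb{R},n)$ is the subspace of $\mathbb{R}^n$ consisting of the $n$-tuples $(x_1,\ldots,x_n)$ for which there are no $k$ pairwise distinct indices $i_1,\ldots,i_k$ with $x_{i_1}=\cdots=x_{i_k}$. *)

theory Defs
  imports "HOL-Analysis.Analysis"
begin

section \<open>No-k-equal configuration spaces of the real line\<close>

text \<open>
  As for \<^const>\<open>Euclidean_space\<close>, the coordinates of a point of \<open>n\<close>-space are indexed by
  \<open>0, \<dots>, n - 1\<close>. A choice of \<open>k\<close> pairwise distinct indices is a set of \<open>k\<close> indices.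
\<close>

definition conf_space :: "nat \<Rightarrow> nat \<Rightarrow> (nat \<Rightarrow> real) topology" where
  "conf_space k n = subtopology (Euclidean_space n)
     {x. \<not> (\<exists>I \<subseteq> {..<n}. card I = k \<and> (\<forall>i\<in>I. \<forall>j\<in>I. x i = x j))}"

section \<open>Wedges of pointed spaces\<close>

text \<open>
  The wedge of the spaces \<open>X i\<close> with base points \<open>p i\<close>, \<open>i \<in> I\<close>, is the quotient of their disjoint
  union that identifies all the base points. The common base point is represented by \<^term>\<open>None\<close>.
  It is always present, so that the wedge of the empty family is a point.
\<close>

definition wedge_proj :: "('i \<Rightarrow> 'a) \<Rightarrow> 'i \<times> 'a \<Rightarrow> ('i \<times> 'a) option" where
  "wedge_proj p z = (if snd z = p (fst z) then None else Some z)"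

definition wedge :: "('i \<Rightarrow> 'a topology) \<Rightarrow> ('i \<Rightarrow> 'a) \<Rightarrow> 'i set \<Rightarrow> ('i \<times> 'a) option topology" where
  "wedge X p I = topology (\<lambda>U.
     U \<subseteq> insert None (wedge_proj p ` topspace (sum_topology X I)) \<and>
     openin (sum_topology X I) {z \<in> topspace (sum_topology X I). wedge_proj p z \<in> U})"

lemma openin_wedge:
  "openin (wedge X p I) U \<longleftrightarrow>
     U \<subseteq> insert None (wedge_proj p ` topspace (sum_topology X I)) \<and>
     openin (sum_topology X I) {z \<in> topspace (sum_topology X I). wedge_proj p z \<in> U}"
proof -
  let ?S = "sum_topology X I"
  let ?P = "\<lambda>U. {z \<in> topspace ?S. wedge_proj p z \<in> U}"
  have 1: "?P (U \<inter> V) = ?P U \<inter> ?P V" for U V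
    by blast
  have 2: "?P (\<Union>\<K>) = \<Union> (?P ` \<K>)" for \<K>
    by blast
  have "istopology (\<lambda>U. U \<subseteq> insert None (wedge_proj p ` topspace ?S) \<and> openin ?S (?P U))"
    unfolding istopology_def 1 2
  proof (intro conjI allI impI; (elim conjE)?)
    fix U V
    assume "openin ?S (?P U)" "openin ?S (?P V)"
    then show "openin ?S (?P U \<inter> ?P V)"
      by (rule openin_Int)
  next
    fix \<K>
    assume "\<forall>K\<in>\<K>. K \<subseteq> insert None (wedge_proj p ` topspace ?S) \<and> openin ?S (?P K)"
    then show "openin ?S (\<Union> (?P ` \<K>))"
      by (intro openin_Union) auto
  qed blast+
  then show ?thesis
    unfolding wedge_def by (simp only: topology_inverse')
qed

lemma topspace_wedge:
  "topspace (wedge X p I) = insert None (wedge_proj p ` topspace (sum_topology X I))"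
proof -
  let ?S = "sum_topology X I"
  let ?T = "insert None (wedge_proj p ` topspace ?S)"
  have "{z \<in> topspace ?S. wedge_proj p z \<in> ?T} = topspace ?S"
    by blast
  then have "openin (wedge X p I) ?T"
    unfolding openin_wedge by (simp only: openin_topspace) blast
  moreover have "topspace (wedge X p I) \<subseteq> ?T"
    using openin_topspace[of "wedge X p I"] unfolding openin_wedge by (rule conjunct1)
  ultimately show ?thesis
    by (intro subset_antisym openin_subset)
qed

lemma quotient_map_wedge_proj:
  assumes "I \<noteq> {}" and "\<And>i. i \<in> I \<Longrightarrow> p i \<in> topspace (X i)"
  shows "quotient_map (sum_topology X I) (wedge X p I) (wedge_proj p)"
proof -
  obtain i where i: "i \<in> I"
    using assms(1) by blast
  then have "(i, p i) \<in> topspace (sum_topology X I)"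
    using assms(2) by simp
  moreover have "wedge_proj p (i, p i) = None"
    by (simp add: wedge_proj_def)
  ultimately have "None \<in> wedge_proj p ` topspace (sum_topology X I)"
    by (metis image_eqI)
  then have "wedge_proj p ` topspace (sum_topology X I) = topspace (wedge X p I)"
    unfolding topspace_wedge by blast
  then show ?thesis
    unfolding quotient_map_def openin_wedge topspace_wedge by simp
qed

definition sphere_wedge :: "nat \<Rightarrow> nat \<Rightarrow> (nat \<times> (nat \<Rightarrow> real)) option topology" where
  "sphere_wedge m d = wedge (\<lambda>_. nsphere d) (\<lambda>_ i. if i = 0 then 1 else 0) {..<m}"

definition beta :: "nat \<Rightarrow> nat \<Rightarrow> nat" where
  "beta k n = (\<Sum>i = k..n. (n choose i) * ((i - 1) choose (k - 1)))"

end

theory Submission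
  imports Defs
begin

text \<open>
  Call a configuration with a block \<open>T\<close> of exactly \<open>k - 1\<close> equal coordinates, all other coordinates
  being strictly above (those in \<open>U\<close>) or strictly below the common value, a point of the cell
  \<open>(T, U)\<close>. The cells are convex and have codimension \<open>k - 2\<close>. One chooses \<open>beta k n\<close> of them, closed
  and pairwise disjoint in the configuration space, whose complement is contractible. Collapsing the
  complement of tubular neighbourhoods of the chosen cells maps the space to a wedge of spheres; a
  homotopy inverse sends each sphere to a disk transverse to its cell, completed by a contraction of
  the complement of the cells.

  The cells are chosen by adding one coordinate at a time. Over a block \<open>T\<close> among the first \<open>n\<close>
  coordinates the new coordinate must avoid the common value, which leaves two half-lines: the cells
  over one of them are chosen, so that the fibre of the complement becomes the other one, an interval.
  The surviving side is "above" if \<open>T\<close> is the lowest block and "below" otherwise, because then the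
  average of the first and the \<open>k\<close>-th smallest coordinate is a continuous section. With this choice
  every chosen cell has coordinates on both sides of its block, and for \<open>n < 2 * k\<close> such cells have
  disjoint tubes. The induction starts with \<open>k + 1\<close> coordinates, where the complement of the chosen
  cells is, up to pushing the last coordinate away from some of them, the complement of the graph of a
  median over a half-space.
\<close>

section \<open>Wedges of spheres as quotients of disks\<close>

text \<open>Two-sidedness shapes the choice of cells. A one-sided cell would spoil the tubes: for
  \<open>n = 2 * k - 1\<close> the remaining \<open>k\<close> coordinates could all coincide, so the
  convex cell would leave the configuration space, and for \<open>2 * k - 2 \<le> n\<close> a lowest
  block and a disjoint highest block can occur in one configuration, so two cells would meet. Among
  \<open>k\<close> coordinates a block leaves a single coordinate, hence every cell is one-sided;
  therefore the induction starts at \<open>k + 1\<close>, with a choice made by hand. Modulo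
  translation and scaling, \<open>k + 1\<close> coordinates give a sphere of dimension
  \<open>k - 1\<close> without the \<open>2 * (k + 1)\<close> points at which \<open>k\<close>
  coordinates agree. Cutting it along a spanning tree on these points leaves a contractible set, and
  the tree has \<open>2 * k + 1 = beta k (k + 1)\<close> edges. A disk transverse to a cell has
  dimension \<open>k - 2\<close>, and collapsing everything outside its interior makes it a sphere
  of that dimension. The equivalence is explicit, so no homology enters: the number of spheres is
  the number of chosen cells, which obeys the same recursion as \<open>beta\<close>.\<close>

definition disk :: "nat \<Rightarrow> (nat \<Rightarrow> real) set" where
  "disk d = {v. (\<forall>i\<ge>d. v i = 0) \<and> L2_set v {..<d} \<le> 1}"

text \<open>For radius \<open>sin t\<close> this is a point at angle \<open>2 * t\<close> from the
  antipode of the base point, written algebraically: the centre goes to the antipode and the whole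
  boundary to the base point.\<close>

definition disk_to_sphere :: "nat \<Rightarrow> (nat \<Rightarrow> real) \<Rightarrow> nat \<Rightarrow> real" where
  "disk_to_sphere d v = (\<lambda>i. if i = 0 then 2 * (L2_set v {..<d})\<^sup>2 - 1
     else 2 * sqrt (1 - (L2_set v {..<d})\<^sup>2) * v (i - 1))"

definition disk_to_wedge :: "nat \<Rightarrow> nat \<Rightarrow> (nat \<Rightarrow> real) \<Rightarrow> (nat \<times> (nat \<Rightarrow> real)) option" where
  "disk_to_wedge d c v = wedge_proj (\<lambda>_ i. if i = 0 then 1 else 0) (c, disk_to_sphere d v)"

lemma continuous_on_apply [continuous_intros]:
  "continuous_on S (\<lambda>x. x i)"
  "continuous_on S' (\<lambda>x. fst x i)"
  "continuous_on S'' (\<lambda>x. snd x i)"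
  for S :: "('a \<Rightarrow> 'b::topological_space) set"
  by (rule continuous_on_product_then_coordinatewise, intro continuous_intros)+

text \<open>Otherwise every function-valued map would be split into its coordinates.\<close>

declare continuous_on_coordinatewise_then_product [continuous_intros del]

lemma continuous_on_L2_set [continuous_intros]:
  fixes f :: "'a::topological_space \<Rightarrow> 'b \<Rightarrow> real"
  assumes "\<And>i. i \<in> A \<Longrightarrow> continuous_on S (\<lambda>x. f x i)"
  shows "continuous_on S (\<lambda>x. L2_set (f x) A)"
  unfolding L2_set_def using assms by (intro continuous_intros)

lemma L2_set_scale: "L2_set (\<lambda>i. c * v i) A = \<bar>c\<bar> * L2_set v A"
  unfolding L2_set_def
  by (simp add: power_mult_distrib sum_distrib_left[symmetric] real_sqrt_mult)

lemma L2_set_divide: "L2_set (\<lambda>i. v i / c) A = L2_set v A / \<bar>c\<bar>"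
  using L2_set_scale[of "1 / c" v A] by simp

lemma disk_scale:
  assumes "v \<in> disk d" "\<bar>c\<bar> * L2_set v {..<d} \<le> 1"
  shows "(\<lambda>i. c * v i) \<in> disk d"
  using assms by (simp add: disk_def L2_set_scale)

text \<open>The function space has infinitely many coordinates, so compactness comes from
  Tychonoff's theorem: the disk is closed and lies in a product of intervals.\<close>

lemma compact_disk: "compact (disk d)"
proof -
  have 1: "compact (\<Pi>\<^sub>E i\<in>UNIV. {-1..1::real})"
    using compactin_PiE[of "\<lambda>_. euclidean" UNIV "\<lambda>_. {-1..1::real}"]
    by (simp add: euclidean_product_topology)
  have 2: "closed (disk d)"
  proof -
    have "disk d = (\<Inter>i\<in>{d..}. {v. v i = 0}) \<inter> {v. L2_set v {..<d} \<le> 1}"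
      by (auto simp: disk_def)
    moreover have "closed {v. v i = (0::real)}" for i :: nat
      by (intro closed_Collect_eq continuous_intros)
    moreover have "closed {v::nat \<Rightarrow> real. L2_set v {..<d} \<le> 1}"
      by (intro closed_Collect_le continuous_intros)
    ultimately show ?thesis
      by (metis (no_types, lifting) closed_INT closed_Int)
  qed
  have "v i \<in> {-1..1}" if "v \<in> disk d" for v i
  proof (cases "i < d")
    case True
    then have "\<bar>v i\<bar> \<le> L2_set (\<lambda>i. \<bar>v i\<bar>) {..<d}"
      by (intro member_le_L2_set) auto
    also have "\<dots> = L2_set v {..<d}"
      by (simp add: L2_set_def)
    also have "\<dots> \<le> 1"
      using that by (simp add: disk_def)
    finally show ?thesis
      by auto
  qed (use that in \<open>auto simp: disk_def\<close>)
  then have "disk d \<subseteq> (\<Pi>\<^sub>E i\<in>UNIV. {-1..1::real})"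
    by (auto simp: PiE_def)
  then show ?thesis
    using 1 2 by (metis closed_Int_compact inf.absorb1)
qed

section \<open>Collapsing the boundary of a disk to obtain a sphere\<close>

lemma nsphere_eq: "nsphere d = top_of_set {x. (\<Sum>i\<le>d. (x i)\<^sup>2) = 1 \<and> (\<forall>i>d. x i = 0)}"
  by (simp add: nsphere euclidean_product_topology)

lemma disk_to_sphere_in:
  assumes "v \<in> disk d"
  shows "disk_to_sphere d v \<in> topspace (nsphere d)"
proof -
  let ?r = "L2_set v {..<d}"
  have r: "0 \<le> ?r" "?r \<le> 1" "(\<Sum>i<d. (v i)\<^sup>2) = ?r\<^sup>2"
    using assms by (auto simp: disk_def L2_set_def sum_nonneg)
  then have r2: "?r\<^sup>2 \<le> 1"
    by (simp add: power_le_one)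
  have "(\<Sum>i\<le>d. (disk_to_sphere d v i)\<^sup>2) = (2 * ?r\<^sup>2 - 1)\<^sup>2 + (\<Sum>i<d. (2 * sqrt (1 - ?r\<^sup>2) * v i)\<^sup>2)"
    by (simp add: sum.atMost_shift disk_to_sphere_def)
  also have "(\<Sum>i<d. (2 * sqrt (1 - ?r\<^sup>2) * v i)\<^sup>2) = 4 * (1 - ?r\<^sup>2) * ?r\<^sup>2"
    using r2 by (simp add: power_mult_distrib sum_distrib_left[symmetric] r(3))
  also have "(2 * ?r\<^sup>2 - 1)\<^sup>2 + \<dots> = 1"
    by algebra
  finally have "(\<Sum>i\<le>d. (disk_to_sphere d v i)\<^sup>2) = 1" .
  moreover have "\<forall>i>d. disk_to_sphere d v i = 0"
    using assms by (auto simp: disk_to_sphere_def disk_def)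
  ultimately show ?thesis
    by (simp add: nsphere_eq)
qed

lemma disk_to_sphere_eq_base_iff:
  assumes "v \<in> disk d"
  shows "disk_to_sphere d v = (\<lambda>i. if i = 0 then 1 else 0) \<longleftrightarrow> L2_set v {..<d} = 1"
proof
  assume "disk_to_sphere d v = (\<lambda>i. if i = 0 then 1 else 0)"
  then have "disk_to_sphere d v 0 = 1" by simp
  then show "L2_set v {..<d} = 1"
    by (simp add: disk_to_sphere_def power2_eq_1_iff) (smt (verit) L2_set_nonneg)
qed (auto simp: disk_to_sphere_def)

lemma disk_to_sphere_inj:
  assumes "v \<in> disk d" "w \<in> disk d" "disk_to_sphere d v = disk_to_sphere d w"
  shows "v = w \<or> L2_set v {..<d} = 1 \<and> L2_set w {..<d} = 1"
proof -
  let ?r = "L2_set v {..<d}"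
  have "disk_to_sphere d v 0 = disk_to_sphere d w 0"
    using assms(3) by simp
  then have r: "?r = L2_set w {..<d}"
    by (simp add: disk_to_sphere_def power2_eq_iff_nonneg)
  show ?thesis
  proof (cases "?r = 1")
    case False
    then have "?r < 1"
      using assms(1) by (auto simp: disk_def)
    then have "?r\<^sup>2 < 1"
      by (simp add: abs_square_less_1)
    moreover have "disk_to_sphere d v (Suc i) = disk_to_sphere d w (Suc i)" for i
      using assms(3) by simp
    ultimately have "v i = w i" for i
      using r by (auto simp: disk_to_sphere_def)
    then show ?thesis
      by auto
  qed (use r in auto)
qed

lemma disk_to_sphere_surj:
  assumes "0 < d" "y \<in> topspace (nsphere d)"
  shows "\<exists>v\<in>disk d. disk_to_sphere d v = y"
proof -
  have y: "(y 0)\<^sup>2 + (\<Sum>i<d. (y (Suc i))\<^sup>2) = 1" "\<And>i. d < i \<Longrightarrow> y i = 0"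
    using assms(2) by (auto simp: nsphere_eq sum.atMost_shift)
  show ?thesis
  proof (cases "y 0 = 1")
    case True
    then have "(\<Sum>i<d. (y (Suc i))\<^sup>2) = 0"
      using y(1) by simp
    then have "y (Suc i) = 0" if "i < d" for i
      using that by (simp add: sum_nonneg_eq_0_iff)
    then have "y (Suc i) = 0" for i
      using y(2) by (cases "i < d") auto
    then have yb: "y = (\<lambda>i. if i = 0 then 1 else 0)"
      using True by (auto simp: fun_eq_iff gr0_conv_Suc)
    \<comment> \<open>Every boundary point of the disk is mapped to the base point;
      \<open>0 < d\<close> provides this one.\<close>
    let ?v = "(\<lambda>i. if i = 0 then 1 else 0) :: nat \<Rightarrow> real"
    have "(?v i)\<^sup>2 = (if i = 0 then 1 else 0)" for i
      by simp
    then have "L2_set ?v {..<d} = 1"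
      using assms(1) by (simp only: L2_set_def sum.delta finite_lessThan lessThan_iff) simp
    then show ?thesis
      using assms(1) disk_to_sphere_eq_base_iff[of ?v d] yb
      by (intro bexI[of _ ?v]) (auto simp: disk_def)
  next
    case False
    have "(y 0)\<^sup>2 \<le> 1"
      using y(1) by (smt (verit) sum_nonneg zero_le_power2)
    then have y0: "-1 \<le> y 0" "y 0 < 1"
      using False by (auto simp: abs_square_le_1)
    \<comment> \<open>Solving \<open>2 * r\<^sup>2 - 1 = y 0\<close> gives
      \<open>r\<^sup>2 = (1 + y 0) / 2\<close>, so \<open>s\<close> is the factor
      \<open>2 * sqrt (1 - r\<^sup>2)\<close> of the other coordinates. It is positive away from the
      base point.\<close>
    define s where "s = sqrt (2 * (1 - y 0))"
    have s: "s > 0" "s\<^sup>2 = 2 * (1 - y 0)"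
      using y0 by (auto simp: s_def)
    define v where "v = (\<lambda>i. y (Suc i) / s)"
    have "(L2_set v {..<d})\<^sup>2 = (\<Sum>i<d. (y (Suc i))\<^sup>2) / s\<^sup>2"
      by (simp add: L2_set_def v_def sum_nonneg power_divide sum_divide_distrib)
    also have "(\<Sum>i<d. (y (Suc i))\<^sup>2) = (1 - y 0) * (1 + y 0)"
      using y(1) by (simp add: power2_eq_square algebra_simps)
    also have "(1 - y 0) * (1 + y 0) / s\<^sup>2 = (1 - y 0) * (1 + y 0) / (2 * (1 - y 0))"
      by (simp only: s(2))
    also have "\<dots> = (1 + y 0) / 2"
      using y0 by (simp add: field_simps)
    finally have r: "(L2_set v {..<d})\<^sup>2 = (1 + y 0) / 2" .
    then have "L2_set v {..<d} \<le> 1"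
      using y0 by (auto intro: power2_le_imp_le[of _ 1, OF _ zero_le_one])
    then have "v \<in> disk d"
      using y(2) by (auto simp: disk_def v_def)
    moreover have *: "2 * sqrt (1 - (1 + y 0) / 2) = s"
    proof -
      have "2 * sqrt x = sqrt (4 * x)" for x
        by (simp add: real_sqrt_mult)
      then have "2 * sqrt (1 - (1 + y 0) / 2) = sqrt (4 * (1 - (1 + y 0) / 2))" .
      also have "\<dots> = s"
        by (simp add: s_def field_simps)
      finally show ?thesis .
    qed
    have "disk_to_sphere d v i = y i" for i
    proof (cases i)
      case (Suc j)
      then have "disk_to_sphere d v i = s * v j"
        by (simp add: disk_to_sphere_def r *)
      then show ?thesis
        using s(1) Suc by (simp add: v_def)
    qed (simp add: disk_to_sphere_def r field_simps)
    then have "disk_to_sphere d v = y"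
      by blast
    ultimately show ?thesis
      by blast
  qed
qed

lemma quotient_map_disk_to_sphere:
  assumes "0 < d"
  shows "quotient_map (top_of_set (disk d)) (nsphere d) (disk_to_sphere d)"
proof (rule T1_Spaces.continuous_imp_quotient_map)
  have "continuous_on (disk d) (disk_to_sphere d)"
  proof (rule continuous_on_coordinatewise_then_product)
    fix i
    show "continuous_on (disk d) (\<lambda>v. disk_to_sphere d v i)"
      by (cases "i = 0") (auto simp: disk_to_sphere_def intro!: continuous_intros)
  qed
  then show "continuous_map (top_of_set (disk d)) (nsphere d) (disk_to_sphere d)"
    using disk_to_sphere_in unfolding nsphere_eq by auto
  show "compact_space (top_of_set (disk d))"
    using compact_disk by (simp add: compact_space_subtopology)
  show "Hausdorff_space (nsphere d)"
    unfolding nsphere_eq by (simp add: Hausdorff_space_subtopology)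
  show "disk_to_sphere d ` topspace (top_of_set (disk d)) = topspace (nsphere d)"
    using disk_to_sphere_surj[OF assms] disk_to_sphere_in by force
qed

text \<open>The natural numbers are discrete, so this product is a disjoint union of copies of
  \<open>D\<close> and can stand in for a sum topology.\<close>

lemma openin_top_of_set_nat_Times:
  fixes I :: "nat set"
  shows "openin (top_of_set (I \<times> D)) Z \<longleftrightarrow>
    Z \<subseteq> I \<times> D \<and> (\<forall>i\<in>I. openin (top_of_set D) {v. (i, v) \<in> Z})" (is "?L \<longleftrightarrow> ?R")
proof
  assume L: ?L
  then obtain O' where O': "open O'" "Z = (I \<times> D) \<inter> O'"
    by (auto simp: openin_open)
  have "openin (top_of_set D) {v. (i, v) \<in> Z}" if "i \<in> I" for i
  proof -
    have "open ((\<lambda>v. (i, v)) -` O')"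
      by (intro open_vimage O'(1) continuous_intros)
    moreover have "{v. (i, v) \<in> Z} = D \<inter> ((\<lambda>v. (i, v)) -` O')"
      using O'(2) that by auto
    ultimately show ?thesis
      by (auto simp: openin_open)
  qed
  then show ?R
    using O'(2) by auto
next
  assume R: ?R
  then have "\<exists>O'. \<forall>i\<in>I. open (O' i) \<and> {v. (i, v) \<in> Z} = D \<inter> O' i"
    by (intro bchoice) (auto simp: openin_open)
  then obtain O' where O': "\<And>i. i \<in> I \<Longrightarrow> open (O' i) \<and> {v. (i, v) \<in> Z} = D \<inter> O' i"
    by blast
  have "open (\<Union>i\<in>I. {i} \<times> O' i)"
    using O' by (intro open_UN ballI open_Times) (auto intro: open_discrete)
  moreover have "Z = (I \<times> D) \<inter> (\<Union>i\<in>I. {i} \<times> O' i)"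
  proof -
    have "(i, v) \<in> Z \<longleftrightarrow> i \<in> I \<and> v \<in> D \<and> v \<in> O' i" for i v
    proof (cases "i \<in> I")
      case True
      then have "v \<in> {v. (i, v) \<in> Z} \<longleftrightarrow> v \<in> D \<inter> O' i"
        using O' by blast
      then show ?thesis
        using True by simp
    qed (use R in auto)
    then show ?thesis
      by auto
  qed
  ultimately show ?L
    by (auto simp: openin_open)
qed

text \<open>Two quotients in a row: each boundary sphere becomes a base point, then all base points
  are identified. For \<open>0 < m\<close> the point \<open>None\<close> is itself hit by boundary
  points, so a disk index and a vector address every point of the wedge.\<close>

lemma quotient_map_disk_to_wedge:
  assumes "0 < d" "0 < m"
  shows "quotient_map (top_of_set ({..<m} \<times> disk d)) (sphere_wedge m d) (\<lambda>(c, v). disk_to_wedge d c v)"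
proof -
  let ?q = "\<lambda>(c::nat, v). (c, disk_to_sphere d v)"
  have q: "quotient_map (top_of_set (disk d)) (nsphere d) (disk_to_sphere d)"
    by (rule quotient_map_disk_to_sphere[OF assms(1)])
  have "quotient_map (top_of_set ({..<m} \<times> disk d)) (sum_topology (\<lambda>_. nsphere d) {..<m}) ?q"
    unfolding quotient_map_def
  proof (intro conjI allI impI)
    show "?q ` topspace (top_of_set ({..<m} \<times> disk d)) = topspace (sum_topology (\<lambda>_. nsphere d) {..<m})"
      using disk_to_sphere_surj[OF assms(1)] disk_to_sphere_in by fastforce
  next
    fix U assume U: "U \<subseteq> topspace (sum_topology (\<lambda>_::nat. nsphere d) {..<m})"
    let ?Z = "{x \<in> topspace (top_of_set ({..<m} \<times> disk d)). ?q x \<in> U}"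
    have "openin (top_of_set (disk d)) {v. (i, v) \<in> ?Z} \<longleftrightarrow> openin (nsphere d) {x. (i, x) \<in> U}"
      if "i < m" for i
    proof -
      have "{x. (i, x) \<in> U} \<subseteq> topspace (nsphere d)"
        using U by auto
      moreover have "{v. (i, v) \<in> ?Z} = {v \<in> topspace (top_of_set (disk d)). disk_to_sphere d v \<in> {x. (i, x) \<in> U}}"
        using that by auto
      ultimately show ?thesis
        using q unfolding quotient_map_def by presburger
    qed
    then show "openin (top_of_set ({..<m} \<times> disk d)) ?Z = openin (sum_topology (\<lambda>_. nsphere d) {..<m}) U"
      unfolding openin_top_of_set_nat_Times openin_sum_topology using U by auto
  qed
  moreover have "quotient_map (sum_topology (\<lambda>_. nsphere d) {..<m}) (sphere_wedge m d)
     (wedge_proj (\<lambda>_ i. if i = 0 then 1 else 0))"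
    unfolding sphere_wedge_def using assms(2) in_topspace_nsphere
    by (intro quotient_map_wedge_proj) auto
  ultimately have "quotient_map (top_of_set ({..<m} \<times> disk d)) (sphere_wedge m d)
     (wedge_proj (\<lambda>_ i. if i = 0 then 1 else 0) \<circ> ?q)"
    by (rule quotient_map_compose)
  moreover have "wedge_proj (\<lambda>_ i. if i = 0 then 1 else 0) \<circ> ?q = (\<lambda>(c, v). disk_to_wedge d c v)"
    by (auto simp: disk_to_wedge_def)
  ultimately show ?thesis
    by simp
qed

lemma disk_to_wedge_eq_None_iff:
  assumes "v \<in> disk d"
  shows "disk_to_wedge d c v = None \<longleftrightarrow> L2_set v {..<d} = 1"
  using disk_to_sphere_eq_base_iff[OF assms] by (simp add: disk_to_wedge_def wedge_proj_def)

lemma disk_to_wedge_eq_iff: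
  assumes "v \<in> disk d" "w \<in> disk d"
  shows "disk_to_wedge d c v = disk_to_wedge d c' w \<longleftrightarrow>
    c = c' \<and> v = w \<or> L2_set v {..<d} = 1 \<and> L2_set w {..<d} = 1"
  using disk_to_sphere_eq_base_iff[OF assms(1)] disk_to_sphere_eq_base_iff[OF assms(2)]
    disk_to_sphere_inj[OF assms]
  by (auto simp: disk_to_wedge_def wedge_proj_def)

lemma continuous_map_disk_to_wedge:
  assumes "0 < d" "c < m"
  shows "continuous_map (top_of_set (disk d)) (sphere_wedge m d) (disk_to_wedge d c)"
proof -
  have "continuous_map (top_of_set (disk d)) (top_of_set ({..<m} \<times> disk d)) (\<lambda>v. (c, v))"
    using assms by (auto intro!: continuous_intros)
  moreover have "continuous_map (top_of_set ({..<m} \<times> disk d)) (sphere_wedge m d) (\<lambda>(c, v). disk_to_wedge d c v)"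
    using quotient_map_disk_to_wedge[of d m] assms by (auto intro: quotient_imp_continuous_map)
  ultimately have "continuous_map (top_of_set (disk d)) (sphere_wedge m d)
     ((\<lambda>(c, v). disk_to_wedge d c v) \<circ> (\<lambda>v. (c, v)))"
    by (rule continuous_map_compose)
  then show ?thesis
    by (simp add: o_def)
qed

lemma sphere_wedge_cases:
  assumes "0 < d" "0 < m" "w \<in> topspace (sphere_wedge m d)"
  obtains c v where "c < m" "v \<in> disk d" "w = disk_to_wedge d c v"
  using quotient_imp_surjective_map[OF quotient_map_disk_to_wedge[OF assms(1,2)]] assms(3)
  by fastforce

text \<open>The product of a quotient map with the locally compact interval is again a quotient map,
  so a homotopy on the wedge may be prescribed disk by disk. Different points are identified only on
  boundary spheres, hence the single compatibility condition. Plain maps arise by restriction to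
  time \<open>0\<close>.\<close>

lemma sphere_wedge_homotopy_lift:
  assumes "0 < d" "0 < m"
    and F: "\<And>c. c < m \<Longrightarrow> continuous_map (top_of_set ({0..1::real} \<times> disk d)) Y (F c)"
    and eq: "\<And>c c' t v v'. \<lbrakk>c < m; c' < m; t \<in> {0..1}; v \<in> disk d; v' \<in> disk d;
       L2_set v {..<d} = 1; L2_set v' {..<d} = 1\<rbrakk> \<Longrightarrow> F c (t, v) = F c' (t, v')"
  obtains G where "continuous_map (prod_topology (top_of_set {0..1}) (sphere_wedge m d)) Y G"
    "\<And>c t v. \<lbrakk>c < m; t \<in> {0..1}; v \<in> disk d\<rbrakk> \<Longrightarrow> G (t, disk_to_wedge d c v) = F c (t, v)"
proof -
  let ?I = "top_of_set {0..1::real}" and ?D = "top_of_set ({..<m} \<times> disk d)"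
  let ?q = "\<lambda>(x::real, y). (x, (\<lambda>(c, v). disk_to_wedge d c v) y)"
  let ?F = "\<lambda>(t, c, v). F c (t, v)"
  have "locally_compact_space ?I"
    by (simp add: compact_imp_locally_compact_space compact_space_subtopology)
  then have q: "quotient_map (prod_topology ?I ?D) (prod_topology ?I (sphere_wedge m d)) ?q"
    using quotient_map_disk_to_wedge[OF assms(1,2)]
    by (intro quotient_map_prod_right) (auto simp: Hausdorff_space_subtopology)
  have F': "continuous_map (prod_topology ?I ?D) Y ?F"
  proof (rule pasting_lemma_closed[where I = "{..<m}" and T = "\<lambda>c. {0..1} \<times> {c} \<times> disk d"
         and f = "\<lambda>c z. F c (fst z, snd (snd z))"])
    fix c assume c: "c \<in> {..<m}"
    have "closedin ?D ({c} \<times> disk d)"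
      using c by (auto simp: closedin_closed intro!: exI[of _ "{c} \<times> UNIV"] closed_Times)
    then show "closedin (prod_topology ?I ?D) ({0..1} \<times> {c} \<times> disk d)"
      unfolding closedin_prod_Times_iff by simp
    have "subtopology (prod_topology ?I ?D) ({0..1} \<times> {c} \<times> disk d) = top_of_set ({0..1} \<times> {c} \<times> disk d)"
      using c by (simp add: subtopology_Times subtopology_subtopology) (metis Times_Int_Times inf.idem Int_insert_right_if1 lessThan_iff inf_bot_right)
    moreover have "continuous_map (top_of_set ({0..1} \<times> {c} \<times> disk d)) (top_of_set ({0..1} \<times> disk d)) (\<lambda>z. (fst z, snd (snd z)))"
      unfolding continuous_map_subtopology_eu by (intro conjI continuous_intros) auto
    then have "continuous_map (top_of_set ({0..1} \<times> {c} \<times> disk d)) Y (F c \<circ> (\<lambda>z. (fst z, snd (snd z))))"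
      using F c by (intro continuous_map_compose) auto
    ultimately show "continuous_map (subtopology (prod_topology ?I ?D) ({0..1} \<times> {c} \<times> disk d)) Y (\<lambda>z. F c (fst z, snd (snd z)))"
      by (simp add: o_def)
  qed auto
  have eq': "?F x = ?F y" if "x \<in> topspace (prod_topology ?I ?D)" "y \<in> topspace (prod_topology ?I ?D)"
    "?q x = ?q y" for x y
  proof -
    obtain t c v t' c' v' where xy: "x = (t, c, v)" "y = (t', c', v')"
      by (metis prod_cases3)
    then have *: "t = t'" "c < m" "c' < m" "t \<in> {0..1}" "v \<in> disk d" "v' \<in> disk d"
      "disk_to_wedge d c v = disk_to_wedge d c' v'"
      using that by auto
    then consider "c = c'" "v = v'" | "L2_set v {..<d} = 1" "L2_set v' {..<d} = 1"
      using disk_to_wedge_eq_iff by blast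
    then show ?thesis
      by cases (use eq[OF *(2-6)] *(1) in \<open>simp_all add: xy\<close>)
  qed
  show ?thesis
  proof (rule quotient_map_lift_exists[OF q F'])
    show "?F x = ?F y" if "x \<in> topspace (prod_topology ?I ?D)" "y \<in> topspace (prod_topology ?I ?D)"
      "?q x = ?q y" for x y
      using that by (rule eq')
  next
    fix G
    assume G: "continuous_map (prod_topology ?I (sphere_wedge m d)) Y G"
      "\<And>x. x \<in> topspace (prod_topology ?I ?D) \<Longrightarrow> G (?q x) = ?F x"
    have "G (t, disk_to_wedge d c v) = F c (t, v)" if "c < m" "t \<in> {0..1}" "v \<in> disk d" for c t v
      using G(2)[of "(t, c, v)"] that by simp
    then show ?thesis
      using that G(1) by blast
  qed
qed

section \<open>Collapsing the complement of disjoint tubes\<close>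

lemma continuous_on_scale_fun [continuous_intros]:
  fixes f :: "'a::topological_space \<Rightarrow> 'b \<Rightarrow> real"
  assumes "continuous_on S c" "continuous_on S f"
  shows "continuous_on S (\<lambda>x i. c x * f x i)"
  using assms
  by (intro continuous_on_coordinatewise_then_product continuous_on_mult)
     (auto intro: continuous_on_product_then_coordinatewise)

text \<open>The tube \<open>N c\<close> has the coordinate \<open>p c\<close> along its core and
  \<open>v c\<close> across it, and \<open>a c\<close> rebuilds a point from the two.
  \<open>\<eta> c\<close> contracts the parameter space \<open>P c\<close> to \<open>h c\<close>,
  and \<open>K\<close> contracts the complement \<open>V\<close> of all the cores, where a core
  consists of the points with \<open>v c = 0\<close>.\<close>

locale disk_tubes =
  fixes X :: "'a::topological_space set" and m d :: nat
    and N :: "nat \<Rightarrow> 'a set" and P :: "nat \<Rightarrow> 'b::topological_space set"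
    and v :: "nat \<Rightarrow> 'a \<Rightarrow> nat \<Rightarrow> real" and p :: "nat \<Rightarrow> 'a \<Rightarrow> 'b"
    and a :: "nat \<Rightarrow> 'b \<times> (nat \<Rightarrow> real) \<Rightarrow> 'a"
    and \<eta> :: "nat \<Rightarrow> real \<times> 'b \<Rightarrow> 'b" and h :: "nat \<Rightarrow> 'b"
    and V :: "'a set" and K :: "real \<times> 'a \<Rightarrow> 'a" and x\<^sub>0 :: 'a
  assumes d_pos: "0 < d" and m_pos: "0 < m"
    and N_closed: "\<And>c. c < m \<Longrightarrow> closedin (top_of_set X) (N c)"
    and N_disjoint: "\<And>c c'. \<lbrakk>c < m; c' < m; c \<noteq> c'\<rbrakk> \<Longrightarrow> N c \<inter> N c' = {}"
    and N_open: "\<And>c. c < m \<Longrightarrow> openin (top_of_set X) {x \<in> N c. L2_set (v c x) {..<d} < 1}"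
    and v_cont: "\<And>c. c < m \<Longrightarrow> continuous_on (N c) (v c)"
    and v_in: "\<And>c x. \<lbrakk>c < m; x \<in> N c\<rbrakk> \<Longrightarrow> v c x \<in> disk d"
    and p_cont: "\<And>c. c < m \<Longrightarrow> continuous_on (N c) (p c)"
    and p_in: "\<And>c x. \<lbrakk>c < m; x \<in> N c\<rbrakk> \<Longrightarrow> p c x \<in> P c"
    and a_cont: "\<And>c. c < m \<Longrightarrow> continuous_on (P c \<times> disk d) (a c)"
    and a_in: "\<And>c y w. \<lbrakk>c < m; y \<in> P c; w \<in> disk d\<rbrakk> \<Longrightarrow> a c (y, w) \<in> N c"
    and a_pv: "\<And>c x. \<lbrakk>c < m; x \<in> N c\<rbrakk> \<Longrightarrow> a c (p c x, v c x) = x"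
    and v_a: "\<And>c y w. \<lbrakk>c < m; y \<in> P c; w \<in> disk d\<rbrakk> \<Longrightarrow> v c (a c (y, w)) = w"
    and \<eta>_cont: "\<And>c. c < m \<Longrightarrow> continuous_on ({0..1} \<times> P c) (\<eta> c)"
    and \<eta>_in: "\<And>c t y. \<lbrakk>c < m; t \<in> {0..1}; y \<in> P c\<rbrakk> \<Longrightarrow> \<eta> c (t, y) \<in> P c"
    and \<eta>_0: "\<And>c y. \<lbrakk>c < m; y \<in> P c\<rbrakk> \<Longrightarrow> \<eta> c (0, y) = y"
    and \<eta>_1: "\<And>c y. \<lbrakk>c < m; y \<in> P c\<rbrakk> \<Longrightarrow> \<eta> c (1, y) = h c"
    and h_in: "\<And>c. c < m \<Longrightarrow> h c \<in> P c"
    and V_def: "V = X - (\<Union>c<m. {x \<in> N c. L2_set (v c x) {..<d} = 0})"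
    and K_cont: "continuous_on ({0..1} \<times> V) K"
    and K_in: "\<And>t x. \<lbrakk>t \<in> {0..1}; x \<in> V\<rbrakk> \<Longrightarrow> K (t, x) \<in> V"
    and K_0: "\<And>x. x \<in> V \<Longrightarrow> K (0, x) = x"
    and K_1: "\<And>x. x \<in> V \<Longrightarrow> K (1, x) = x\<^sub>0"
begin

abbreviation nrm :: "(nat \<Rightarrow> real) \<Rightarrow> real" where
  "nrm w \<equiv> L2_set w {..<d}"

definition outside :: "'a set" where
  "outside = X - (\<Union>c<m. {x \<in> N c. nrm (v c x) < 1})"

text \<open>The pieces take a time and a point, so the same construction serves homotopies and, at
  time \<open>0\<close>, maps. The description operator is meaningful because the tubes are
  disjoint.\<close>

definition paste :: "(nat \<Rightarrow> real \<times> 'a \<Rightarrow> 'c) \<Rightarrow> (real \<times> 'a \<Rightarrow> 'c) \<Rightarrow> real \<times> 'a \<Rightarrow> 'c" where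
  "paste F G z = (if \<exists>c<m. snd z \<in> N c then F (THE c. c < m \<and> snd z \<in> N c) z else G z)"

lemma paste_N:
  assumes "c < m" "x \<in> N c"
  shows "paste F G (t, x) = F c (t, x)"
proof -
  have "(THE c. c < m \<and> x \<in> N c) = c"
    using assms N_disjoint by (intro the_equality) blast+
  then show ?thesis
    using assms by (auto simp: paste_def)
qed

lemma N_subset: "c < m \<Longrightarrow> N c \<subseteq> X"
  using N_closed closedin_imp_subset by blast

lemma v_norm: "\<lbrakk>c < m; x \<in> N c\<rbrakk> \<Longrightarrow> nrm (v c x) \<le> 1"
  using v_in by (auto simp: disk_def)

lemma paste_outside:
  assumes "x \<in> outside" "\<And>c. \<lbrakk>c < m; x \<in> N c; nrm (v c x) = 1\<rbrakk> \<Longrightarrow> F c (t, x) = G (t, x)"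
  shows "paste F G (t, x) = G (t, x)"
proof (cases "\<exists>c<m. x \<in> N c")
  case True
  then obtain c where c: "c < m" "x \<in> N c" by blast
  then have "nrm (v c x) = 1"
    using assms(1) v_norm[OF c] by (force simp: outside_def)
  then show ?thesis
    using assms(2) c by (simp add: paste_N)
qed (auto simp: paste_def)

lemma X_cases:
  assumes "x \<in> X"
  obtains (N) c where "c < m" "x \<in> N c" | (outside) "x \<in> outside"
  using assms by (auto simp: outside_def)

lemma closedin_outside: "closedin (top_of_set X) outside"
  unfolding outside_def by (intro closedin_diff openin_Union) (auto intro: N_open)

text \<open>The tubes and \<open>outside\<close> form a finite closed cover. Different tubes are
  disjoint and a tube meets \<open>outside\<close> only where its normal vector has norm
  \<open>1\<close>, so the pieces have to be compared nowhere else.\<close>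

lemma continuous_map_paste:
  assumes S: "S \<subseteq> X"
    and F: "\<And>c. c < m \<Longrightarrow> continuous_map (top_of_set ({0..1} \<times> (N c \<inter> S))) Y (F c)"
    and G: "continuous_map (top_of_set ({0..1} \<times> (outside \<inter> S))) Y G"
    and eq: "\<And>c t x. \<lbrakk>c < m; t \<in> {0..1}; x \<in> N c; x \<in> S; nrm (v c x) = 1\<rbrakk> \<Longrightarrow> F c (t, x) = G (t, x)"
  shows "continuous_map (top_of_set ({0..1} \<times> S)) Y (paste F G)"
\<comment> \<open>Index \<open>m\<close> stands for \<open>outside\<close>, the indices below
  \<open>m\<close> for the tubes.\<close>
proof (rule pasting_lemma_closed[where I = "{..m}"
      and T = "\<lambda>c. {0..1} \<times> ((if c < m then N c else outside) \<inter> S)"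
      and f = "\<lambda>c. if c < m then F c else G"])
  fix c assume "c \<in> {..m}"
  have "closedin (top_of_set X) (if c < m then N c else outside)"
    using N_closed closedin_outside by auto
  then obtain T where "closed T" "(if c < m then N c else outside) = X \<inter> T"
    unfolding closedin_closed by blast
  then have "closedin (top_of_set S) ((if c < m then N c else outside) \<inter> S)"
    unfolding closedin_closed using S by (intro exI[of _ T]) auto
  then show "closedin (top_of_set ({0..1} \<times> S)) ({0..1} \<times> ((if c < m then N c else outside) \<inter> S))"
    by (intro closedin_Times) auto
  show "continuous_map (subtopology (top_of_set ({0..1} \<times> S)) ({0..1} \<times> ((if c < m then N c else outside) \<inter> S))) Y
          (if c < m then F c else G)"
  proof -
    have "({0..1::real} \<times> S) \<inter> ({0..1} \<times> (C \<inter> S)) = {0..1} \<times> (C \<inter> S)" for C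
      by blast
    then show ?thesis
      using F[of c] G by (auto simp: subtopology_subtopology)
  qed
next
  fix i j and z :: "real \<times> 'a"
  assume *: "i \<in> {..m}" "j \<in> {..m}" "z \<in> topspace (top_of_set ({0..1} \<times> S)) \<inter>
    {0..1} \<times> ((if i < m then N i else outside) \<inter> S) \<inter> {0..1} \<times> ((if j < m then N j else outside) \<inter> S)"
  obtain t x where z: "z = (t, x)"
    by fastforce
  have B1: "F c (t, x) = G (t, x)" if "c < m" "x \<in> N c" "x \<in> outside" for c
  proof -
    have "nrm (v c x) = 1"
      using that v_norm[OF that(1,2)] by (force simp: outside_def)
    then show ?thesis
      using that * eq z by auto
  qed
  show "(if i < m then F i else G) z = (if j < m then F j else G) z"
    using * B1 N_disjoint[of i j] unfolding z by (cases "i < m"; cases "j < m"; cases "i = j") auto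
next
  fix z :: "real \<times> 'a" assume z: "z \<in> topspace (top_of_set ({0..1} \<times> S))"
  then obtain t x where tx: "z = (t, x)" "t \<in> {0..1}" "x \<in> S"
    by auto
  show "\<exists>j. j \<in> {..m} \<and> z \<in> {0..1} \<times> ((if j < m then N j else outside) \<inter> S) \<and>
     paste F G z = (if j < m then F j else G) z"
  proof (cases "\<exists>c<m. x \<in> N c")
    case True
    then obtain c where "c < m" "x \<in> N c"
      by blast
    then show ?thesis
      using tx by (intro exI[of _ c]) (auto simp: paste_N)
  next
    case False
    then show ?thesis
      using tx S by (intro exI[of _ m]) (auto simp: paste_def outside_def)
  qed
qed auto

text \<open>The disk normal to a tube, continued from radius \<open>1\<close> to radius \<open>2\<close> by the contraction \<open>K\<close>; on the
  sphere of radius \<open>2\<close> it is constant.\<close>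

definition extend :: "nat \<Rightarrow> 'b \<times> (nat \<Rightarrow> real) \<Rightarrow> 'a" where
  "extend c z = (if nrm (snd z) \<le> 1 then a c z
     else K (nrm (snd z) - 1, a c (fst z, \<lambda>i. (1 / nrm (snd z)) * snd z i)))"

definition disk2 :: "(nat \<Rightarrow> real) set" where
  "disk2 = {w. (\<forall>i\<ge>d. w i = 0) \<and> nrm w \<le> 2}"

lemma outside_subset_V: "outside \<subseteq> V"
  by (force simp: outside_def V_def)

lemma V_subset: "V \<subseteq> X"
  by (auto simp: V_def)

lemma a_V:
  assumes "c < m" "y \<in> P c" "w \<in> disk d" "nrm w \<noteq> 0"
  shows "a c (y, w) \<in> V"
proof -
  have "a c (y, w) \<in> N c"
    using assms a_in by blast
  then show ?thesis
    using assms N_subset N_disjoint v_a by (fastforce simp: V_def)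
qed

lemma normalize_disk:
  assumes "w \<in> disk2" "nrm w \<noteq> 0"
  shows "(\<lambda>i. (1 / nrm w) * w i) \<in> disk d" "nrm (\<lambda>i. (1 / nrm w) * w i) = 1"
  using assms unfolding disk_def disk2_def L2_set_scale by (auto simp: L2_set_divide)

text \<open>At radius \<open>1\<close> the two branches of \<open>extend\<close> agree because
  \<open>K\<close> starts at the identity. From there on the extended disk stays in
  \<open>V\<close>, which is where the radial homotopy \<open>push\<close> will apply.\<close>

lemma extend_outer:
  assumes "c < m" "y \<in> P c" "w \<in> disk2" "1 \<le> nrm w"
  shows "extend c (y, w) = K (nrm w - 1, a c (y, \<lambda>i. (1 / nrm w) * w i))"
    and "extend c (y, w) \<in> V"
proof -
  have w: "nrm w \<noteq> 0" "nrm w \<le> 2"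
    using assms by (auto simp: disk2_def)
  have V: "a c (y, \<lambda>i. (1 / nrm w) * w i) \<in> V"
    using normalize_disk[OF assms(3) w(1)] assms by (intro a_V) auto
  show 1: "extend c (y, w) = K (nrm w - 1, a c (y, \<lambda>i. (1 / nrm w) * w i))"
  proof (cases "nrm w = 1")
    case True
    then show ?thesis
      using K_0[OF V] by (simp add: extend_def)
  next
    case False
    then show ?thesis
      using assms by (simp add: extend_def)
  qed
  show "extend c (y, w) \<in> V"
    unfolding 1 using V assms w by (intro K_in) auto
qed

lemma extend_2:
  assumes "c < m" "y \<in> P c" "w \<in> disk2" "nrm w = 2"
  shows "extend c (y, w) = x\<^sub>0"
proof -
  have "a c (y, \<lambda>i. (1 / nrm w) * w i) \<in> V"
    using normalize_disk[OF assms(3)] assms by (intro a_V) auto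
  then show ?thesis
    using extend_outer(1)[OF assms(1-3)] K_1 assms(4) by simp
qed

lemma extend_in:
  assumes "c < m" "y \<in> P c" "w \<in> disk2"
  shows "extend c (y, w) \<in> X"
proof (cases "nrm w \<le> 1")
  case True
  then have "w \<in> disk d"
    using assms by (auto simp: disk_def disk2_def)
  then show ?thesis
    using True a_in[OF assms(1,2)] N_subset[OF assms(1)] by (auto simp: extend_def)
next
  case False
  then show ?thesis
    using extend_outer(2)[OF assms] V_subset by auto
qed

lemma continuous_on_extend:
  assumes "c < m"
  shows "continuous_on (P c \<times> disk2) (extend c)"
proof -
  have "continuous_on (P c \<times> disk2) (\<lambda>z. if nrm (snd z) \<le> 1 then a c z
     else K (nrm (snd z) - 1, a c (fst z, \<lambda>i. (1 / nrm (snd z)) * snd z i)))"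
  proof (rule continuous_on_cases_le)
    show "continuous_on {t \<in> P c \<times> disk2. nrm (snd t) \<le> 1} (a c)"
      by (rule continuous_on_subset[OF a_cont[OF assms]]) (auto simp: disk_def disk2_def)
    let ?T = "{t \<in> P c \<times> disk2. 1 \<le> nrm (snd t)}"
    have "continuous_on ?T (\<lambda>z. a c (fst z, \<lambda>i. (1 / nrm (snd z)) * snd z i))"
    proof (rule continuous_on_compose2[OF a_cont[OF assms]])
      show "continuous_on ?T (\<lambda>z. (fst z, \<lambda>i. (1 / nrm (snd z)) * snd z i))"
        by (intro continuous_intros) auto
      show "(\<lambda>z. (fst z, \<lambda>i. (1 / nrm (snd z)) * snd z i)) ` ?T \<subseteq> P c \<times> disk d"
        using normalize_disk(1) by fastforce
    qed
    then show "continuous_on ?T (\<lambda>z. K (nrm (snd z) - 1, a c (fst z, \<lambda>i. (1 / nrm (snd z)) * snd z i)))"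
    proof (intro continuous_on_compose2[OF K_cont] continuous_intros)
      show "(\<lambda>z. (nrm (snd z) - 1, a c (fst z, \<lambda>i. (1 / nrm (snd z)) * snd z i))) ` ?T \<subseteq> {0..1} \<times> V"
        using normalize_disk assms by (fastforce simp: disk2_def intro!: a_V)
    qed
    show "continuous_on (P c \<times> disk2) (\<lambda>z. nrm (snd z))"
      by (intro continuous_intros)
    fix z assume z: "z \<in> P c \<times> disk2" "nrm (snd z) = 1"
    then have "a c z \<in> V"
      using a_V[OF assms, of "fst z" "snd z"] by (auto simp: disk_def disk2_def)
    then show "a c z = K (nrm (snd z) - 1, a c (fst z, \<lambda>i. (1 / nrm (snd z)) * snd z i))"
      using z K_0 by simp
  qed
  then show ?thesis
    by (simp add: extend_def[abs_def])
qed

lemma scale_disk2: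
  assumes "w \<in> disk d" "0 \<le> s" "s \<le> 2"
  shows "(\<lambda>i. s * w i) \<in> disk2"
proof -
  have "s * nrm w \<le> 2 * 1"
    using assms by (intro mult_mono) (auto simp: disk_def)
  then show ?thesis
    using assms by (auto simp: disk2_def disk_def L2_set_scale)
qed


lemma norm_double: "nrm (\<lambda>i. 2 * w i) = 2 * nrm w"
  using L2_set_scale[of 2 w "{..<d}"] by simp

section \<open>The collapse map and its null-homotopy off the cores\<close>

definition collapse :: "'a \<Rightarrow> (nat \<times> (nat \<Rightarrow> real)) option" where
  "collapse x = paste (\<lambda>c z. disk_to_wedge d c (v c (snd z))) (\<lambda>_. None) (0, x)"

text \<open>At time \<open>s\<close> the factor turns norm \<open>r\<close> into
  \<open>(1 - s) * r + s\<close>: normal vectors move radially to the boundary, which is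
  \<open>None\<close> in the wedge. On \<open>V\<close> the norm \<open>r\<close> is positive, so
  the quotient makes sense.\<close>

definition push :: "real \<times> 'a \<Rightarrow> (nat \<times> (nat \<Rightarrow> real)) option" where
  "push = paste (\<lambda>c z. disk_to_wedge d c
     (\<lambda>i. ((1 - fst z) + fst z / nrm (v c (snd z))) * v c (snd z) i)) (\<lambda>_. None)"

lemma None_in_wedge: "None \<in> topspace (sphere_wedge m d)"
  by (simp add: sphere_wedge_def topspace_wedge)

lemma collapse_N: "\<lbrakk>c < m; x \<in> N c\<rbrakk> \<Longrightarrow> collapse x = disk_to_wedge d c (v c x)"
  by (simp add: collapse_def paste_N)

lemma collapse_outside:
  assumes "x \<in> outside"
  shows "collapse x = None"
  unfolding collapse_def using disk_to_wedge_eq_None_iff[OF v_in]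
  by (subst paste_outside[OF assms]) auto

lemma continuous_map_on_tube:
  assumes "c < m" "continuous_on T g" "g ` T \<subseteq> disk d"
  shows "continuous_map (top_of_set T) (sphere_wedge m d) (\<lambda>z. disk_to_wedge d c (g z))"
proof -
  have "continuous_map (top_of_set T) (sphere_wedge m d) (disk_to_wedge d c \<circ> g)"
    using assms(2,3) continuous_map_disk_to_wedge[OF d_pos assms(1)]
    by (intro continuous_map_compose[where X' = "top_of_set (disk d)"]) auto
  then show ?thesis
    by (simp add: o_def)
qed

lemma continuous_map_collapse: "continuous_map (top_of_set X) (sphere_wedge m d) collapse"
proof -
  let ?H = "paste (\<lambda>c z. disk_to_wedge d c (v c (snd z))) (\<lambda>_. None)"
  have "continuous_map (top_of_set ({0..1} \<times> X)) (sphere_wedge m d) ?H"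
  proof (rule continuous_map_paste)
    fix c assume c: "c < m"
    have "continuous_on ({0..1::real} \<times> (N c \<inter> X)) (\<lambda>z. v c (snd z))"
      by (rule continuous_on_compose2[OF v_cont[OF c]]) (auto intro!: continuous_intros)
    then show "continuous_map (top_of_set ({0..1::real} \<times> (N c \<inter> X))) (sphere_wedge m d)
       (\<lambda>z. disk_to_wedge d c (v c (snd z)))"
      using c v_in by (intro continuous_map_on_tube) auto
  qed (use None_in_wedge disk_to_wedge_eq_None_iff v_in in auto)
  moreover have "continuous_map (top_of_set X) (top_of_set ({0..1} \<times> X)) (\<lambda>x. (0::real, x))"
    unfolding continuous_map_subtopology_eu by (intro conjI continuous_intros) auto
  ultimately have "continuous_map (top_of_set X) (sphere_wedge m d) (?H \<circ> (\<lambda>x. (0, x)))"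
    by (intro continuous_map_compose)
  then show ?thesis
    by (simp add: collapse_def[abs_def] o_def)
qed

lemma V_norm:
  assumes "c < m" "x \<in> N c" "x \<in> V"
  shows "0 < nrm (v c x)"
proof -
  have "nrm (v c x) \<noteq> 0"
    using assms by (auto simp: V_def)
  then show ?thesis
    using L2_set_nonneg[of "v c x" "{..<d}"] by linarith
qed

lemma push_disk:
  assumes "c < m" "x \<in> N c" "x \<in> V" "s \<in> {0..1}"
  shows "(\<lambda>i. ((1 - s) + s / nrm (v c x)) * v c x i) \<in> disk d"
proof (rule disk_scale)
  have r: "0 < nrm (v c x)" "nrm (v c x) \<le> 1"
    using assms V_norm v_norm by auto
  have "0 \<le> (1 - s) + s / nrm (v c x)"
    using r assms(4) by auto
  then have "\<bar>(1 - s) + s / nrm (v c x)\<bar> * nrm (v c x) = ((1 - s) + s / nrm (v c x)) * nrm (v c x)"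
    by simp
  also have "\<dots> = (1 - s) * nrm (v c x) + s"
    using r by (simp add: field_simps)
  also have "\<dots> \<le> (1 - s) * 1 + s"
    using r assms(4) by (intro add_right_mono mult_left_mono) auto
  finally show "\<bar>(1 - s) + s / nrm (v c x)\<bar> * nrm (v c x) \<le> 1"
    by simp
qed (use assms v_in in auto)

lemma push_N:
  assumes "c < m" "x \<in> N c"
  shows "push (s, x) = disk_to_wedge d c (\<lambda>i. ((1 - s) + s / nrm (v c x)) * v c x i)"
  using assms by (simp add: push_def paste_N)

lemma push_unit:
  assumes "c < m" "x \<in> N c" "nrm (v c x) = 1"
  shows "disk_to_wedge d c (\<lambda>i. ((1 - s) + s / nrm (v c x)) * v c x i) = None"
  using assms v_in disk_to_wedge_eq_None_iff by auto

lemma push_outside: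
  assumes "x \<in> outside"
  shows "push (s, x) = None"
  unfolding push_def using push_unit by (subst paste_outside[OF assms]) auto

lemma continuous_map_push: "continuous_map (top_of_set ({0..1} \<times> V)) (sphere_wedge m d) push"
  unfolding push_def
proof (rule continuous_map_paste)
  fix c assume c: "c < m"
  let ?T = "{0..1::real} \<times> (N c \<inter> V)"
  have v: "continuous_on ?T (\<lambda>z. v c (snd z))"
    by (rule continuous_on_compose2[OF v_cont[OF c]]) (auto intro!: continuous_intros)
  have "continuous_on ?T (\<lambda>z i. ((1 - fst z) + fst z / nrm (v c (snd z))) * v c (snd z) i)"
    using V_norm[OF c]
    by (intro continuous_intros v continuous_on_product_then_coordinatewise[OF v]) force
  then show "continuous_map (top_of_set ?T) (sphere_wedge m d)
     (\<lambda>z. disk_to_wedge d c (\<lambda>i. ((1 - fst z) + fst z / nrm (v c (snd z))) * v c (snd z) i))"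
    using c push_disk[OF c] by (intro continuous_map_on_tube) auto
qed (use None_in_wedge push_unit V_subset in auto)

lemma push_0:
  assumes "x \<in> V"
  shows "push (0, x) = collapse x"
proof (rule X_cases[of x])
  show "x \<in> X"
    using assms V_subset by blast
qed (simp_all add: push_N collapse_N push_outside collapse_outside)

lemma push_1:
  assumes "x \<in> V"
  shows "push (1, x) = None"
proof (rule X_cases[of x])
  fix c assume c: "c < m" "x \<in> N c"
  then have "disk_to_wedge d c (\<lambda>i. (1 / nrm (v c x)) * v c x i) = None"
    using push_disk[OF c assms, of 1] V_norm[OF c assms]
    by (subst disk_to_wedge_eq_None_iff) (simp_all add: L2_set_divide)
  then show ?thesis
    using c by (simp add: push_N)
qed (use assms V_subset push_outside in auto)

text \<open>The template of both homotopies of \<open>X\<close>: in a tube the point runs through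
  the extended normal disks with moving foot point \<open>q\<close> and moving vector
  \<open>w\<close>, and outside the tubes it follows \<open>G\<close>.\<close>

lemma homotopy_on_X:
  assumes c1: "\<And>c. c < m \<Longrightarrow> continuous_on ({0..1} \<times> N c) (\<lambda>z. q c z)"
    and c2: "\<And>c. c < m \<Longrightarrow> continuous_on ({0..1} \<times> N c) (\<lambda>z. w c z)"
    and in1: "\<And>c t x. \<lbrakk>c < m; t \<in> {0..1}; x \<in> N c\<rbrakk> \<Longrightarrow> q c (t, x) \<in> P c"
    and in2: "\<And>c t x. \<lbrakk>c < m; t \<in> {0..1}; x \<in> N c\<rbrakk> \<Longrightarrow> w c (t, x) \<in> disk2"
    and G: "continuous_on ({0..1} \<times> outside) G" "\<And>t x. \<lbrakk>t \<in> {0..1}; x \<in> outside\<rbrakk> \<Longrightarrow> G (t, x) \<in> X"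
    and eq: "\<And>c t x. \<lbrakk>c < m; t \<in> {0..1}; x \<in> N c; nrm (v c x) = 1\<rbrakk> \<Longrightarrow> extend c (q c (t, x), w c (t, x)) = G (t, x)"
  shows "continuous_map (prod_topology (top_of_set {0..1}) (top_of_set X)) (top_of_set X)
    (paste (\<lambda>c z. extend c (q c z, w c z)) G)"
proof -
  have "continuous_map (top_of_set ({0..1} \<times> X)) (top_of_set X) (paste (\<lambda>c z. extend c (q c z, w c z)) G)"
  proof (rule continuous_map_paste)
    fix c assume c: "c < m"
    have NX: "N c \<inter> X = N c"
      using N_subset[OF c] by blast
    have "continuous_on ({0..1} \<times> N c) (\<lambda>z. extend c (q c z, w c z))"
      by (rule continuous_on_compose2[OF continuous_on_extend[OF c]])
        (use c1 c2 c in1 in2 in \<open>auto intro!: continuous_on_Pair\<close>)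
    then show "continuous_map (top_of_set ({0..1} \<times> (N c \<inter> X))) (top_of_set X) (\<lambda>z. extend c (q c z, w c z))"
      unfolding NX using in1 in2 c extend_in by auto
  next
    have "outside \<inter> X = outside"
      by (auto simp: outside_def)
    then show "continuous_map (top_of_set ({0..1} \<times> (outside \<inter> X))) (top_of_set X) G"
      using G by auto
  qed (use eq in auto)
  then show ?thesis
    by (simp add: prod_topology_subtopology_eu)
qed

text \<open>The map \<open>mid\<close> stretches every normal disk to radius \<open>2\<close> and
  sends \<open>outside\<close> to \<open>x\<^sub>0\<close>. Letting the radius grow while
  \<open>K\<close> acts outside joins it to the identity; contracting the foot points in
  \<open>P c\<close> joins it to \<open>g \<circ> collapse\<close>. On the wedge,
  \<open>mid'\<close> doubles the inner half of each disk and sends the outer half to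
  \<open>None\<close>; \<open>push\<close> erases what \<open>collapse\<close> makes of the outer
  part of \<open>g\<close>.\<close>

lemma homotopy_equivalent_sphere_wedge: "top_of_set X homotopy_equivalent_space sphere_wedge m d"
proof -
  let ?W = "sphere_wedge m d" and ?I = "top_of_set {0..1::real}"
  \<comment> \<open>A homotopy constant in time, of which \<open>g\<close> is the value at time
    \<open>0\<close>. Doubling turns the unit disk into \<open>disk2\<close>, and the disks fit
    together because \<open>extend\<close> is \<open>x\<^sub>0\<close> on the sphere of radius
    \<open>2\<close>.\<close>
  obtain G0 where G0: "continuous_map (prod_topology ?I ?W) (top_of_set X) G0"
    "\<And>c t w. \<lbrakk>c < m; t \<in> {0..1}; w \<in> disk d\<rbrakk> \<Longrightarrow> G0 (t, disk_to_wedge d c w) = extend c (h c, \<lambda>i. 2 * w i)"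
  proof (rule sphere_wedge_homotopy_lift[OF d_pos m_pos])
    fix c assume c: "c < m"
    have "continuous_on ({0..1::real} \<times> disk d) (\<lambda>z. extend c (h c, \<lambda>i. 2 * snd z i))"
      by (rule continuous_on_compose2[OF continuous_on_extend[OF c]])
        (use h_in[OF c] scale_disk2 in \<open>auto intro!: continuous_intros\<close>)
    then show "continuous_map (top_of_set ({0..1::real} \<times> disk d)) (top_of_set X) (\<lambda>z. extend c (h c, \<lambda>i. 2 * snd z i))"
      using c h_in extend_in scale_disk2 by auto
  next
    fix c c' :: nat and t :: real and w w'
    assume "c < m" "c' < m" "w \<in> disk d" "w' \<in> disk d" "nrm w = 1" "nrm w' = 1"
    then show "extend c (h c, \<lambda>i. 2 * snd (t, w) i) = extend c' (h c', \<lambda>i. 2 * snd (t, w') i)"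
      using scale_disk2[of _ 2] by (simp add: extend_2 h_in norm_double)
  qed (use that in auto)
  define g where "g w = G0 (0, w)" for w
  have g_eq: "g (disk_to_wedge d c w) = extend c (h c, \<lambda>i. 2 * w i)" if "c < m" "w \<in> disk d" for c w
    using G0(2)[of c 0] that by (simp add: g_def)
  have g_None: "g None = x\<^sub>0"
  proof -
    obtain c w where cw: "c < m" "w \<in> disk d" "None = disk_to_wedge d c w"
      using sphere_wedge_cases[OF d_pos m_pos None_in_wedge] by metis
    then have "nrm w = 1"
      using disk_to_wedge_eq_None_iff by metis
    moreover have "g None = extend c (h c, \<lambda>i. 2 * w i)"
      unfolding cw(3) by (rule g_eq[OF cw(1,2)])
    ultimately show ?thesis
      using cw scale_disk2[of w 2] by (simp add: extend_2 h_in norm_double)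
  qed
  have g_cont: "continuous_map ?W (top_of_set X) g"
  proof -
    have "continuous_map ?W (prod_topology ?I ?W) (\<lambda>w. (0, w))"
      by (auto simp: continuous_map_pairwise o_def)
    then have "continuous_map ?W (top_of_set X) (G0 \<circ> (\<lambda>w. (0, w)))"
      using G0(1) by (rule continuous_map_compose)
    then show ?thesis
      by (simp add: g_def[abs_def] o_def)
  qed
  define mid where "mid x = paste (\<lambda>c z. extend c (p c (snd z), \<lambda>i. 2 * v c (snd z) i)) (\<lambda>_. x\<^sub>0) (0, x)" for x
  have v_snd: "continuous_on ({0..1::real} \<times> N c) (\<lambda>z. v c (snd z))" if "c < m" for c
    by (rule continuous_on_compose2[OF v_cont[OF that]]) (auto intro!: continuous_intros)
  have p_snd: "continuous_on ({0..1::real} \<times> N c) (\<lambda>z. p c (snd z))" if "c < m" for c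
    by (rule continuous_on_compose2[OF p_cont[OF that]]) (auto intro!: continuous_intros)
  have mid_N: "mid x = extend c (p c x, \<lambda>i. 2 * v c x i)" if "c < m" "x \<in> N c" for c x
    using that by (simp add: mid_def paste_N)
  have mid_outside: "mid x = x\<^sub>0" if "x \<in> outside" for x
    unfolding mid_def
    by (subst paste_outside[OF that]) (auto simp: extend_2 p_in scale_disk2 v_in norm_double)
  \<comment> \<open>A point of \<open>outside\<close> lies in \<open>V\<close>, and \<open>K\<close>
    carries it to \<open>x\<^sub>0\<close> within \<open>V\<close>. If \<open>outside\<close> is
    empty, no value of the constant piece has to lie in \<open>X\<close>.\<close>
  have "outside \<noteq> {} \<Longrightarrow> x\<^sub>0 \<in> X"
    using K_1 K_in[of 1] V_subset outside_subset_V by force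
  then have "homotopic_with (\<lambda>_. True) (top_of_set X) (top_of_set X) mid (g \<circ> collapse)"
  proof (subst homotopic_with, simp, intro exI[of _ "paste (\<lambda>c z. extend c (\<eta> c (fst z, p c (snd z)), \<lambda>i. 2 * v c (snd z) i)) (\<lambda>_. x\<^sub>0)"] conjI ballI TrueI)
    show "continuous_map (prod_topology ?I (top_of_set X)) (top_of_set X)
      (paste (\<lambda>c z. extend c (\<eta> c (fst z, p c (snd z)), \<lambda>i. 2 * v c (snd z) i)) (\<lambda>_. x\<^sub>0))"
    proof (rule homotopy_on_X)
      fix c assume c: "c < m"
      show "continuous_on ({0..1} \<times> N c) (\<lambda>z. \<eta> c (fst z, p c (snd z)))"
        by (rule continuous_on_compose2[OF \<eta>_cont[OF c]])
          (use p_snd[OF c] p_in[OF c] in \<open>auto intro!: continuous_intros\<close>)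
      show "continuous_on ({0..1::real} \<times> N c) (\<lambda>z i. 2 * v c (snd z) i)"
        by (intro continuous_intros v_snd[OF c])
    next
      show "x\<^sub>0 \<in> X" if "x \<in> outside" for x
        using that \<open>outside \<noteq> {} \<Longrightarrow> x\<^sub>0 \<in> X\<close> by blast
    qed (auto simp: extend_2 \<eta>_in p_in scale_disk2 v_in norm_double)
  next
    fix x assume x: "x \<in> topspace (top_of_set X)"
    then have "x \<in> X"
      by simp
    then show "paste (\<lambda>c z. extend c (\<eta> c (fst z, p c (snd z)), \<lambda>i. 2 * v c (snd z) i)) (\<lambda>_. x\<^sub>0) (0, x) = mid x"
    proof (cases rule: X_cases)
      case (N c)
      then show ?thesis
        by (simp add: paste_N mid_N \<eta>_0 p_in)
    next
      case outside
      show ?thesis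
        unfolding mid_outside[OF outside]
        by (subst paste_outside[OF outside]) (auto simp: extend_2 \<eta>_0 p_in scale_disk2 v_in norm_double)
    qed
    show "paste (\<lambda>c z. extend c (\<eta> c (fst z, p c (snd z)), \<lambda>i. 2 * v c (snd z) i)) (\<lambda>_. x\<^sub>0) (1, x) = (g \<circ> collapse) x"
      using \<open>x \<in> X\<close>
    proof (cases rule: X_cases)
      case (N c)
      then show ?thesis
        by (simp add: paste_N collapse_N \<eta>_1 p_in g_eq v_in)
    next
      case outside
      then have "(g \<circ> collapse) x = x\<^sub>0"
        by (simp add: collapse_outside g_None)
      then show ?thesis
        by (subst paste_outside[OF outside]) (auto simp: extend_2 \<eta>_1 h_in p_in scale_disk2 v_in norm_double)
    qed
  qed
  moreover have "homotopic_with (\<lambda>_. True) (top_of_set X) (top_of_set X) id mid"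
  proof (subst homotopic_with, simp, intro exI[of _ "paste (\<lambda>c z. extend c (p c (snd z), \<lambda>i. (1 + fst z) * v c (snd z) i)) K"] conjI ballI TrueI)
    \<comment> \<open>For a unit normal vector, the radius \<open>1 + t\<close> is exactly the one
      at which \<open>extend\<close> has followed \<open>K\<close> up to time \<open>t\<close>; this
      matches the tube piece with \<open>K\<close> outside.\<close>
    have K': "extend c (p c x, \<lambda>i. (1 + t) * v c x i) = K (t, x)"
      if "c < m" "t \<in> {0..1}" "x \<in> N c" "nrm (v c x) = 1" for c t x
    proof -
      have n: "nrm (\<lambda>i. (1 + t) * v c x i) = 1 + t"
        using that by (simp add: L2_set_scale)
      have "1 / (1 + t) * ((1 + t) * y) = y" for y
        using that(2) by simp
      then have "(\<lambda>i. 1 / (1 + t) * ((1 + t) * v c x i)) = v c x"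
        by blast
      then show ?thesis
        using that extend_outer(1)[of c "p c x" "\<lambda>i. (1 + t) * v c x i"] scale_disk2[of "v c x" "1 + t"] v_in[of c x]
        by (simp add: n p_in a_pv)
    qed
    show "continuous_map (prod_topology ?I (top_of_set X)) (top_of_set X)
      (paste (\<lambda>c z. extend c (p c (snd z), \<lambda>i. (1 + fst z) * v c (snd z) i)) K)"
    proof (rule homotopy_on_X)
      fix c assume c: "c < m"
      show "continuous_on ({0..1} \<times> N c) (\<lambda>z i. (1 + fst z) * v c (snd z) i)"
        by (intro continuous_intros v_snd[OF c])
    next
      show "continuous_on ({0..1} \<times> outside) K"
        by (rule continuous_on_subset[OF K_cont]) (use outside_subset_V in auto)
      show "K (t, x) \<in> X" if "t \<in> {0..1}" "x \<in> outside" for t x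
        using K_in[of t x] that outside_subset_V V_subset by blast
    qed (use K' p_snd p_in v_in scale_disk2 K_in outside_subset_V V_subset in auto)
    fix x assume x: "x \<in> topspace (top_of_set X)"
    then have "x \<in> X"
      by simp
    then show "paste (\<lambda>c z. extend c (p c (snd z), \<lambda>i. (1 + fst z) * v c (snd z) i)) K (0, x) = id x"
    proof (cases rule: X_cases)
      case (N c)
      then show ?thesis
        using v_norm[OF N] by (simp add: paste_N extend_def a_pv)
    next
      case outside
      then show ?thesis
        using K'[of _ 0] K_0 outside_subset_V by (subst paste_outside[OF outside]) auto
    qed
    show "paste (\<lambda>c z. extend c (p c (snd z), \<lambda>i. (1 + fst z) * v c (snd z) i)) K (1, x) = mid x"
      using \<open>x \<in> X\<close>
    proof (cases rule: X_cases)
      case (N c)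
      then show ?thesis
        by (simp add: paste_N mid_N)
    next
      case outside
      then show ?thesis
        using K'[of _ 1] K_1 outside_subset_V mid_outside[OF outside] by (subst paste_outside[OF outside]) auto
    qed
  qed
  ultimately have "homotopic_with (\<lambda>_. True) (top_of_set X) (top_of_set X) id (g \<circ> collapse)"
    by (meson homotopic_with_trans)
  then have gf: "homotopic_with (\<lambda>_. True) (top_of_set X) (top_of_set X) (g \<circ> collapse) id"
    by (rule homotopic_with_symD)
  \<comment> \<open>Radial retraction onto the unit disk. It allows a disk to be doubled within
    itself, the overflow landing on the boundary, that is, at \<open>None\<close>.\<close>
  define clamp where "clamp w = (\<lambda>i. (1 / max 1 (nrm w)) * w i)" for w :: "nat \<Rightarrow> real"
  have clamp_disk: "clamp (\<lambda>i. (1 + s) * w i) \<in> disk d" if "w \<in> disk d" for s w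
  proof -
    have "(1 / max 1 (nrm (\<lambda>i. (1 + s) * w i))) * nrm (\<lambda>i. (1 + s) * w i) \<le> 1"
      by (simp add: divide_simps)
    then show ?thesis
      using that by (auto simp: disk_def clamp_def L2_set_divide)
  qed
  have outer: "extend c (h c, \<lambda>i. 2 * w i) \<in> V" if "c < m" "w \<in> disk d" "1 / 2 \<le> nrm w" for c w
    using that by (intro extend_outer(2)) (auto simp: h_in scale_disk2 norm_double)
  have unit_None: "disk_to_wedge d c (\<lambda>i. 2 * w i) = None" "push (t, extend c (h c, \<lambda>i. 2 * w i)) = None"
    if "c < m" "w \<in> disk d" "nrm w = 1 / 2" for c w t
  proof -
    have w: "(\<lambda>i. 2 * w i) \<in> disk d"
      using that by (intro disk_scale) auto
    show "disk_to_wedge d c (\<lambda>i. 2 * w i) = None"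
      using that by (simp add: disk_to_wedge_eq_None_iff[OF w] norm_double)
    have "extend c (h c, \<lambda>i. 2 * w i) = a c (h c, \<lambda>i. 2 * w i)"
      using that by (simp add: extend_def norm_double)
    moreover have "a c (h c, \<lambda>i. 2 * w i) \<in> N c" "nrm (v c (a c (h c, \<lambda>i. 2 * w i))) = 1"
      using a_in v_a h_in w that by (auto simp: norm_double)
    ultimately show "push (t, extend c (h c, \<lambda>i. 2 * w i)) = None"
      using that push_unit push_N by metis
  qed
  \<comment> \<open>From \<open>collapse \<circ> g\<close> to \<open>mid'\<close>: the inner half is
    already doubling and stays fixed, the outer half is carried to \<open>None\<close>. At norm
    \<open>1 / 2\<close> both pieces are \<open>None\<close> at all times.\<close>
  let ?F1 = "\<lambda>c (z::real \<times> (nat \<Rightarrow> real)). if nrm (snd z) \<le> 1 / 2 then disk_to_wedge d c (\<lambda>i. 2 * snd z i)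
        else push (fst z, extend c (h c, \<lambda>i. 2 * snd z i))"
  obtain G1 where G1: "continuous_map (prod_topology ?I ?W) ?W G1"
    "\<And>c t w. \<lbrakk>c < m; t \<in> {0..1}; w \<in> disk d\<rbrakk> \<Longrightarrow> G1 (t, disk_to_wedge d c w) = ?F1 c (t, w)"
  proof (rule sphere_wedge_homotopy_lift[OF d_pos m_pos])
    fix c assume c: "c < m"
    let ?T = "{0..1} \<times> disk d"
    show "continuous_map (top_of_set ?T) ?W (?F1 c)"
    proof (rule continuous_map_cases_le)
      show "continuous_map (top_of_set ?T) euclideanreal (\<lambda>z. nrm (snd z))"
        "continuous_map (top_of_set ?T) euclideanreal (\<lambda>z. 1 / 2)"
        by (auto intro!: continuous_intros)
      have "continuous_map (top_of_set {z \<in> ?T. nrm (snd z) \<le> 1 / 2}) ?W (\<lambda>z. disk_to_wedge d c (\<lambda>i. 2 * snd z i))"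
        by (rule continuous_map_on_tube[OF c]) (auto intro!: continuous_intros simp: disk_def norm_double)
      then show "continuous_map (subtopology (top_of_set ?T) {z \<in> topspace (top_of_set ?T). nrm (snd z) \<le> 1 / 2}) ?W
          (\<lambda>z. disk_to_wedge d c (\<lambda>i. 2 * snd z i))"
        by (simp add: subtopology_subtopology Collect_conj_eq[symmetric] Int_def)
      let ?T2 = "{z \<in> ?T. 1 / 2 \<le> nrm (snd z)}"
      have "continuous_on ?T2 (\<lambda>z. (fst z, extend c (h c, \<lambda>i. 2 * snd z i)))"
        by (intro continuous_on_Pair continuous_on_compose2[OF continuous_on_extend[OF c]])
          (use h_in[OF c] scale_disk2 in \<open>auto intro!: continuous_intros\<close>)
      then have "continuous_map (top_of_set ?T2) (top_of_set ({0..1} \<times> V)) (\<lambda>z. (fst z, extend c (h c, \<lambda>i. 2 * snd z i)))"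
        using outer[OF c] by auto
      then have "continuous_map (top_of_set ?T2) ?W (push \<circ> (\<lambda>z. (fst z, extend c (h c, \<lambda>i. 2 * snd z i))))"
        by (rule continuous_map_compose) (rule continuous_map_push)
      then show "continuous_map (subtopology (top_of_set ?T) {z \<in> topspace (top_of_set ?T). 1 / 2 \<le> nrm (snd z)}) ?W
          (\<lambda>z. push (fst z, extend c (h c, \<lambda>i. 2 * snd z i)))"
        by (simp add: subtopology_subtopology Collect_conj_eq[symmetric] Int_def o_def)
    qed (use unit_None[OF c] in auto)
  next
    fix c c' :: nat and t :: real and w w'
    assume "c < m" "c' < m" "w \<in> disk d" "w' \<in> disk d" "nrm w = 1" "nrm w' = 1"
    then show "?F1 c (t, w) = ?F1 c' (t, w')"
      using scale_disk2[of _ 2] by (simp add: extend_2 h_in norm_double)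
  qed (use that in auto)
  \<comment> \<open>From the identity to \<open>mid'\<close>: the stretching factor grows from
    \<open>1\<close> to \<open>2\<close>.\<close>
  let ?F2 = "\<lambda>c (z::real \<times> (nat \<Rightarrow> real)). disk_to_wedge d c (clamp (\<lambda>i. (1 + fst z) * snd z i))"
  obtain G2 where G2: "continuous_map (prod_topology ?I ?W) ?W G2"
    "\<And>c t w. \<lbrakk>c < m; t \<in> {0..1}; w \<in> disk d\<rbrakk> \<Longrightarrow> G2 (t, disk_to_wedge d c w) = ?F2 c (t, w)"
  proof (rule sphere_wedge_homotopy_lift[OF d_pos m_pos])
    fix c assume c: "c < m"
    have *: "continuous_on ({0..1} \<times> disk d) (\<lambda>z i. (1 + fst z) * snd z i)"
      by (intro continuous_intros)
    have "continuous_on ({0..1} \<times> disk d) (\<lambda>z. clamp (\<lambda>i. (1 + fst z) * snd z i))"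
      unfolding clamp_def
      by (intro continuous_intros * continuous_on_product_then_coordinatewise[OF *]) auto
    then show "continuous_map (top_of_set ({0..1} \<times> disk d)) ?W (?F2 c)"
      using clamp_disk by (intro continuous_map_on_tube[OF c]) auto
  next
    fix c c' :: nat and t :: real and w w'
    assume *: "c < m" "c' < m" "t \<in> {0..1}" "w \<in> disk d" "w' \<in> disk d" "nrm w = 1" "nrm w' = 1"
    have "nrm (clamp (\<lambda>i. (1 + t) * u i)) = 1" if "nrm u = 1" for u
      using that * by (simp add: clamp_def L2_set_scale L2_set_divide max_def)
    then show "?F2 c (t, w) = ?F2 c' (t, w')"
      using * clamp_disk by (simp add: disk_to_wedge_eq_iff)
  qed (use that in auto)
  have W_cases: "(\<forall>w\<in>topspace ?W. Q w) \<longleftrightarrow> (\<forall>c<m. \<forall>w\<in>disk d. Q (disk_to_wedge d c w))" for Q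
    using sphere_wedge_cases[OF d_pos m_pos] continuous_map_image_subset_topspace[OF continuous_map_disk_to_wedge[OF d_pos]]
    by (metis image_subset_iff topspace_euclidean_subtopology)
  define mid' where "mid' w = G1 (1, w)" for w
  have "homotopic_with (\<lambda>_. True) ?W ?W (collapse \<circ> g) mid'"
  proof (subst homotopic_with, simp, intro exI[of _ G1] conjI)
    show "\<forall>w\<in>topspace ?W. G1 (0, w) = (collapse \<circ> g) w"
      unfolding W_cases
    proof (intro allI impI ballI)
      fix c w assume cw: "c < m" "w \<in> disk d"
      show "G1 (0, disk_to_wedge d c w) = (collapse \<circ> g) (disk_to_wedge d c w)"
      proof (cases "nrm w \<le> 1 / 2")
        case True
        then have "(\<lambda>i. 2 * w i) \<in> disk d"
          using cw by (intro disk_scale) auto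
        then have "collapse (a c (h c, \<lambda>i. 2 * w i)) = disk_to_wedge d c (\<lambda>i. 2 * w i)"
          using cw a_in v_a h_in by (subst collapse_N) auto
        then show ?thesis
          using True cw by (simp add: G1 g_eq extend_def norm_double)
      next
        case False
        then show ?thesis
          using cw outer[OF cw] by (simp add: G1 g_eq push_0)
      qed
    qed
  qed (use G1(1) in \<open>auto simp: mid'_def\<close>)
  moreover have "homotopic_with (\<lambda>_. True) ?W ?W id mid'"
  proof (subst homotopic_with, simp, intro exI[of _ G2] conjI)
    show "\<forall>w\<in>topspace ?W. G2 (0, w) = id w"
      unfolding W_cases using G2(2)[of _ 0] by (auto simp: clamp_def disk_def max_def)
    show "\<forall>w\<in>topspace ?W. G2 (1, w) = mid' w"
      unfolding W_cases
    proof (intro allI impI ballI)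
      fix c w assume cw: "c < m" "w \<in> disk d"
      show "G2 (1, disk_to_wedge d c w) = mid' (disk_to_wedge d c w)"
      proof (cases "nrm w \<le> 1 / 2")
        case True
        then have "max 1 (2 * nrm w) = 1"
          by simp
        then show ?thesis
          using cw True by (simp add: G1 G2 mid'_def clamp_def norm_double)
      next
        case False
        then have "nrm (clamp (\<lambda>i. 2 * w i)) = 1"
          by (simp add: clamp_def L2_set_divide norm_double max_def)
        then have "disk_to_wedge d c (clamp (\<lambda>i. 2 * w i)) = None"
          using clamp_disk[of w 1] cw by (simp add: disk_to_wedge_eq_None_iff)
        then show ?thesis
          using cw outer[OF cw] False by (simp add: G1 G2 mid'_def push_1)
      qed
    qed
  qed (use G2(1) in auto)
  then have "homotopic_with (\<lambda>_. True) ?W ?W mid' id"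
    by (rule homotopic_with_symD)
  ultimately have "homotopic_with (\<lambda>_. True) ?W ?W (collapse \<circ> g) id"
    by (rule homotopic_with_trans)
  then show ?thesis
    unfolding homotopy_equivalent_space_def using gf g_cont continuous_map_collapse by blast
qed

end

section \<open>The combinatorics of the cells\<close>

text \<open>
  In the sphere of directions of \<open>k + 1\<close> coordinates these cells are arcs joining the points where
  all coordinates but one agree; they form a spanning tree: a star around each of the two points where
  the odd coordinate is \<open>k\<close>, and one arc between the stars.
\<close>

definition base_cells :: "nat \<Rightarrow> (nat set \<times> nat set) set" where
  "base_cells k = (\<lambda>j. ({..<k} - {j}, {j})) ` {..<k} \<union> (\<lambda>j. ({..<k} - {j}, {k})) ` {..<k} \<union> {({2..k}, {1})}"

text \<open>The set \<open>cells k r\<close> belongs to configurations of \<open>k + 1 + r\<close> coordinates.\<close>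

primrec cells :: "nat \<Rightarrow> nat \<Rightarrow> (nat set \<times> nat set) set" where
  "cells k 0 = base_cells k"
| "cells k (Suc r) = {(T, U). T \<subseteq> {..<k + 1 + r} \<and> card T = k - 1 \<and> U \<subseteq> {..k + 1 + r} - T \<and>
     ((T, U \<inter> {..<k + 1 + r}) \<in> cells k r \<or>
      (if U \<inter> {..<k + 1 + r} = {..<k + 1 + r} - T then k + 1 + r \<notin> U else k + 1 + r \<in> U))}"

lemma mem_cells_Suc:
  "(T, U) \<in> cells k (Suc r) \<longleftrightarrow> T \<subseteq> {..<k + 1 + r} \<and> card T = k - 1 \<and> U \<subseteq> {..k + 1 + r} - T \<and>
     ((T, U \<inter> {..<k + 1 + r}) \<in> cells k r \<or>
      (if U \<inter> {..<k + 1 + r} = {..<k + 1 + r} - T then k + 1 + r \<notin> U else k + 1 + r \<in> U))"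
  by (simp only: cells.simps mem_Collect_eq split)

declare cells.simps(2) [simp del]

lemma base_cells_two_sided:
  assumes "3 \<le> k" "(T, U) \<in> base_cells k"
  shows "T \<subseteq> {..<k + 1} \<and> card T = k - 1 \<and> U \<subseteq> {..<k + 1} - T \<and> U \<noteq> {} \<and> U \<noteq> {..<k + 1} - T"
proof -
  consider j where "j < k" "T = {..<k} - {j}" "U = {j}" | j where "j < k" "T = {..<k} - {j}" "U = {k}"
    | "T = {2..k}" "U = {1}"
    using assms(2) by (auto simp: base_cells_def)
  then show ?thesis
  proof cases
    case (1 j)
    then have "k \<in> {..<k + 1} - T" "k \<notin> U" "card T = k - 1" "T \<subseteq> {..<k + 1}" "U \<subseteq> {..<k + 1} - T" "U \<noteq> {}"
      by auto
    then show ?thesis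
      by blast
  next
    case (2 j)
    then have "j \<in> {..<k + 1} - T" "j \<notin> U" "card T = k - 1" "T \<subseteq> {..<k + 1}" "U \<subseteq> {..<k + 1} - T" "U \<noteq> {}"
      by auto
    then show ?thesis
      by blast
  next
    case 3
    then have "0 \<in> {..<k + 1} - T" "0 \<notin> U" "card T = k - 1" "T \<subseteq> {..<k + 1}" "U \<subseteq> {..<k + 1} - T" "U \<noteq> {}"
      using assms(1) by auto
    then show ?thesis
      by blast
  qed
qed

text \<open>A cell inherited from the old coordinates stays two-sided. In a newly chosen one the new
  coordinate is below if all the others are above the block, and above if some other one is already
  below.\<close>

lemma cells_two_sided:
  assumes "3 \<le> k" "(T, U) \<in> cells k r"
  shows "T \<subseteq> {..<k + 1 + r} \<and> card T = k - 1 \<and> U \<subseteq> {..<k + 1 + r} - T \<and> U \<noteq> {} \<and> U \<noteq> {..<k + 1 + r} - T"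
  using assms(2)
proof (induction r arbitrary: U)
  case 0
  then show ?case
    using base_cells_two_sided[OF assms(1)] by simp
next
  case (Suc r)
  let ?n = "k + 1 + r"
  have U: "T \<subseteq> {..<?n}" "card T = k - 1" "U \<subseteq> {..?n} - T"
    using Suc.prems unfolding mem_cells_Suc by blast+
  have n: "?n \<in> {..?n} - T"
    using U by auto
  have "U \<noteq> {} \<and> U \<noteq> {..?n} - T"
  proof (cases "(T, U \<inter> {..<?n}) \<in> cells k r")
    case True
    from Suc.IH[OF True] have "U \<inter> {..<?n} \<noteq> {}" "U \<inter> {..<?n} \<noteq> {..<?n} - T"
      by blast+
    then show ?thesis
      by auto
  next
    case False
    then have *: "if U \<inter> {..<?n} = {..<?n} - T then ?n \<notin> U else ?n \<in> U"
      using Suc.prems unfolding mem_cells_Suc by blast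
    show ?thesis
    proof (cases "U \<inter> {..<?n} = {..<?n} - T")
      case True
      have "card ({..<?n} - T) = ?n - (k - 1)"
        using U by (simp add: card_Diff_subset finite_subset)
      then have "{..<?n} - T \<noteq> {}"
        using assms(1) by (metis card.empty diff_is_0_eq not_less_eq_eq Suc_eq_plus1 diff_le_self add.commute le_add1 le_trans)
      then show ?thesis
        using True * n by auto
    next
      case False
      then show ?thesis
        using * n by auto
    qed
  qed
  moreover have "{..?n} = {..<k + 1 + Suc r}"
    by auto
  ultimately show ?case
    using U by auto
qed

lemma finite_cells: "3 \<le> k \<Longrightarrow> finite (cells k r)"
proof (rule finite_subset)
  assume "3 \<le> k"
  then show "cells k r \<subseteq> Pow {..<k + 1 + r} \<times> Pow {..<k + 1 + r}"
    using cells_two_sided[of k _ _ r] by fastforce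
qed simp

section \<open>Counting the chosen cells\<close>

lemma card_base_cells:
  assumes "3 \<le> k"
  shows "card (base_cells k) = 2 * k + 1"
proof -
  let ?A = "(\<lambda>j. ({..<k} - {j}, {j})) ` {..<k}" and ?B = "(\<lambda>j. ({..<k} - {j}, {k})) ` {..<k}"
  have "inj_on (\<lambda>j. ({..<k} - {j}, {k})) {..<k}"
    by (rule inj_onI) auto
  then have B: "card ?B = k"
    by (simp add: card_image)
  have A: "card ?A = k"
    by (subst card_image) (auto simp: inj_on_def)
  have "?A \<inter> ?B = {}"
    by auto
  then have AB: "card (?A \<union> ?B) = 2 * k"
    using A B by (subst card_Un_disjoint) auto
  have "k \<in> {2..k}" "k \<notin> {..<k} - {j}" for j
    using assms by auto
  then have "{2..k} \<noteq> {..<k} - {j}" for j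
    by metis
  then have "(?A \<union> ?B) \<inter> {({2..k}, {1})} = {}"
    by blast
  then show ?thesis
    unfolding base_cells_def using AB by (subst card_Un_disjoint) auto
qed

text \<open>A block and a sign pattern on the old coordinates have two extensions by the new
  coordinate. The one on the removed side is always chosen, the other one exactly when the pair was
  chosen before.\<close>

lemma card_cells_Suc:
  assumes k: "3 \<le> k"
  shows "card (cells k (Suc r)) = card (cells k r) + ((k + 1 + r) choose (k - 1)) * 2 ^ (k + 1 + r - (k - 1))"
proof -
  let ?n = "k + 1 + r"
  let ?all = "SIGMA T:{T. T \<subseteq> {..<?n} \<and> card T = k - 1}. Pow ({..<?n} - T)"
  \<comment> \<open>\<open>?f\<close> extends on the removed side and \<open>?g\<close> on the
    surviving side. Both are undone by restricting \<open>U\<close> to the old coordinates.\<close>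
  let ?f = "\<lambda>(T, U). (T, if U = {..<?n} - T then U else insert ?n U)"
  let ?g = "\<lambda>(T, U). (T, if U = {..<?n} - T then insert ?n U else U)"
  have sub: "cells k r \<subseteq> ?all"
    using cells_two_sided[OF k] by fastforce
  have "cells k (Suc r) = ?f ` ?all \<union> ?g ` cells k r"
  proof -
    have 1: "(T, U) \<in> ?f ` ?all" if TU: "(T, U) \<in> cells k (Suc r)" and ng: "(T, U) \<notin> ?g ` cells k r" for T U
    proof -
    from TU have U: "T \<subseteq> {..<?n}" "card T = k - 1" "U \<subseteq> {..?n} - T"
      and *: "(T, U \<inter> {..<?n}) \<in> cells k r \<or> (if U \<inter> {..<?n} = {..<?n} - T then ?n \<notin> U else ?n \<in> U)"
      unfolding mem_cells_Suc by blast+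
    let ?U = "U \<inter> {..<?n}"
    have all: "(T, ?U) \<in> ?all"
      using U by auto
    have U': "U = (if ?n \<in> U then insert ?n ?U else ?U)"
      using U(3) by (auto simp: nat_less_le)
    show "(T, U) \<in> ?f ` ?all"
    proof (cases "if ?U = {..<?n} - T then ?n \<notin> U else ?n \<in> U")
      case True
      then have "(T, U) = ?f (T, ?U)"
        using U' by (auto split: if_splits)
      then show ?thesis
        using all by blast
    next
      case False
      then have "(T, ?U) \<in> cells k r" "(T, U) = ?g (T, ?U)"
        using U' * by (auto split: if_splits)
      then show ?thesis
        using ng by blast
    qed
    qed
    have 2: "(T', U') \<in> cells k (Suc r)" if *: "(T', U') \<in> ?f ` ?all" for T' U'
    proof -
    obtain U where "(T', U) \<in> ?all" "U' = (if U = {..<?n} - T' then U else insert ?n U)"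
      using * by auto
    then have "T' \<subseteq> {..<?n}" "card T' = k - 1" "U' \<subseteq> {..?n} - T'" "U' \<inter> {..<?n} = U"
      "if U = {..<?n} - T' then ?n \<notin> U' else ?n \<in> U'"
      by (auto split: if_splits)
    then show "(T', U') \<in> cells k (Suc r)"
      unfolding mem_cells_Suc by metis
    qed
    have 3: "(T', U') \<in> cells k (Suc r)" if g: "(T', U') \<in> ?g ` cells k r" for T' U'
    proof -
    obtain U where *: "(T', U) \<in> cells k r" "U' = (if U = {..<?n} - T' then insert ?n U else U)"
      using g by auto
    from cells_two_sided[OF k *(1)] have 1: "T' \<subseteq> {..<?n}" "card T' = k - 1" "U \<subseteq> {..<?n} - T'"
      by auto
    then have "U' \<inter> {..<?n} = U" "U' \<subseteq> {..?n} - T'"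
      using *(2) by auto
    then show "(T', U') \<in> cells k (Suc r)"
      unfolding mem_cells_Suc using 1 *(1) by simp
    qed
    show ?thesis
    proof (intro set_eqI iffI)
      fix x assume x: "x \<in> cells k (Suc r)"
      obtain T U where "x = (T, U)"
        by (rule prod.exhaust)
      then show "x \<in> ?f ` ?all \<union> ?g ` cells k r"
        using 1[of T U] x by blast
    next
      fix x assume x: "x \<in> ?f ` ?all \<union> ?g ` cells k r"
      obtain T U where "x = (T, U)"
        by (rule prod.exhaust)
      then show "x \<in> cells k (Suc r)"
        using 2[of T U] 3[of T U] x by blast
    qed
  qed
  moreover have "inj_on ?f ?all"
    by (rule inj_on_inverseI[where g = "\<lambda>(T, U). (T, U \<inter> {..<?n})"]) (auto split: if_splits)
  then have "card (?f ` ?all) = card ?all"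
    by (rule card_image)
  moreover have "inj_on ?g (cells k r)"
  proof (rule inj_on_subset[OF _ sub])
    show "inj_on ?g ?all"
      by (rule inj_on_inverseI[where g = "\<lambda>(T, U). (T, U \<inter> {..<?n})"]) (auto split: if_splits)
  qed
  then have "card (?g ` cells k r) = card (cells k r)"
    by (rule card_image)
  moreover have "?f ` ?all \<inter> ?g ` cells k r = {}"
  proof -
    have False if "(T, U) \<in> ?all" "(T', U') \<in> ?all" "?f (T, U) = ?g (T', U')" for T U T' U'
    proof -
      have T: "T = T'" and *: "(if U = {..<?n} - T then U else insert ?n U) = (if U' = {..<?n} - T' then insert ?n U' else U')"
        using that(3) unfolding prod.case prod.inject by (rule conjunct1, rule conjunct2)
      have 1: "(if U = {..<?n} - T then U else insert ?n U) \<inter> {..<?n} = U"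
        and 2: "(if U' = {..<?n} - T' then insert ?n U' else U') \<inter> {..<?n} = U'"
        using that(1,2) by (auto split: if_splits)
      have "U = U'"
        using 1[unfolded *] 2 by (rule trans[OF sym])
      moreover have "?n \<notin> U"
        using that(1) by auto
      ultimately show False
        using * T by (metis insertI1)
    qed
    then have "?f ` ?all \<inter> ?g ` ?all = {}"
      by blast
    then show ?thesis
      using sub by blast
  qed
  moreover have fin: "finite {T. T \<subseteq> {..<?n} \<and> card T = k - 1}"
    by simp
  then have "finite ?all"
    by (intro finite_SigmaI) auto
  ultimately have "card (cells k (Suc r)) = card ?all + card (cells k r)"
    using finite_cells[OF k] by (simp add: card_Un_disjoint)
  moreover have "card ?all = (\<Sum>T\<in>{T. T \<subseteq> {..<?n} \<and> card T = k - 1}. card (Pow ({..<?n} - T)))"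
    using fin by (intro card_SigmaI) auto
  moreover have "\<dots> = (\<Sum>T\<in>{T. T \<subseteq> {..<?n} \<and> card T = k - 1}. 2 ^ (?n - (k - 1)))"
    by (intro sum.cong) (auto simp: card_Pow card_Diff_subset finite_subset)
  moreover have "\<dots> = (?n choose (k - 1)) * 2 ^ (?n - (k - 1))"
    using n_subsets[of "{..<?n}" "k - 1"] by simp
  ultimately show ?thesis
    by simp
qed

text \<open>Pascal's rule on \<open>Suc n choose i\<close> splits off \<open>beta k n\<close>. In
  the rest, choosing \<open>j\<close> elements and then \<open>k - 1\<close> of these amounts to
  choosing the \<open>k - 1\<close> elements first and then any subset of the others. The increment
  is thus the number of all pairs of a block and a sign pattern, as for the cells.\<close>

lemma beta_Suc:
  assumes "1 \<le> k" "k \<le> Suc n"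
  shows "beta k (Suc n) = beta k n + (n choose (k - 1)) * 2 ^ (n - (k - 1))"
proof -
  have "beta k (Suc n) = (\<Sum>i = k..Suc n. (n choose i) * ((i - 1) choose (k - 1)) + (n choose (i - 1)) * ((i - 1) choose (k - 1)))"
    unfolding beta_def
  proof (rule sum.cong)
    fix i assume "i \<in> {k..Suc n}"
    then obtain j where "i = Suc j"
      using assms(1) by (cases i) auto
    then show "(Suc n choose i) * ((i - 1) choose (k - 1)) =
       (n choose i) * ((i - 1) choose (k - 1)) + (n choose (i - 1)) * ((i - 1) choose (k - 1))"
      by (simp add: algebra_simps)
  qed simp
  \<comment> \<open>The summand for \<open>i = Suc n\<close> vanishes in the first part, since
    \<open>n choose Suc n = 0\<close>.\<close>
  also have "\<dots> = beta k n + (\<Sum>i = k..Suc n. (n choose (i - 1)) * ((i - 1) choose (k - 1)))"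
    using assms(2) by (simp add: sum.distrib beta_def binomial_eq_0)
  also have "(\<Sum>i = k..Suc n. (n choose (i - 1)) * ((i - 1) choose (k - 1))) = (\<Sum>j = k - 1..n. (n choose j) * (j choose (k - 1)))"
    using sum.shift_bounds_cl_Suc_ivl[of "\<lambda>i. (n choose (i - 1)) * ((i - 1) choose (k - 1))" "k - 1" n] assms(1) by simp
  also have "\<dots> = (\<Sum>j = k - 1..n. (n choose (k - 1)) * ((n - (k - 1)) choose (j - (k - 1))))"
    by (intro sum.cong refl choose_mult) auto
  also have "\<dots> = (n choose (k - 1)) * (\<Sum>j = 0 + (k - 1)..(n - (k - 1)) + (k - 1). (n - (k - 1)) choose (j - (k - 1)))"
    using assms(2) by (simp add: sum_distrib_left)
  also have "\<dots> = (n choose (k - 1)) * (\<Sum>j = 0..n - (k - 1). (n - (k - 1)) choose j)"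
    by (simp only: sum.shift_bounds_cl_nat_ivl) simp
  also have "\<dots> = (n choose (k - 1)) * 2 ^ (n - (k - 1))"
    by (simp add: choose_row_sum atLeast0AtMost)
  finally show ?thesis .
qed

lemma card_cells:
  assumes "3 \<le> k"
  shows "card (cells k r) = beta k (k + 1 + r)"
proof (induction r)
  case 0
  \<comment> \<open>The recursion from \<open>k\<close> to \<open>k + 1\<close> coordinates gives
    \<open>1 + k * 2\<close>, the number of edges of the tree.\<close>
  have "beta k k = 1"
    by (simp add: beta_def)
  moreover have "k - (k - 1) = 1" "k choose (k - 1) = k"
    using assms binomial_symmetric[of "k - 1" k] by auto
  ultimately show ?case
    using beta_Suc[of k k] assms card_base_cells[OF assms] by simp
next
  case (Suc r)
  then show ?case
    using card_cells_Suc[OF assms, of r] beta_Suc[of k "k + 1 + r"] assms by simp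
qed

section \<open>Contractibility of the complement of the cells\<close>

definition conf :: "nat \<Rightarrow> nat \<Rightarrow> (nat \<Rightarrow> real) set" where
  "conf k n = {x. (\<forall>i\<ge>n. x i = 0) \<and> \<not> (\<exists>I \<subseteq> {..<n}. card I = k \<and> (\<forall>i\<in>I. \<forall>j\<in>I. x i = x j))}"

definition cell :: "nat \<Rightarrow> nat set \<Rightarrow> nat set \<Rightarrow> (nat \<Rightarrow> real) set" where
  "cell n T U = {x. \<exists>a. (\<forall>i\<in>T. x i = a) \<and> (\<forall>i\<in>U. a < x i) \<and> (\<forall>i\<in>{..<n} - T - U. x i < a)}"

definition cell_complement :: "nat \<Rightarrow> nat \<Rightarrow> (nat \<Rightarrow> real) set" where
  "cell_complement k r = {x \<in> conf k (k + 1 + r). \<forall>(T, U)\<in>cells k r. x \<notin> cell (k + 1 + r) T U}"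

lemma conf_space_eq: "conf_space k n = top_of_set (conf k n)"
  by (simp add: conf_space_def conf_def Euclidean_space_def euclidean_product_topology subtopology_subtopology
      Collect_conj_eq)

lemma conf_no_block:
  assumes "x \<in> conf k n" "I \<subseteq> {..<n}" "card I = k" "\<And>i. i \<in> I \<Longrightarrow> x i = a"
  shows False
  using assms unfolding conf_def by auto

lemma conf_block_maximal:
  assumes "x \<in> conf k n" "1 \<le> k" "T \<subseteq> {..<n}" "card T = k - 1" "\<And>i. i \<in> T \<Longrightarrow> x i = a" "j < n" "j \<notin> T"
  shows "x j \<noteq> a"
proof
  assume "x j = a"
  have "finite T"
    using assms(3) finite_subset by blast
  then have "card (insert j T) = k"
    using assms(2,4,7) by simp
  then show False
    using conf_no_block[of x k n "insert j T" a] assms \<open>x j = a\<close> by auto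
qed

lemma continuous_on_Min_image [continuous_intros]:
  fixes f :: "'a::topological_space \<Rightarrow> 'b \<Rightarrow> real"
  assumes "finite I" "I \<noteq> {}" "\<And>i. i \<in> I \<Longrightarrow> continuous_on S (\<lambda>x. f x i)"
  shows "continuous_on S (\<lambda>x. Min (f x ` I))"
  using assms
proof (induction I rule: finite_ne_induct)
  case (insert i I)
  have "continuous_on S (\<lambda>x. min (f x i) (Min (f x ` I)))"
    using insert by (intro continuous_intros) auto
  then show ?case
    using insert by simp
qed simp

lemma continuous_on_Max_image [continuous_intros]:
  fixes f :: "'a::topological_space \<Rightarrow> 'b \<Rightarrow> real"
  assumes "finite I" "I \<noteq> {}" "\<And>i. i \<in> I \<Longrightarrow> continuous_on S (\<lambda>x. f x i)"
  shows "continuous_on S (\<lambda>x. Max (f x ` I))"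
  using assms
proof (induction I rule: finite_ne_induct)
  case (insert i I)
  have "continuous_on S (\<lambda>x. max (f x i) (Max (f x ` I)))"
    using insert by (intro continuous_intros) auto
  then show ?case
    using insert by simp
qed simp

lemma continuous_on_fun_upd [continuous_intros]:
  fixes f :: "'a::topological_space \<Rightarrow> 'b \<Rightarrow> 'c::topological_space"
  assumes "continuous_on S f" "continuous_on S g"
  shows "continuous_on S (\<lambda>x. (f x)(i := g x))"
proof (rule continuous_on_coordinatewise_then_product)
  fix j
  show "continuous_on S (\<lambda>x. ((f x)(i := g x)) j)"
    using assms continuous_on_product_then_coordinatewise[OF assms(1)] by (cases "j = i") auto
qed

lemma homotopic_canonI:
  fixes h :: "real \<times> 'a::topological_space \<Rightarrow> 'b::topological_space"
  assumes "continuous_on ({0..1} \<times> S) h" "\<And>t x. \<lbrakk>t \<in> {0..1}; x \<in> S\<rbrakk> \<Longrightarrow> h (t, x) \<in> T"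
    "\<And>x. x \<in> S \<Longrightarrow> h (0, x) = f x" "\<And>x. x \<in> S \<Longrightarrow> h (1, x) = g x"
  shows "homotopic_with_canon (\<lambda>_. True) S T f g"
proof (rule iffD2[OF homotopic_with])
  show "\<exists>h. continuous_map (prod_topology (top_of_set {0..1::real}) (top_of_set S)) (top_of_set T) h \<and>
      (\<forall>x\<in>topspace (top_of_set S). h (0, x) = f x) \<and> (\<forall>x\<in>topspace (top_of_set S). h (1, x) = g x) \<and>
      (\<forall>t\<in>{0..1::real}. True)"
    by (intro exI[of _ h]) (use assms in auto)
qed simp

text \<open>Up to homotopy the identity of \<open>T\<close> factors through \<open>S\<close>, and a
  contraction of \<open>S\<close> turns the factored map into a constant.\<close>

lemma contractible_dominated:
  assumes "continuous_on T f" "f \<in> T \<rightarrow> S" "continuous_on S g" "g \<in> S \<rightarrow> T"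
    and hom: "homotopic_with_canon (\<lambda>_. True) T T id (g \<circ> f)" and S: "contractible S"
  shows "contractible T"
proof -
  obtain b where "homotopic_with_canon (\<lambda>_. True) S S id (\<lambda>x. b)"
    using S unfolding contractible_def by blast
  then have "homotopic_with_canon (\<lambda>_. True) T S (id \<circ> f) ((\<lambda>x. b) \<circ> f)"
    by (rule homotopic_with_compose_continuous_map_right) (use assms in auto)
  then have "homotopic_with_canon (\<lambda>_. True) T T (g \<circ> (id \<circ> f)) (g \<circ> ((\<lambda>x. b) \<circ> f))"
    by (rule homotopic_with_compose_continuous_map_left) (use assms in auto)
  then have "homotopic_with_canon (\<lambda>_. True) T T id (\<lambda>x. g b)"
    using homotopic_with_trans[OF hom] by (simp add: o_def)
  then show ?thesis
    unfolding contractible_def by blast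
qed

section \<open>Contractibility when one coordinate is added\<close>

definition split_level :: "nat \<Rightarrow> nat \<Rightarrow> (nat \<Rightarrow> real) \<Rightarrow> real" where
  "split_level k n x = (Min (x ` {..<n}) + Min ((\<lambda>S. Max (x ` S)) ` {S. S \<subseteq> {..<n} \<and> card S = k})) / 2"

lemma k_subsets_nonempty: "k \<le> n \<Longrightarrow> {S. S \<subseteq> {..<n} \<and> card S = k} \<noteq> {}" for n k :: nat
  using obtain_subset_with_card_n[of k "{..<n}"] by auto

text \<open>The minimum over all \<open>k\<close>-subsets of their maxima is the \<open>k\<close>-th
  smallest coordinate. In this form continuity follows from that of finite minima and maxima,
  without sorting.\<close>

lemma continuous_on_split_level:
  assumes "1 \<le> k" "k \<le> n" "continuous_on S f"
  shows "continuous_on S (\<lambda>x. split_level k n (f x))"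
proof -
  have "0 \<in> {..<n}"
    using assms by simp
  then have ne: "{..<n} \<noteq> {}"
    by blast
  have c: "continuous_on S (\<lambda>x. f x i)" for i
    by (rule continuous_on_product_then_coordinatewise[OF assms(3)])
  have "continuous_on S (\<lambda>x. Max (f x ` A))" if "A \<subseteq> {..<n}" "card A = k" for A
    using that assms(1) by (intro continuous_on_Max_image c) (auto intro: finite_subset)
  then have "continuous_on S (\<lambda>x. Min ((\<lambda>A. Max (f x ` A)) ` {A. A \<subseteq> {..<n} \<and> card A = k}))"
    using k_subsets_nonempty[OF assms(2)] by (intro continuous_on_Min_image) auto
  moreover have "continuous_on S (\<lambda>x. Min (f x ` {..<n}))"
    using ne by (intro continuous_on_Min_image c) auto
  ultimately show ?thesis
    unfolding split_level_def by (intro continuous_on_divide continuous_on_add) auto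
qed

lemma split_level_upd: "split_level k n (x(n := t)) = split_level k n x"
proof -
  have 1: "(x(n := t)) ` S = x ` S" if "S \<subseteq> {..<n}" for S
    using that by (intro image_cong) auto
  have "(\<lambda>S. Max ((x(n := t)) ` S)) ` {S. S \<subseteq> {..<n} \<and> card S = k} = (\<lambda>S. Max (x ` S)) ` {S. S \<subseteq> {..<n} \<and> card S = k}"
    by (intro image_cong refl) (auto simp only: 1 mem_Collect_eq)
  then show ?thesis
    unfolding split_level_def using 1[of "{..<n}"] by simp
qed

text \<open>Only \<open>k - 1\<close> coordinates attain the minimum \<open>a\<close>, so the
  \<open>k\<close>-th smallest exceeds it, and its average with the smallest does too.\<close>

lemma split_level_gt:
  assumes "2 \<le> k" "k \<le> n" "T \<subseteq> {..<n}" "card T = k - 1" "\<And>i. i \<in> T \<Longrightarrow> x i = a"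
    and "\<And>i. i \<in> {..<n} - T \<Longrightarrow> a < x i"
  shows "a < split_level k n x"
proof -
  have "a \<le> x i" if "i < n" for i
    using assms(5,6) that by (cases "i \<in> T") force+
  moreover have "0 \<in> {..<n}"
    using assms by simp
  then have "{..<n} \<noteq> {}"
    by blast
  ultimately have "a \<le> Min (x ` {..<n})"
    by (subst Min_ge_iff) auto
  moreover have "a < Max (x ` S)" if S: "S \<subseteq> {..<n}" "card S = k" for S
  proof -
    have fin: "finite S" "finite T"
      using S assms(3) finite_subset by blast+
    have "\<not> S \<subseteq> T"
      using card_mono[OF fin(2), of S] S assms(1,4) by auto
    then obtain i where "i \<in> S" "i \<notin> T"
      by blast
    then have "a < x i"
      using S assms(6) by blast
    also have "x i \<le> Max (x ` S)"
      using fin \<open>i \<in> S\<close> by simp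
    finally show ?thesis .
  qed
  then have "a < Min ((\<lambda>S. Max (x ` S)) ` {S. S \<subseteq> {..<n} \<and> card S = k})"
    using k_subsets_nonempty[OF assms(2)] by (subst Min_gr_iff) auto
  moreover have "a < (p + q) / 2" if "a \<le> p" "a < q" for p q :: real
    using that by simp
  ultimately show ?thesis
    unfolding split_level_def by blast
qed

text \<open>A coordinate below the block makes the smallest one less than \<open>a\<close>; together
  with the block it gives \<open>k\<close> coordinates that are at most \<open>a\<close>.\<close>

lemma split_level_less:
  assumes "2 \<le> k" "T \<subseteq> {..<n}" "card T = k - 1" "\<And>i. i \<in> T \<Longrightarrow> x i = a" "i < n" "x i < a"
  shows "split_level k n x < a"
proof -
  have "Min (x ` {..<n}) \<le> x i"
    using assms(5) by simp
  then have 1: "Min (x ` {..<n}) < a"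
    using assms(6) by (rule le_less_trans)
  have "i \<notin> T"
    using assms(4,6) by force
  then have S: "insert i T \<subseteq> {..<n}" "card (insert i T) = k"
    using assms finite_subset[OF assms(2)] by auto
  have "Min ((\<lambda>S. Max (x ` S)) ` {S. S \<subseteq> {..<n} \<and> card S = k}) \<le> Max (x ` insert i T)"
    by (intro Min_le imageI) (use S in auto)
  also have "\<dots> \<le> a"
    using assms finite_subset[OF assms(2)] by (subst Max_le_iff) force+
  finally have 2: "Min ((\<lambda>S. Max (x ` S)) ` {S. S \<subseteq> {..<n} \<and> card S = k}) \<le> a" .
  have "(p + q) / 2 < a" if "p < a" "q \<le> a" for p q :: real
    using that by simp
  then show ?thesis
    unfolding split_level_def using 1 2 by blast
qed

text \<open>The strict condition on \<open>x n\<close> says two things at once: the new coordinate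
  does not complete a block to \<open>k\<close> equal ones, and it avoids the removed side. A chosen
  cell never has the new index in its block, so blocks of old coordinates suffice. The inherited
  cells are taken care of by the projection \<open>x(n := 0)\<close>.\<close>

lemma cell_complement_Suc_iff:
  assumes k: "3 \<le> k" and n_def: "n = k + 1 + r" and x: "\<forall>i\<ge>Suc n. x i = 0"
  shows "x \<in> cell_complement k (Suc r) \<longleftrightarrow> x(n := 0) \<in> cell_complement k r \<and>
    (\<forall>T a. T \<subseteq> {..<n} \<longrightarrow> card T = k - 1 \<longrightarrow> (\<forall>i\<in>T. x i = a) \<longrightarrow>
      (if \<forall>i\<in>{..<n} - T. a < x i then a < x n else x n < a))" (is "_ \<longleftrightarrow> ?A \<and> ?B")
proof (intro iffI conjI)
  have Suc_n: "k + 1 + Suc r = Suc n"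
    by (simp add: n_def)
  assume g: "x \<in> cell_complement k (Suc r)"
  then have xc: "x \<in> conf k (Suc n)" and xcell: "\<And>T U. (T, U) \<in> cells k (Suc r) \<Longrightarrow> x \<notin> cell (Suc n) T U"
    unfolding cell_complement_def Suc_n by auto
  have other: "x j \<noteq> a" if "T \<subseteq> {..<n}" "card T = k - 1" "\<forall>i\<in>T. x i = a" "j \<le> n" "j \<notin> T" for T a j
    using conf_block_maximal[OF xc, of T a j] that k by fastforce
  show ?A
    unfolding cell_complement_def n_def[symmetric]
  proof (intro CollectI conjI ballI; clarify?)
    show "x(n := 0) \<in> conf k n"
      using x conf_no_block[OF xc] unfolding conf_def by (auto simp: subset_iff) (metis less_SucI nat_neq_iff)
    fix T U assume TU: "(T, U) \<in> cells k r" and "x(n := 0) \<in> cell n T U"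
    then obtain a where a: "\<And>i. i \<in> T \<Longrightarrow> (x(n := 0)) i = a" "\<And>i. i \<in> U \<Longrightarrow> a < (x(n := 0)) i"
      "\<And>i. i \<in> {..<n} - T - U \<Longrightarrow> (x(n := 0)) i < a"
      unfolding cell_def by blast
    have sub: "T \<subseteq> {..<n}" "card T = k - 1" "U \<subseteq> {..<n} - T"
      using cells_two_sided[OF k TU] unfolding n_def by blast+
    have nn: "n \<notin> T" "n \<notin> U"
      using sub by auto
    have a': "x i = a" if "i \<in> T" for i
      using a(1)[OF that] that nn by (auto split: if_splits)
    have a'': "a < x i" if "i \<in> U" for i
      using a(2)[OF that] that nn by (auto split: if_splits)
    have a3: "x i < a" if "i \<in> {..<n} - T - U" for i
      using a(3)[OF that] that by (auto split: if_splits)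
    have ne: "x n \<noteq> a"
      using other[of T a n] sub nn a' by blast
    \<comment> \<open>An inherited cell is chosen with the new coordinate on either side;
      \<open>U'\<close> records the side on which it actually lies.\<close>
    define U' where "U' = (if a < x n then insert n U else U)"
    have "U' \<inter> {..<n} = U" "U' \<subseteq> {..n} - T"
      using sub nn by (auto simp: U'_def)
    then have "(T, U') \<in> cells k (Suc r)"
      unfolding mem_cells_Suc n_def[symmetric] using sub TU by simp
    moreover have "x \<in> cell (Suc n) T U'"
      unfolding cell_def
    proof (intro CollectI exI[of _ a] conjI ballI)
      fix i assume "i \<in> {..<Suc n} - T - U'"
      then show "x i < a"
        using a3[of i] ne by (cases "i = n") (auto simp: U'_def split: if_splits)
    qed (use a' a'' in \<open>auto simp: U'_def split: if_splits\<close>)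
    ultimately show False
      using xcell by blast
  qed
  show ?B
  proof (intro allI impI)
    fix T a assume T: "T \<subseteq> {..<n}" "card T = k - 1" "\<forall>i\<in>T. x i = a"
    define U where "U = {i. i \<le> n \<and> a < x i}"
    have nT: "n \<notin> T" "T \<inter> U = {}"
      using T by (auto simp: U_def)
    have ne: "x i \<noteq> a" if "i \<le> n" "i \<notin> T" for i
      using other[OF T that] .
    have cl: "x \<in> cell (Suc n) T U"
      unfolding cell_def
    proof (intro CollectI exI[of _ a] conjI ballI)
      fix i assume i: "i \<in> {..<Suc n} - T - U"
      then show "x i < a"
        using ne[of i] by (auto simp: U_def)
    qed (use T in \<open>auto simp: U_def\<close>)
    then have "(T, U) \<notin> cells k (Suc r)"
      using xcell by blast
    moreover have "U \<subseteq> {..n} - T"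
      using nT by (auto simp: U_def)
    ultimately have *: "\<not> (if U \<inter> {..<n} = {..<n} - T then n \<notin> U else n \<in> U)"
      unfolding mem_cells_Suc n_def[symmetric] using T by blast
    have "U \<inter> {..<n} = {..<n} - T \<longleftrightarrow> (\<forall>i\<in>{..<n} - T. a < x i)"
      using T by (auto simp: U_def)
    moreover have "n \<in> U \<longleftrightarrow> a < x n"
      by (simp add: U_def)
    ultimately show "if \<forall>i\<in>{..<n} - T. a < x i then a < x n else x n < a"
      using * ne[of n] nT by (auto split: if_splits)
  qed
next
  have Suc_n: "k + 1 + Suc r = Suc n"
    by (simp add: n_def)
  assume AB: "?A \<and> ?B"
  then have A: "x(n := 0) \<in> conf k n" and Ac: "\<And>T U. (T, U) \<in> cells k r \<Longrightarrow> x(n := 0) \<notin> cell n T U"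
    unfolding cell_complement_def n_def by auto
  have B: "if \<forall>i\<in>{..<n} - T. a < x i then a < x n else x n < a"
    if "T \<subseteq> {..<n}" "card T = k - 1" "\<forall>i\<in>T. x i = a" for T a
    using AB that by blast
  show "x \<in> cell_complement k (Suc r)"
    unfolding cell_complement_def Suc_n
  proof (intro CollectI conjI ballI; clarify?)
    have False if I: "I \<subseteq> {..<Suc n}" "card I = k" "\<forall>i\<in>I. \<forall>j\<in>I. x i = x j" for I
    proof (cases "n \<in> I")
      case True
      have "finite I"
        using I(1) finite_subset by blast
      then have "card (I - {n}) = k - 1"
        using True I(2) by simp
      moreover have "I - {n} \<subseteq> {..<n}"
        using I(1) by auto
      moreover have "\<forall>i\<in>I - {n}. x i = x n"
        using I(3) True by blast
      \<comment> \<open>With the common value \<open>x n\<close> as \<open>a\<close>, either side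
        condition reads \<open>x n < x n\<close>.\<close>
      ultimately have "if \<forall>i\<in>{..<n} - (I - {n}). x n < x i then x n < x n else x n < x n"
        by (intro B)
      then show False
        by (auto split: if_splits)
    next
      case False
      then have "I \<subseteq> {..<n}"
        using I(1) less_Suc_eq by auto
      moreover obtain i where i: "i \<in> I"
        using I(2) k by fastforce
      have "(x(n := 0)) j = x i" if "j \<in> I" for j
        using I(3) that i False by (metis fun_upd_other)
      ultimately show False
        using conf_no_block[OF A _ I(2)] by blast
    qed
    then show "x \<in> conf k (Suc n)"
      unfolding conf_def using x by blast
    fix T U assume TU: "(T, U) \<in> cells k (Suc r)" and "x \<in> cell (Suc n) T U"
    then obtain a where a: "\<And>i. i \<in> T \<Longrightarrow> x i = a" "\<And>i. i \<in> U \<Longrightarrow> a < x i"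
      "\<And>i. i \<in> {..<Suc n} - T - U \<Longrightarrow> x i < a"
      unfolding cell_def by blast
    have sub: "T \<subseteq> {..<n}" "card T = k - 1" "U \<subseteq> {..n} - T"
      and or: "(T, U \<inter> {..<n}) \<in> cells k r \<or> (if U \<inter> {..<n} = {..<n} - T then n \<notin> U else n \<in> U)"
      using TU unfolding mem_cells_Suc n_def[symmetric] by blast+
    have "x i < a" if "i < n" "i \<notin> T" "i \<notin> U" for i
      using a(3)[of i] that by simp
    then have "x(n := 0) \<in> cell n T (U \<inter> {..<n})"
      unfolding cell_def using a(1,2) sub by (intro CollectI exI[of _ a]) auto
    then have U: "if U \<inter> {..<n} = {..<n} - T then n \<notin> U else n \<in> U"
      using or Ac by metis
    have nT: "n \<notin> T"
      using sub by auto
    have "U \<inter> {..<n} = {..<n} - T \<longleftrightarrow> (\<forall>i\<in>{..<n} - T. a < x i)"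
    proof
      assume R: "\<forall>i\<in>{..<n} - T. a < x i"
      have "i \<in> U" if i: "i \<in> {..<n} - T" for i
      proof (rule ccontr)
        assume "i \<notin> U"
        then have "x i < a"
          using i by (intro a(3)) auto
        moreover have "a < x i"
          using R i by blast
        ultimately show False
          by simp
      qed
      then show "U \<inter> {..<n} = {..<n} - T"
        using sub by auto
    qed (use a in auto)
    moreover have "n \<in> U \<longleftrightarrow> a < x n"
    proof (cases "n \<in> U")
      case False
      then have "x n < a"
        using nT by (intro a(3)) simp
      then show ?thesis
        using False by simp
    qed (simp add: a(2))
    moreover have "if \<forall>i\<in>{..<n} - T. a < x i then a < x n else x n < a"
      using sub a by (intro B) auto
    ultimately show False
      using U by (auto split: if_splits)
  qed
qed


text \<open>Over fixed old coordinates the admissible new values form an intersection of half-lines,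
  hence an interval, and \<open>split_level\<close> is one of them. The complement therefore deforms
  linearly along the fibres onto the graph of \<open>split_level\<close>.\<close>

lemma contractible_cell_complement_Suc:
  assumes k: "3 \<le> k" and V: "contractible (cell_complement k r)"
  shows "contractible (cell_complement k (Suc r))"
proof -
  define n where "n = k + 1 + r"
  let ?\<tau> = "split_level k n"
  have kn: "1 \<le> k" "k \<le> n"
    using k by (auto simp: n_def)
  note iff = cell_complement_Suc_iff[OF k n_def]
  have zero: "\<forall>i\<ge>Suc n. x i = 0" if "x \<in> cell_complement k (Suc r)" for x
    using that by (auto simp: cell_complement_def conf_def n_def)
  have zero': "\<forall>i\<ge>n. x i = 0" if "x \<in> cell_complement k r" for x
    using that by (auto simp: cell_complement_def conf_def n_def)
  have side: "if \<forall>i\<in>{..<n} - T. a < x i then a < ?\<tau> x else ?\<tau> x < a"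
    if x: "x(n := 0) \<in> cell_complement k r" and T: "T \<subseteq> {..<n}" "card T = k - 1" "\<forall>i\<in>T. x i = a" for x T a
  proof (cases "\<forall>i\<in>{..<n} - T. a < x i")
    case True
    then show ?thesis
      using split_level_gt[of k n T x a] k kn T by simp
  next
    case False
    then obtain i where i: "i < n" "i \<notin> T" "\<not> a < x i"
      by auto
    have "x(n := 0) \<in> conf k n"
      using x by (simp add: cell_complement_def n_def)
    moreover have "(x(n := 0)) j = a" if "j \<in> T" for j
      using T that by auto
    ultimately have "(x(n := 0)) i \<noteq> a"
      using conf_block_maximal[of "x(n := 0)" k n T a i] T(1,2) i(1,2) kn(1) by blast
    then have "x i < a"
      using i by auto
    then show ?thesis
      using split_level_less[of k T n x a i] k T i False by simp
  qed
  have move: "x(n := t) \<in> cell_complement k (Suc r)"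
    if x: "x(n := 0) \<in> cell_complement k r" "\<forall>i\<ge>Suc n. x i = 0"
      and t: "\<And>T a. \<lbrakk>T \<subseteq> {..<n}; card T = k - 1; \<forall>i\<in>T. x i = a\<rbrakk> \<Longrightarrow>
        if \<forall>i\<in>{..<n} - T. a < x i then a < t else t < a" for x t
  proof (subst iff)
    show "\<forall>i\<ge>Suc n. (x(n := t)) i = 0"
      using x(2) by auto
    show "(x(n := t))(n := 0) \<in> cell_complement k r \<and> (\<forall>T a. T \<subseteq> {..<n} \<longrightarrow> card T = k - 1 \<longrightarrow>
       (\<forall>i\<in>T. (x(n := t)) i = a) \<longrightarrow>
       (if \<forall>i\<in>{..<n} - T. a < (x(n := t)) i then a < (x(n := t)) n else (x(n := t)) n < a))"
    proof (intro conjI allI impI)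
      fix T a assume T: "T \<subseteq> {..<n}" "card T = k - 1" "\<forall>i\<in>T. (x(n := t)) i = a"
      have "\<forall>i\<in>T. x i = a"
        using T by (metis fun_upd_other lessThan_iff less_irrefl subset_eq)
      moreover have "(\<forall>i\<in>{..<n} - T. a < (x(n := t)) i) \<longleftrightarrow> (\<forall>i\<in>{..<n} - T. a < x i)"
        by auto
      ultimately show "if \<forall>i\<in>{..<n} - T. a < (x(n := t)) i then a < (x(n := t)) n else (x(n := t)) n < a"
        using t[OF T(1,2)] by simp
    qed (use x(1) in simp)
  qed
  have down: "x(n := 0) \<in> cell_complement k r" if "x \<in> cell_complement k (Suc r)" for x
    using iff[OF zero[OF that]] that by simp
  show ?thesis
  proof (rule contractible_dominated[OF _ _ _ _ _ V])
    show "continuous_on (cell_complement k (Suc r)) (\<lambda>x. x(n := 0))"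
      "continuous_on (cell_complement k r) (\<lambda>x. x(n := ?\<tau> x))"
      by (intro continuous_intros continuous_on_split_level kn)+
    show "(\<lambda>x. x(n := 0)) \<in> cell_complement k (Suc r) \<rightarrow> cell_complement k r"
      using down by auto
    show "(\<lambda>x. x(n := ?\<tau> x)) \<in> cell_complement k r \<rightarrow> cell_complement k (Suc r)"
    proof
      fix x assume x: "x \<in> cell_complement k r"
      then have "x(n := 0) = x"
        using zero' by (auto simp: fun_eq_iff)
      then show "x(n := ?\<tau> x) \<in> cell_complement k (Suc r)"
        using x zero'[OF x] side[of x] by (intro move) auto
    qed
    show "homotopic_with_canon (\<lambda>_. True) (cell_complement k (Suc r)) (cell_complement k (Suc r)) id ((\<lambda>x. x(n := ?\<tau> x)) \<circ> (\<lambda>x. x(n := 0)))"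
    proof (rule homotopic_canonI[where h = "\<lambda>z. (snd z)(n := (1 - fst z) * snd z n + fst z * ?\<tau> (snd z))"])
      show "continuous_on ({0..1} \<times> cell_complement k (Suc r)) (\<lambda>z. (snd z)(n := (1 - fst z) * snd z n + fst z * ?\<tau> (snd z)))"
        by (intro continuous_intros continuous_on_split_level kn)
      fix s :: real and x assume s: "s \<in> {0..1}" and x: "x \<in> cell_complement k (Suc r)"
      have "x(n := (1 - s) * x n + s * ?\<tau> x) \<in> cell_complement k (Suc r)"
      proof (rule move)
        fix T a assume T: "T \<subseteq> {..<n}" "card T = k - 1" "\<forall>i\<in>T. x i = a"
        have "if \<forall>i\<in>{..<n} - T. a < x i then a < x n else x n < a"
          using iff[OF zero[OF x]] x T by blast
        moreover have "if \<forall>i\<in>{..<n} - T. a < x i then a < ?\<tau> x else ?\<tau> x < a"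
          using side[OF down[OF x] T] .
        moreover have "a < (1 - s) * p + s * q" if "a < p" "a < q" for p q
          using convex_bound_lt[of "- p" "- a" "- q" "1 - s" s] that s by auto
        moreover have "(1 - s) * p + s * q < a" if "p < a" "q < a" for p q
          using convex_bound_lt[of p a q "1 - s" s] that s by auto
        ultimately show "if \<forall>i\<in>{..<n} - T. a < x i then a < (1 - s) * x n + s * ?\<tau> x else (1 - s) * x n + s * ?\<tau> x < a"
          by auto
      qed (use down x zero in auto)
      then show "(snd (s, x))(n := (1 - fst (s, x)) * snd (s, x) n + fst (s, x) * ?\<tau> (snd (s, x))) \<in> cell_complement k (Suc r)"
        by simp
    qed (auto simp: split_level_upd)
  qed
qed


section \<open>The base case of k + 1 coordinates\<close>

definition mid3 :: "nat \<Rightarrow> (nat \<Rightarrow> real) \<Rightarrow> real" where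
  "mid3 k x = max (x 0) (min (x 1) (x k))"

text \<open>For \<open>x 0 \<le> x 1\<close> this is the median of \<open>x 0\<close>, \<open>x 1\<close> and \<open>x k\<close>. The graph consists of the cells
  \<open>({..<k} - {1}, {1})\<close>, \<open>({2..k}, {1})\<close> and \<open>({..<k} - {0}, {k})\<close>, i.e. of a path in the tree of arcs.\<close>

definition off_graph :: "nat \<Rightarrow> (nat \<Rightarrow> real) set" where
  "off_graph k = {x. (\<forall>i\<ge>Suc k. x i = 0) \<and> \<not> (x 0 \<le> x 1 \<and> (\<forall>i\<in>{2..<k}. x i = mid3 k x))}"

text \<open>The homotopy moves \<open>x 0\<close> to \<open>1\<close> and scales \<open>x 1\<close>
  and \<open>x k\<close> to \<open>0\<close>, while the deviations of the other coordinates from the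
  moving median shrink by the factor \<open>1 - t\<close>. Meeting the graph before time
  \<open>1\<close> would force \<open>x 0 \<le> x 1\<close> and zero deviations from the start; at
  time \<open>1\<close> the half-space has been left.\<close>

lemma contractible_off_graph:
  assumes "3 \<le> k"
  shows "contractible (off_graph k)"
proof -
  define h where "h z = (\<lambda>i. if i = 0 then (1 - fst z) * snd z 0 + fst z
      else if i = 1 \<or> i = k then (1 - fst z) * snd z i
      else if i < k then max ((1 - fst z) * snd z 0 + fst z) (min ((1 - fst z) * snd z 1) ((1 - fst z) * snd z k))
         + (1 - fst z) * (snd z i - mid3 k (snd z)) else 0)" for z :: "real \<times> (nat \<Rightarrow> real)"
  have mid: "mid3 k (h z) = max ((1 - fst z) * snd z 0 + fst z) (min ((1 - fst z) * snd z 1) ((1 - fst z) * snd z k))" for z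
    using assms by (simp add: mid3_def h_def)
  have "homotopic_with_canon (\<lambda>_. True) (off_graph k) (off_graph k) id (\<lambda>x i. if i = 0 then 1 else if i = 1 \<or> k \<le> i then 0 else 1)"
  proof (rule homotopic_canonI[where h = h])
    have "continuous_on ({0..1} \<times> off_graph k) (\<lambda>z. h z i)" for i
    proof -
      consider "i = 0" | "i \<noteq> 0" "i = 1 \<or> i = k" | "i \<noteq> 0" "i \<noteq> 1" "i \<noteq> k" "i < k" | "i \<noteq> 0" "i \<noteq> 1" "i \<noteq> k" "\<not> i < k"
        by blast
      then show ?thesis
        by cases (auto simp: h_def mid3_def intro!: continuous_intros)
    qed
    then show "continuous_on ({0..1} \<times> off_graph k) h"
      by (rule continuous_on_coordinatewise_then_product)
  next
    fix s :: real and x assume s: "s \<in> {0..1}" and x: "x \<in> off_graph k"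
    have "h (s, x) \<in> off_graph k"
    proof (rule ccontr)
      assume "h (s, x) \<notin> off_graph k"
      then have le: "h (s, x) 0 \<le> h (s, x) 1" and eq: "\<And>i. i \<in> {2..<k} \<Longrightarrow> h (s, x) i = mid3 k (h (s, x))"
        using assms by (auto simp: off_graph_def h_def)
      from le have le': "(1 - s) * x 0 + s \<le> (1 - s) * x 1"
        by (simp add: h_def)
      have s1: "s < 1"
        using le' s by (cases "s = 1") auto
      have "(1 - s) * x 0 \<le> (1 - s) * x 1"
        using le' s by auto
      then have "x 0 \<le> x 1"
        using s1 by simp
      moreover have "x i = mid3 k x" if i: "i \<in> {2..<k}" for i
      proof -
        have "(1 - s) * (x i - mid3 k x) = 0"
          using eq[OF i] i unfolding mid by (simp add: h_def)
        then show ?thesis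
          using s1 by simp
      qed
      ultimately show False
        using x by (auto simp: off_graph_def)
    qed
    then show "h (s, x) \<in> off_graph k" .
  next
    fix x assume "x \<in> off_graph k"
    then show "h (0, x) = id x"
      by (auto simp: h_def mid3_def fun_eq_iff off_graph_def)
    show "h (1, x) = (\<lambda>i. if i = 0 then 1 else if i = 1 \<or> k \<le> i then 0 else 1)"
      using assms by (auto simp: h_def fun_eq_iff)
  qed
  then show ?thesis
    unfolding contractible_def by (metis)
qed

lemma base_cells_iff:
  "(T, U) \<in> base_cells k \<longleftrightarrow>
    (\<exists>j<k. T = {..<k} - {j} \<and> (U = {j} \<or> U = {k})) \<or> T = {2..k} \<and> U = {1}"
  unfolding base_cells_def by blast

text \<open>The graph is the cone over the path of three arcs, vertices included. The rest of the
  tree consists of leaf arcs; for each of them the implication puts \<open>x k\<close> strictly on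
  the side of \<open>x j\<close>, which excludes the arc together with its outer end point.\<close>

lemma cell_complement_0_iff:
  assumes k: "3 \<le> k" and x: "\<forall>i\<ge>Suc k. x i = 0"
  shows "x \<in> cell_complement k 0 \<longleftrightarrow> x \<in> off_graph k \<and>
    (\<forall>j<k. \<forall>a. (\<forall>i\<in>{..<k} - {j}. x i = a) \<longrightarrow>
       (j \<noteq> 1 \<longrightarrow> a < x j \<longrightarrow> a < x k) \<and> (j \<noteq> 0 \<longrightarrow> x j < a \<longrightarrow> x k < a))" (is "_ \<longleftrightarrow> ?A \<and> ?B")
proof (intro iffI conjI)
  assume g: "x \<in> cell_complement k 0"
  then have xc: "x \<in> conf k (Suc k)" and xcell: "\<And>T U. (T, U) \<in> base_cells k \<Longrightarrow> x \<notin> cell (Suc k) T U"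
    unfolding cell_complement_def by auto
  have ne: "x k \<noteq> a" if "j < k" "\<forall>i\<in>{..<k} - {j}. x i = a" for j a
  proof -
    have "{..<k} - {j} \<subseteq> {..<Suc k}"
      by auto
    then show ?thesis
      using conf_block_maximal[OF xc, of "{..<k} - {j}" a k] that k by auto
  qed
  have neq: "x 0 \<noteq> x 1 \<or> (\<exists>i\<in>{2..<k}. x i \<noteq> x 0)"
  proof (rule ccontr)
    assume *: "\<not> ?thesis"
    have "x i = x 0" if i: "i \<in> {..<k}" for i
    proof -
      consider "i = 0" | "i = 1" | "i \<in> {2..<k}"
        using i by fastforce
      then show ?thesis
        using * by cases auto
    qed
    moreover have "{..<k} \<subseteq> {..<Suc k}"
      by auto
    ultimately show False
      using conf_no_block[OF xc, of "{..<k}" "x 0"] card_lessThan by blast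
  qed
  have up: "a < x k" if j: "j < k" "\<forall>i\<in>{..<k} - {j}. x i = a" "a < x j" for j a
  proof (rule ccontr)
    assume "\<not> a < x k"
    then have "x k < a"
      using ne[OF j(1,2)] by linarith
    then have "x \<in> cell (Suc k) ({..<k} - {j}) {j}"
      unfolding cell_def using j by (intro CollectI exI[of _ a]) (auto simp: less_Suc_eq)
    then show False
      using xcell j(1) unfolding base_cells_iff by blast
  qed
  have down: "x k < a" if j: "j < k" "\<forall>i\<in>{..<k} - {j}. x i = a" "x j < a" for j a
  proof (rule ccontr)
    assume "\<not> x k < a"
    then have "a < x k"
      using ne[OF j(1,2)] by linarith
    then have "x \<in> cell (Suc k) ({..<k} - {j}) {k}"
      unfolding cell_def using j by (intro CollectI exI[of _ a]) (auto simp: less_Suc_eq)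
    then show False
      using xcell j(1) unfolding base_cells_iff by blast
  qed
  show ?B
    using up down by blast
  have False if le: "x 0 \<le> x 1" and eq: "\<And>i. i \<in> {2..<k} \<Longrightarrow> x i = mid3 k x"
  proof -
    \<comment> \<open>The position of \<open>x k\<close> relative to \<open>x 0\<close> and
      \<open>x 1\<close> determines the arc or vertex of the path.\<close>
    consider "x 0 = x 1" | "x 0 < x 1" "x k \<le> x 0" | "x 0 < x k" "x k < x 1" | "x 0 < x 1" "x 1 \<le> x k"
      using le by linarith
    then show False
    proof cases
      case 1
      then have "mid3 k x = x 0"
        by (auto simp: mid3_def)
      then show False
        using neq 1 eq by metis
    next
      case 2
      then have m: "mid3 k x = x 0"
        by (auto simp: mid3_def)
      have "\<forall>i\<in>{..<k} - {1}. x i = x 0"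
      proof
        fix i assume "i \<in> {..<k} - {1}"
        then consider "i = 0" | "i \<in> {2..<k}"
          by fastforce
        then show "x i = x 0"
          using eq m by cases metis+
      qed
      moreover have "1 < k"
        using k by simp
      ultimately show False
        using up[of 1 "x 0"] 2 by (meson not_le)
    next
      case 3
      then have m: "mid3 k x = x k"
        by (auto simp: mid3_def)
      have "x i = x k" if "i \<in> {2..k}" for i
        using eq[of i] m that by (cases "i = k") simp_all
      moreover have "i = 0" if "i \<in> {..<Suc k} - {2..k} - {1}" for i
        using that by auto
      ultimately have "x \<in> cell (Suc k) {2..k} {1}"
        unfolding cell_def using 3 by (intro CollectI exI[of _ "x k"] conjI ballI) (blast | force)+
      then show False
        using xcell unfolding base_cells_iff by blast
    next
      case 4
      then have m: "mid3 k x = x 1"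
        by (auto simp: mid3_def)
      have "\<forall>i\<in>{..<k} - {0}. x i = x 1"
      proof
        fix i assume "i \<in> {..<k} - {0}"
        then consider "i = 1" | "i \<in> {2..<k}"
          by fastforce
        then show "x i = x 1"
          using eq m by cases metis+
      qed
      moreover have "0 < k"
        using k by simp
      ultimately show False
        using down[of 0 "x 1"] 4 by (meson not_le)
    qed
  qed
  then show ?A
    using x unfolding off_graph_def by blast
next
  assume AB: "?A \<and> ?B"
  then have A: "\<not> (x 0 \<le> x 1 \<and> (\<forall>i\<in>{2..<k}. x i = mid3 k x))"
    and B: "\<And>j a. \<lbrakk>j < k; \<forall>i\<in>{..<k} - {j}. x i = a\<rbrakk> \<Longrightarrow>
       (j \<noteq> 1 \<longrightarrow> a < x j \<longrightarrow> a < x k) \<and> (j \<noteq> 0 \<longrightarrow> x j < a \<longrightarrow> x k < a)"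
    by (auto simp: off_graph_def)
  have A0: False if "x 1 = a" "x 0 < a" "a \<le> x k" "\<forall>i\<in>{2..<k}. x i = a" for a
    using A that by (auto simp: mid3_def)
  have A1: False if "x 0 = a" "a < x 1" "x k \<le> a" "\<forall>i\<in>{2..<k}. x i = a" for a
    using A that by (auto simp: mid3_def)
  have A2: False if "x 0 = a" "x 1 = a" "\<forall>i\<in>{2..<k}. x i = a" for a
    using A that by (auto simp: mid3_def)
  have A3: False if "x k = a" "x 0 < a" "a < x 1" "\<forall>i\<in>{2..<k}. x i = a" for a
    using A that by (auto simp: mid3_def)
  have B1: "a < x k" if "j < k" "\<forall>i\<in>{..<k} - {j}. x i = a" "a < x j" for j a
  \<comment> \<open>For \<open>j = 1\<close> this arc lies on the path, so the graph excludes it;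
    \<open>j = 0\<close> plays the same part in the next claim.\<close>
  proof (cases "j = 1")
    case True
    then show ?thesis
      using A1[of a] that k by force
  qed (use B that in auto)
  have B2: "x k < a" if "j < k" "\<forall>i\<in>{..<k} - {j}. x i = a" "x j < a" for j a
  proof (cases "j = 0")
    case True
    then show ?thesis
      using A0[of a] that k by force
  qed (use B that in auto)
  have B3: False if "\<forall>i\<in>{..<k}. x i = a" for a
    using A2[of a] that k by auto
  show "x \<in> cell_complement k 0"
    unfolding cell_complement_def
  proof (intro CollectI conjI ballI; clarify?)
    have False if I: "I \<subseteq> {..<Suc k}" "card I = k" "\<forall>i\<in>I. \<forall>j\<in>I. x i = x j" for I
    proof -
      have "card ({..<Suc k} - I) = 1"
        using I by (simp add: card_Diff_subset finite_subset)
      then obtain j where j: "{..<Suc k} - I = {j}"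
        using card_1_singletonE by blast
      then have Ij: "I = {..<Suc k} - {j}" "j \<le> k"
        using I(1) by auto
      show False
      proof (cases "j = k")
        case True
        then have "I = {..<k}"
          using Ij by auto
        moreover from this have "0 \<in> I"
          using k by simp
        ultimately show False
          using B3[of "x 0"] I(3) by blast
      next
        case False
        then have "j < k" "k \<in> I" "{..<k} - {j} \<subseteq> I"
          using Ij by auto
        then have *: "\<forall>i\<in>{..<k} - {j}. x i = x k"
          using I(3) by blast
        consider "x j = x k" | "x k < x j" | "x j < x k"
          by linarith
        then show False
        proof cases
          case 1
          then show False
            using B3[of "x k"] * by blast
        qed (use B1[OF \<open>j < k\<close> *] B2[OF \<open>j < k\<close> *] in auto)
      qed
    qed
    then have "x \<in> conf k (Suc k)"
      unfolding conf_def using x by blast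
    then show "x \<in> conf k (k + 1 + 0)"
      by simp
    fix T U assume TU: "(T, U) \<in> cells k 0" and "x \<in> cell (k + 1 + 0) T U"
    then obtain a where a: "\<forall>i\<in>T. x i = a" "\<And>i. i \<in> U \<Longrightarrow> a < x i"
      "\<And>i. i \<in> {..<Suc k} - T - U \<Longrightarrow> x i < a"
      unfolding cell_def by auto
    from TU consider j where "j < k" "T = {..<k} - {j}" "U = {j}" | j where "j < k" "T = {..<k} - {j}" "U = {k}"
      | "T = {2..k}" "U = {1}"
      unfolding cells.simps(1) base_cells_iff by blast
    then show False
    proof cases
      case (1 j)
      have "a < x j" "x k < a"
        using a(2)[of j] a(3)[of k] 1 by auto
      then show False
        using B1[of j a] a(1) 1 by auto
    next
      case (2 j)
      have "a < x k" "x j < a"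
        using a(2)[of k] a(3)[of j] 2 by auto
      then show False
        using B2[of j a] a(1) 2 by auto
    next
      case 3
      have "a < x 1" "x 0 < a" "x k = a"
        using a(1) a(2)[of 1] a(3)[of 0] 3 k by auto
      then show False
        using A3[of a] a(1) 3 by auto
    qed
  qed
qed

text \<open>Where \<open>x j\<close> stands apart from the other coordinates below \<open>k\<close> by more than their diameter, \<open>shift\<close>
  moves \<open>x k\<close> towards \<open>x j\<close>. This pushes \<open>x k\<close> off the cells that are leaves of the tree.\<close>

definition isolation_weight :: "real \<Rightarrow> real \<Rightarrow> real" where
  "isolation_weight g e = 2 * max 0 (g - e) / (max 0 (g - e) + e + \<bar>g\<bar>)"

definition diam :: "nat \<Rightarrow> nat \<Rightarrow> (nat \<Rightarrow> real) \<Rightarrow> real" where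
  "diam k j x = Max (x ` ({..<k} - {j})) - Min (x ` ({..<k} - {j}))"

text \<open>The two cases set to \<open>0\<close> belong to arcs on the path, which are removed
  along with the graph.\<close>

definition isolation :: "nat \<Rightarrow> nat \<Rightarrow> (nat \<Rightarrow> real) \<Rightarrow> real" where
  "isolation k j x =
     (if j = 1 then 0 else isolation_weight (x j - Max (x ` ({..<k} - {j}))) (diam k j x)) +
     (if j = 0 then 0 else isolation_weight (Min (x ` ({..<k} - {j})) - x j) (diam k j x))"

definition shift :: "nat \<Rightarrow> real \<times> (nat \<Rightarrow> real) \<Rightarrow> nat \<Rightarrow> real" where
  "shift k z = (snd z)(k := snd z k + fst z * (\<Sum>j<k. isolation k j (snd z) * (snd z j - snd z k)))"

lemma isolation_weight_eq_0: "\<lbrakk>g \<le> 0; 0 \<le> e\<rbrakk> \<Longrightarrow> isolation_weight g e = 0"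
  by (simp add: isolation_weight_def max_def)

text \<open>For \<open>e = 0 < g\<close> numerator and denominator are both \<open>2 * g\<close>.
  The term \<open>\<bar>g\<bar>\<close> keeps the denominator positive for \<open>0 \<le> e\<close>
  unless \<open>g\<close> and \<open>e\<close> both vanish.\<close>

lemma isolation_weight_eq_1: "0 < g \<Longrightarrow> isolation_weight g 0 = 1"
  by (simp add: isolation_weight_def)

lemma rest_nonempty:
  fixes j k :: nat
  assumes "3 \<le> k"
  shows "finite ({..<k} - {j})" "{..<k} - {j} \<noteq> {}"
proof -
  have "(if j = 0 then 1 else 0) \<in> {..<k} - {j}"
    using assms by auto
  then show "{..<k} - {j} \<noteq> {}"
    by blast
qed simp

lemma diam_nonneg:
  assumes "3 \<le> k"
  shows "0 \<le> diam k j x"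
proof -
  obtain i where "i \<in> {..<k} - {j}"
    using rest_nonempty[OF assms] by blast
  then have "Min (x ` ({..<k} - {j})) \<le> x i" "x i \<le> Max (x ` ({..<k} - {j}))"
    by auto
  then show ?thesis
    by (simp add: diam_def)
qed

lemma isolation_eq_0:
  assumes k: "3 \<le> k" and "j \<noteq> 1 \<Longrightarrow> \<exists>i<k. i \<noteq> j \<and> x j \<le> x i" "j \<noteq> 0 \<Longrightarrow> \<exists>i<k. i \<noteq> j \<and> x i \<le> x j"
  shows "isolation k j x = 0"
proof -
  have "x j - Max (x ` ({..<k} - {j})) \<le> 0" if j: "j \<noteq> 1"
  proof -
    obtain i where i: "i < k" "i \<noteq> j" "x j \<le> x i"
      using assms(2)[OF j] by blast
    then have "x i \<le> Max (x ` ({..<k} - {j}))"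
      by simp
    then show ?thesis
      using i by linarith
  qed
  moreover have "Min (x ` ({..<k} - {j})) - x j \<le> 0" if j: "j \<noteq> 0"
  proof -
    obtain i where i: "i < k" "i \<noteq> j" "x i \<le> x j"
      using assms(3)[OF j] by blast
    then have "Min (x ` ({..<k} - {j})) \<le> x i"
      by simp
    then show ?thesis
      using i by linarith
  qed
  ultimately show ?thesis
    unfolding isolation_def using diam_nonneg[OF k] by (auto simp: isolation_weight_eq_0)
qed

lemma Max_Min_const:
  fixes j k :: nat
  assumes "3 \<le> k" "\<forall>i\<in>{..<k} - {j}. x i = a"
  shows "Max (x ` ({..<k} - {j})) = a" "Min (x ` ({..<k} - {j})) = a"
proof -
  have "x ` ({..<k} - {j}) = {a}"
    using assms(2) rest_nonempty(2)[OF assms(1), of j] by (auto simp: image_iff)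
  then show "Max (x ` ({..<k} - {j})) = a" "Min (x ` ({..<k} - {j})) = a"
    by simp_all
qed

lemma isolation_eq_1:
  assumes k: "3 \<le> k" and c: "\<forall>i\<in>{..<k} - {j}. x i = a" and "j \<noteq> 1 \<and> a < x j \<or> j \<noteq> 0 \<and> x j < a"
  shows "isolation k j x = 1"
  using assms(3) unfolding isolation_def diam_def Max_Min_const[OF k c]
  by (auto simp: isolation_weight_eq_0 isolation_weight_eq_1)

lemma shift_isolated:
  assumes k: "3 \<le> k" and "j < k" and c: "\<forall>i\<in>{..<k} - {j}. x i = a"
    and j: "j \<noteq> 1 \<and> a < x j \<or> j \<noteq> 0 \<and> x j < a"
  shows "shift k (s, x) = x(k := (1 - s) * x k + s * x j)"
proof -
  have "isolation k i x = 0" if i: "i \<in> {..<k} - {j}" for i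
  proof -
    \<comment> \<open>As \<open>3 \<le> k\<close>, a third index \<open>l\<close> shares the value
      \<open>a\<close> with \<open>i\<close>, so \<open>x i\<close> stands apart on neither side and
      only \<open>j\<close> contributes to the sum.\<close>
    obtain l where "l < k" "l \<noteq> i" "l \<noteq> j"
    proof -
      have "card {i, j} < card {..<k}"
        using k by (simp add: card_insert_if)
      then have "\<not> {..<k} \<subseteq> {i, j}"
        by (meson card_mono finite.emptyI finite_insert not_le)
      then show ?thesis
        using that by blast
    qed
    then have "x l = x i"
      using c i by auto
    then show ?thesis
      using \<open>l < k\<close> \<open>l \<noteq> i\<close> by (intro isolation_eq_0[OF k]) auto
  qed
  then have "(\<Sum>i<k. isolation k i x * (x i - x k)) = (\<Sum>i\<in>{j}. isolation k i x * (x i - x k))"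
    using assms(2) by (intro sum.mono_neutral_right) auto
  also have "\<dots> = x j - x k"
    using isolation_eq_1[OF k c j] by simp
  finally have e: "(\<Sum>i<k. isolation k i x * (x i - x k)) = x j - x k" .
  show ?thesis
    unfolding shift_def fst_conv snd_conv e by (simp add: algebra_simps)
qed

text \<open>Only \<open>x k\<close> changes. If the result were on the graph, all coordinates below
  \<open>k\<close> would lie between \<open>x 0\<close> and \<open>x 1\<close>; then every weight
  would vanish and \<open>shift\<close> would not have moved the point.\<close>

lemma shift_off_graph:
  assumes k: "3 \<le> k" and x: "x \<in> off_graph k"
  shows "shift k (s, x) \<in> off_graph k"
proof (rule ccontr)
  assume n: "shift k (s, x) \<notin> off_graph k"
  have eq: "shift k (s, x) i = x i" if "i \<noteq> k" for i
    using that by (simp add: shift_def)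
  have le: "x 0 \<le> x 1" and mid: "\<And>i. i \<in> {2..<k} \<Longrightarrow> x i = mid3 k (shift k (s, x))"
    using n x k eq by (auto simp: off_graph_def)
  have m: "x 0 \<le> mid3 k (shift k (s, x))" "mid3 k (shift k (s, x)) \<le> x 1"
    using le eq k by (auto simp: mid3_def)
  have "isolation k j x = 0" if jk: "j < k" for j
  proof (rule isolation_eq_0[OF k])
    consider "j = 0" | "j = 1" | "j \<in> {2..<k}"
      using jk by fastforce
    then show "\<exists>i<k. i \<noteq> j \<and> x j \<le> x i" if "j \<noteq> 1"
    proof cases
      case 3
      then show ?thesis
        using mid[OF 3] m k by (intro exI[of _ 1]) auto
    qed (use le k that in \<open>auto intro!: exI[of _ 1]\<close>)
    consider "j = 0" | "j = 1" | "j \<in> {2..<k}"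
      using jk by fastforce
    then show "\<exists>i<k. i \<noteq> j \<and> x i \<le> x j" if "j \<noteq> 0"
    proof cases
      case 3
      then show ?thesis
        using mid[OF 3] m k by (intro exI[of _ 0]) auto
    qed (use le k that in \<open>auto intro!: exI[of _ 0]\<close>)
  qed
  then have "shift k (s, x) = x"
    by (simp add: shift_def)
  then show False
    using n x by simp
qed

text \<open>A weight can be discontinuous only where gap and diameter both vanish. There all
  coordinates below \<open>k\<close> agree, and such a point lies on the graph.\<close>

lemma continuous_on_shift:
  assumes k: "3 \<le> k"
  shows "continuous_on ({0..1} \<times> off_graph k) (shift k)"
proof -
  let ?S = "{0..1::real} \<times> off_graph k"
  note r = rest_nonempty[OF k]
  have M: "continuous_on ?S (\<lambda>z. Max (snd z ` ({..<k} - {j})))" "continuous_on ?S (\<lambda>z. Min (snd z ` ({..<k} - {j})))" for j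
    by (intro continuous_intros r)+
  then have d: "continuous_on ?S (\<lambda>z. diam k j (snd z))" for j
    unfolding diam_def by (intro continuous_on_diff)
  have w: "continuous_on ?S (\<lambda>z. isolation_weight (g z) (diam k j (snd z)))"
    if g: "continuous_on ?S g" and ne: "\<And>z. \<lbrakk>z \<in> ?S; diam k j (snd z) = 0; g z = 0\<rbrakk> \<Longrightarrow> False" for g j
    unfolding isolation_weight_def
  proof (intro continuous_on_divide continuous_on_mult continuous_on_add continuous_on_max continuous_on_diff
      continuous_on_const g d continuous_on_rabs ballI)
    fix z assume z: "z \<in> ?S"
    have "diam k j (snd z) \<noteq> 0 \<or> g z \<noteq> 0"
      using ne[OF z] by blast
    then show "max 0 (g z - diam k j (snd z)) + diam k j (snd z) + \<bar>g z\<bar> \<noteq> 0"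
      using diam_nonneg[OF k, of j "snd z"] by (smt (verit))
  qed
  have all_eq: False if z: "z \<in> ?S" and d0: "diam k j (snd z) = 0" and j: "j < k"
    and g: "snd z j = Max (snd z ` ({..<k} - {j})) \<or> snd z j = Min (snd z ` ({..<k} - {j}))" for z j
  proof -
    let ?x = "snd z"
    let ?R = "?x ` ({..<k} - {j})"
    have mm: "Max ?R = Min ?R"
      using d0 by (simp add: diam_def)
    have "?x i = Min ?R" if "i < k" for i
    proof (cases "i = j")
      case False
      then have "Min ?R \<le> ?x i" "?x i \<le> Max ?R"
        using that by auto
      then show ?thesis
        using mm by linarith
    qed (use g mm in auto)
    then have "?x 0 \<le> ?x 1 \<and> (\<forall>i\<in>{2..<k}. ?x i = mid3 k ?x)"
      using k by (auto simp: mid3_def)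
    then show False
      using z by (auto simp: off_graph_def)
  qed
  have "continuous_on ?S (\<lambda>z. isolation k j (snd z))" if j: "j < k" for j
  proof -
    have "continuous_on ?S (\<lambda>z. isolation_weight (snd z j - Max (snd z ` ({..<k} - {j}))) (diam k j (snd z)))"
    proof (rule w)
      fix z assume "z \<in> ?S" "diam k j (snd z) = 0" "snd z j - Max (snd z ` ({..<k} - {j})) = 0"
      then show False
        using all_eq[OF _ _ j, of z] by simp
    qed (intro continuous_on_diff M continuous_intros)
    moreover have "continuous_on ?S (\<lambda>z. isolation_weight (Min (snd z ` ({..<k} - {j})) - snd z j) (diam k j (snd z)))"
    proof (rule w)
      fix z assume "z \<in> ?S" "diam k j (snd z) = 0" "Min (snd z ` ({..<k} - {j})) - snd z j = 0"
      then show False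
        using all_eq[OF _ _ j, of z] by simp
    qed (intro continuous_on_diff M continuous_intros)
    ultimately show ?thesis
      unfolding isolation_def by (intro continuous_on_add) (cases "j = 1"; cases "j = 0"; simp)+
  qed
  then show ?thesis
    unfolding shift_def[abs_def] by (intro continuous_intros) auto
qed

text \<open>Over the block of a leaf arc, \<open>x k\<close> moves linearly to \<open>x j\<close>.
  It ends on the required side of the block in any case, and never leaves that side if it starts
  there.\<close>

lemma shift_in_cell_complement:
  assumes k: "3 \<le> k" and x: "x \<in> off_graph k" and s: "s \<in> {0..1}" and "x \<in> cell_complement k 0 \<or> s = 1"
  shows "shift k (s, x) \<in> cell_complement k 0"
proof -
  have eq: "shift k (s, x) i = x i" if "i \<noteq> k" for i
    using that by (simp add: shift_def)
  have x0: "\<forall>i\<ge>Suc k. x i = 0"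
    using x by (simp add: off_graph_def)
  then have "\<forall>i\<ge>Suc k. shift k (s, x) i = 0"
    using eq by auto
  moreover have "(j \<noteq> 1 \<longrightarrow> a < shift k (s, x) j \<longrightarrow> a < shift k (s, x) k) \<and>
      (j \<noteq> 0 \<longrightarrow> shift k (s, x) j < a \<longrightarrow> shift k (s, x) k < a)"
    if j: "j < k" and "\<forall>i\<in>{..<k} - {j}. shift k (s, x) i = a" for j a
  proof -
    have c: "\<forall>i\<in>{..<k} - {j}. x i = a"
      using that eq by (metis Diff_iff lessThan_iff less_irrefl)
    have xj: "shift k (s, x) j = x j"
      using j eq by simp
    have gd: "s = 1 \<or> (j \<noteq> 1 \<longrightarrow> a < x j \<longrightarrow> a < x k) \<and> (j \<noteq> 0 \<longrightarrow> x j < a \<longrightarrow> x k < a)"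
      using cell_complement_0_iff[OF k x0] assms(4) j c by blast
    show ?thesis
    proof (intro conjI impI)
      assume "j \<noteq> 1" "a < shift k (s, x) j"
      then have *: "j \<noteq> 1" "a < x j"
        using xj by auto
      then have "s = 1 \<or> a < x k"
        using gd by blast
      then have "a < (1 - s) * x k + s * x j"
        using convex_bound_lt[of "- x k" "- a" "- x j" "1 - s" s] *(2) s by auto
      then show "a < shift k (s, x) k"
        using shift_isolated[OF k j c] * by simp
    next
      assume "j \<noteq> 0" "shift k (s, x) j < a"
      then have *: "j \<noteq> 0" "x j < a"
        using xj by auto
      then have "s = 1 \<or> x k < a"
        using gd by blast
      then have "(1 - s) * x k + s * x j < a"
        using convex_bound_lt[of "x k" a "x j" "1 - s" s] *(2) s by auto
      then show "shift k (s, x) k < a"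
        using shift_isolated[OF k j c] * by simp
    qed
  qed
  ultimately show ?thesis
    using cell_complement_0_iff[OF k, of "shift k (s, x)"] shift_off_graph[OF k x] by blast
qed

lemma contractible_cell_complement:
  assumes k: "3 \<le> k"
  shows "contractible (cell_complement k r)"
proof (induction r)
  case 0
  have sub: "cell_complement k 0 \<subseteq> off_graph k"
  proof
    fix x assume x: "x \<in> cell_complement k 0"
    then have "\<forall>i\<ge>Suc k. x i = 0"
      by (auto simp: cell_complement_def conf_def)
    then show "x \<in> off_graph k"
      using cell_complement_0_iff[OF k] x by blast
  qed
  have c: "continuous_on ({0..1} \<times> cell_complement k 0) (shift k)"
    by (rule continuous_on_subset[OF continuous_on_shift[OF k]]) (use sub in auto)
  show ?case
  \<comment> \<open>The inclusion followed by \<open>shift\<close> at time \<open>1\<close> is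
    joined to the identity by \<open>shift\<close> itself.\<close>
  proof (rule contractible_dominated[OF _ _ _ _ _ contractible_off_graph[OF k]])
    show "continuous_on (cell_complement k 0) id"
      by (rule continuous_on_id')
    show "id \<in> cell_complement k 0 \<rightarrow> off_graph k"
      using sub by auto
    show "continuous_on (off_graph k) (\<lambda>x. shift k (1, x))"
      by (rule continuous_on_compose2[OF continuous_on_shift[OF k]]) (auto intro!: continuous_intros)
    show "(\<lambda>x. shift k (1, x)) \<in> off_graph k \<rightarrow> cell_complement k 0"
      using shift_in_cell_complement[OF k] by auto
    show "homotopic_with_canon (\<lambda>_. True) (cell_complement k 0) (cell_complement k 0) id ((\<lambda>x. shift k (1, x)) \<circ> id)"
      by (rule homotopic_canonI[OF c]) (use sub shift_in_cell_complement[OF k] in \<open>auto simp: shift_def\<close>)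
  qed
next
  case (Suc r)
  then show ?case
    by (rule contractible_cell_complement_Suc[OF k])
qed

section \<open>Tubes around the cells\<close>

text \<open>It involves only the reference coordinate \<open>x (Min T)\<close> and the coordinates
  outside \<open>T\<close>, hence is constant along a normal disk. Any divisor greater than
  \<open>3\<close> keeps tubes over different overlapping blocks apart.\<close>

definition spacing :: "nat \<Rightarrow> nat set \<Rightarrow> (nat \<Rightarrow> real) \<Rightarrow> real" where
  "spacing n T x = Min ((\<lambda>j. \<bar>x j - x (Min T)\<bar>) ` ({..<n} - T)) / 4"

text \<open>An arbitrary labelling of the block without its reference index by the
  \<open>k - 2\<close> coordinates of the disk.\<close>

definition enum_rest :: "nat set \<Rightarrow> nat \<Rightarrow> nat" where
  "enum_rest T = (SOME e. bij_betw e {..<card T - 1} (T - {Min T}))"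

definition offset :: "nat set \<Rightarrow> (nat \<Rightarrow> real) \<Rightarrow> nat \<Rightarrow> real" where
  "offset T x = (\<lambda>i. if i < card T - 1 then x (enum_rest T i) - x (Min T) else 0)"

text \<open>Weak inequalities make the tube closed; within the configuration space those on the
  signs turn out to be strict.\<close>

definition tube :: "nat \<Rightarrow> nat \<Rightarrow> nat set \<times> nat set \<Rightarrow> (nat \<Rightarrow> real) set" where
  "tube k n = (\<lambda>(T, U). {x \<in> conf k n. (\<forall>j\<in>U. x (Min T) \<le> x j) \<and> (\<forall>j\<in>{..<n} - T - U. x j \<le> x (Min T)) \<and>
     L2_set (offset T x) {..<card T - 1} \<le> spacing n T x})"

definition tube_normal :: "nat \<Rightarrow> nat set \<Rightarrow> (nat \<Rightarrow> real) \<Rightarrow> nat \<Rightarrow> real" where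
  "tube_normal n T x = (\<lambda>i. (1 / spacing n T x) * offset T x i)"

text \<open>Stated without \<open>conf\<close>, so that convexity is apparent. That the points built
  from it are configurations is the content of \<open>in_conf\<close>.\<close>

definition flat_cell :: "nat \<Rightarrow> nat set \<times> nat set \<Rightarrow> (nat \<Rightarrow> real) set" where
  "flat_cell n = (\<lambda>(T, U). {x. (\<forall>i\<ge>n. x i = 0) \<and> (\<forall>i\<in>T. x i = x (Min T)) \<and> (\<forall>j\<in>U. x (Min T) < x j) \<and>
     (\<forall>j\<in>{..<n} - T - U. x j < x (Min T))})"

definition flatten :: "nat set \<Rightarrow> (nat \<Rightarrow> real) \<Rightarrow> nat \<Rightarrow> real" where
  "flatten T x = (\<lambda>i. if i \<in> T then x (Min T) else x i)"

text \<open>Offsets are measured in units of \<open>spacing\<close>, so unit vectors reach precisely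
  the boundary of the tube.\<close>

definition spread :: "nat \<Rightarrow> nat set \<Rightarrow> (nat \<Rightarrow> real) \<times> (nat \<Rightarrow> real) \<Rightarrow> nat \<Rightarrow> real" where
  "spread n T = (\<lambda>(y, u) i. if i \<in> T - {Min T} then y i + spacing n T y * u (inv_into {..<card T - 1} (enum_rest T) i) else y i)"

definition flat_center :: "nat \<Rightarrow> nat set \<times> nat set \<Rightarrow> nat \<Rightarrow> real" where
  "flat_center n = (\<lambda>(T, U) i. if i \<in> U then 1 else if i \<in> {..<n} - T then -1 else 0)"

definition flat_contraction :: "nat \<Rightarrow> nat set \<times> nat set \<Rightarrow> real \<times> (nat \<Rightarrow> real) \<Rightarrow> nat \<Rightarrow> real" where
  "flat_contraction n c = (\<lambda>z i. (1 - fst z) * snd z i + fst z * flat_center n c i)"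

definition two_sided :: "nat \<Rightarrow> nat \<Rightarrow> nat set \<times> nat set \<Rightarrow> bool" where
  "two_sided k n = (\<lambda>(T, U). T \<subseteq> {..<n} \<and> card T = k - 1 \<and> U \<subseteq> {..<n} - T \<and> U \<noteq> {} \<and> U \<noteq> {..<n} - T)"

section \<open>The product structure of a single tube\<close>

locale two_sided_cell =
  fixes k n :: nat and T U :: "nat set"
  assumes k: "3 \<le> k" and n: "n < 2 * k" and two_sided: "two_sided k n (T, U)"
begin

lemma block: "T \<subseteq> {..<n}" "card T = k - 1" "finite T" "T \<noteq> {}" "Min T \<in> T"
proof -
  show 1: "T \<subseteq> {..<n}" "card T = k - 1"
    using two_sided by (auto simp: two_sided_def)
  show 2: "finite T"
    using 1 finite_subset by blast
  show 3: "T \<noteq> {}"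
    using 1 k by auto
  show "Min T \<in> T"
    using 2 3 by simp
qed

lemma signs: "U \<subseteq> {..<n} - T" "U \<noteq> {}" "{..<n} - T - U \<noteq> {}" "{..<n} - T \<noteq> {}" "finite U"
  using two_sided finite_subset[of U "{..<n}"] by (auto simp: two_sided_def)

lemma flat_cellI:
  assumes "\<And>i. n \<le> i \<Longrightarrow> x i = 0" "\<And>i. i \<in> T \<Longrightarrow> x i = x (Min T)" "\<And>j. j \<in> U \<Longrightarrow> x (Min T) < x j"
    "\<And>j. j \<in> {..<n} - T - U \<Longrightarrow> x j < x (Min T)"
  shows "x \<in> flat_cell n (T, U)"
  using assms unfolding flat_cell_def by blast

lemma flat_cellD:
  assumes "x \<in> flat_cell n (T, U)"
  shows "n \<le> i \<Longrightarrow> x i = 0" "i \<in> T \<Longrightarrow> x i = x (Min T)" "i \<in> U \<Longrightarrow> x (Min T) < x i"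
    "i \<in> {..<n} - T - U \<Longrightarrow> x i < x (Min T)"
  using assms unfolding flat_cell_def by blast+

lemma enum_rest: "bij_betw (enum_rest T) {..<k - 2} (T - {Min T})"
proof -
  have "card (T - {Min T}) = k - 2"
    using block k by simp
  then have "\<exists>e. bij_betw e {..<k - 2} (T - {Min T})"
    using block(3) by (metis finite_Diff ex_bij_betw_nat_finite atLeast0LessThan)
  moreover have "card T - 1 = k - 2"
    using block k by simp
  ultimately show ?thesis
    unfolding enum_rest_def by (metis (mono_tags, lifting) someI_ex)
qed

lemma card_block: "card T - Suc 0 = k - 2"
  using block k by simp

lemma enum_rest_in: "i < k - 2 \<Longrightarrow> enum_rest T i \<in> T" "i < k - 2 \<Longrightarrow> enum_rest T i \<noteq> Min T"
  using enum_rest by (auto dest: bij_betwE)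

lemma inv_enum_rest: "i < k - 2 \<Longrightarrow> inv_into {..<k - 2} (enum_rest T) (enum_rest T i) = i"
  using enum_rest by (simp add: bij_betw_inv_into_left)

lemma enum_rest_inv:
  assumes "i \<in> T - {Min T}"
  shows "enum_rest T (inv_into {..<k - 2} (enum_rest T) i) = i" "inv_into {..<k - 2} (enum_rest T) i < k - 2"
  using enum_rest assms inv_into_into[of i "enum_rest T" "{..<k - 2}"]
  by (auto simp: bij_betw_inv_into_right bij_betw_def)

lemma continuous_on_spacing [continuous_intros]:
  assumes "continuous_on S f"
  shows "continuous_on S (\<lambda>x. spacing n T (f x))"
  unfolding spacing_def using signs(4)
  by (intro continuous_intros continuous_on_product_then_coordinatewise[OF assms]) auto

lemma continuous_on_offset [continuous_intros]:
  assumes "continuous_on S f"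
  shows "continuous_on S (\<lambda>x. offset T (f x))"
proof (rule continuous_on_coordinatewise_then_product)
  fix i
  show "continuous_on S (\<lambda>x. offset T (f x) i)"
    unfolding offset_def
    by (cases "i < card T - 1") (auto intro!: continuous_on_diff continuous_on_product_then_coordinatewise[OF assms])
qed

lemma spacing_le: "j \<in> {..<n} - T \<Longrightarrow> 4 * spacing n T x \<le> \<bar>x j - x (Min T)\<bar>"
  unfolding spacing_def by (simp add: Min_le)

lemma offset_le:
  assumes "i \<in> T"
  shows "\<bar>x i - x (Min T)\<bar> \<le> L2_set (offset T x) {..<k - 2}"
proof (cases "i = Min T")
  case False
  then have i: "i \<in> T - {Min T}"
    using assms by blast
  let ?j = "inv_into {..<k - 2} (enum_rest T) i"
  have "\<bar>offset T x ?j\<bar> \<le> L2_set (\<lambda>i. \<bar>offset T x i\<bar>) {..<k - 2}"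
    using enum_rest_inv[OF i] by (intro member_le_L2_set) auto
  also have "\<dots> = L2_set (offset T x) {..<k - 2}"
    by (simp add: L2_set_def)
  finally show ?thesis
    using enum_rest_inv[OF i] by (simp add: offset_def card_block)
qed simp

text \<open>A set of \<open>k\<close> equal coordinates does not fit into the block, nor can it mix
  the block with coordinates at least four spacings away. Outside the block there are at most
  \<open>k\<close> coordinates because \<open>n < 2 * k\<close>, so it would consist of all of them,
  and these lie on both sides of the block.\<close>

lemma in_conf:
  assumes x: "\<forall>i\<ge>n. x i = 0" and pos: "0 < spacing n T x" and le: "L2_set (offset T x) {..<k - 2} \<le> spacing n T x"
    and above: "\<forall>j\<in>U. x (Min T) \<le> x j" and below: "\<forall>j\<in>{..<n} - T - U. x j \<le> x (Min T)"
  shows "x \<in> conf k n"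
proof -
  have False if I: "I \<subseteq> {..<n}" "card I = k" "\<forall>i\<in>I. \<forall>j\<in>I. x i = x j" for I
  proof -
    have fI: "finite I"
      using I(1) finite_subset by blast
    have "\<not> I \<subseteq> T"
      using card_mono[OF block(3), of I] I(2) block(2) k by auto
    then obtain j where j: "j \<in> I" "j \<notin> T"
      by blast
    have "I \<inter> T = {}"
    proof (rule ccontr)
      assume "I \<inter> T \<noteq> {}"
      then obtain i where i: "i \<in> I" "i \<in> T"
        by blast
      have "\<bar>x i - x (Min T)\<bar> \<le> spacing n T x"
        using offset_le[OF i(2), of x] le by linarith
      moreover have "4 * spacing n T x \<le> \<bar>x j - x (Min T)\<bar>"
        using spacing_le[of j x] j I(1) by auto
      moreover have "x i = x j"
        using I(3) i j by blast
      ultimately show False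
        using pos by linarith
    qed
    then have sub: "I \<subseteq> {..<n} - T"
      using I(1) by blast
    have "card ({..<n} - T) = n - (k - 1)"
      using block by (simp add: card_Diff_subset)
    then have "I = {..<n} - T"
      using I(2) n by (intro card_seteq[OF _ sub]) auto
    then obtain u l where ul: "u \<in> I" "u \<in> U" "l \<in> I" "l \<in> {..<n} - T - U"
      using signs by blast
    then have "x u = x l" "x (Min T) \<le> x u" "x l \<le> x (Min T)"
      using I(3) above below by blast+
    moreover have "4 * spacing n T x \<le> \<bar>x u - x (Min T)\<bar>"
      using spacing_le[of u x] ul signs(1) by blast
    ultimately show False
      using pos by linarith
  qed
  then show ?thesis
    unfolding conf_def using x by blast
qed

lemma tube_iff:
  "x \<in> tube k n (T, U) \<longleftrightarrow> x \<in> conf k n \<and> (\<forall>j\<in>U. x (Min T) \<le> x j) \<and> (\<forall>j\<in>{..<n} - T - U. x j \<le> x (Min T)) \<and>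
     L2_set (offset T x) {..<k - 2} \<le> spacing n T x"
  by (simp add: tube_def card_block)

text \<open>Otherwise the bound on the offset makes the block constant, and some further coordinate
  agrees with it: \<open>k\<close> equal coordinates.\<close>

lemma spacing_pos:
  assumes "x \<in> tube k n (T, U)"
  shows "0 < spacing n T x"
proof (rule ccontr)
  assume np: "\<not> 0 < spacing n T x"
  have t: "x \<in> conf k n" "L2_set (offset T x) {..<k - 2} \<le> spacing n T x"
    using assms by (auto simp: tube_iff)
  have "Min ((\<lambda>j. \<bar>x j - x (Min T)\<bar>) ` ({..<n} - T)) \<in> (\<lambda>j. \<bar>x j - x (Min T)\<bar>) ` ({..<n} - T)"
    using signs(4) by (intro Min_in) auto
  then obtain j where j: "j \<in> {..<n} - T" "\<bar>x j - x (Min T)\<bar> = 4 * spacing n T x"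
    unfolding spacing_def by auto
  have "x j = x (Min T)"
    using j np by linarith
  moreover have "x i = x (Min T)" if "i \<in> T" for i
    using offset_le[OF that, of x] t np by linarith
  moreover have "1 \<le> k" "j < n" "j \<notin> T"
    using k j by auto
  ultimately show False
    using conf_block_maximal[OF t(1) _ block(1,2), of "x (Min T)" j] by blast
qed

lemma tube_strict:
  assumes "x \<in> tube k n (T, U)"
  shows "\<forall>j\<in>U. x (Min T) + 4 * spacing n T x \<le> x j" "\<forall>j\<in>{..<n} - T - U. x j \<le> x (Min T) - 4 * spacing n T x"
    "\<forall>i\<in>T. \<bar>x i - x (Min T)\<bar> \<le> spacing n T x"
proof -
  have t: "\<forall>j\<in>U. x (Min T) \<le> x j" "\<forall>j\<in>{..<n} - T - U. x j \<le> x (Min T)" "L2_set (offset T x) {..<k - 2} \<le> spacing n T x"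
    using assms by (auto simp: tube_iff)
  show "\<forall>j\<in>U. x (Min T) + 4 * spacing n T x \<le> x j"
  proof
    fix j assume "j \<in> U"
    then show "x (Min T) + 4 * spacing n T x \<le> x j"
      using t(1) spacing_le[of j x] signs(1) by force
  qed
  show "\<forall>j\<in>{..<n} - T - U. x j \<le> x (Min T) - 4 * spacing n T x"
  proof
    fix j assume "j \<in> {..<n} - T - U"
    then show "x j \<le> x (Min T) - 4 * spacing n T x"
      using t(2) spacing_le[of j x] by force
  qed
  show "\<forall>i\<in>T. \<bar>x i - x (Min T)\<bar> \<le> spacing n T x"
    using offset_le t(3) order_trans by blast
qed

lemma tube_less:
  assumes "x \<in> tube k n (T, U)"
  shows "j \<in> U \<Longrightarrow> x (Min T) < x j" "j \<in> {..<n} - T - U \<Longrightarrow> x j < x (Min T)"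
proof -
  show "x (Min T) < x j" if "j \<in> U"
    using bspec[OF tube_strict(1)[OF assms] that] spacing_pos[OF assms] by linarith
  show "x j < x (Min T)" if "j \<in> {..<n} - T - U"
    using bspec[OF tube_strict(2)[OF assms] that] spacing_pos[OF assms] by linarith
qed

lemma closedin_tube: "closedin (top_of_set (conf k n)) (tube k n (T, U))"
proof -
  let ?C = "(\<Inter>j\<in>U. {x. x (Min T) \<le> x j}) \<inter> (\<Inter>j\<in>{..<n} - T - U. {x. x j \<le> x (Min T)}) \<inter>
     {x. L2_set (offset T x) {..<k - 2} \<le> spacing n T x}"
  have "closed ?C"
    by (intro closed_Int closed_INT ballI closed_Collect_le continuous_intros
        continuous_on_product_then_coordinatewise[OF continuous_on_offset])
  moreover have "tube k n (T, U) = conf k n \<inter> ?C"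
    by (auto simp: tube_iff)
  ultimately show ?thesis
    unfolding closedin_closed by blast
qed

lemma norm_tube_normal:
  assumes "x \<in> tube k n (T, U)"
  shows "L2_set (tube_normal n T x) {..<k - 2} = L2_set (offset T x) {..<k - 2} / spacing n T x"
  using spacing_pos[OF assms] unfolding tube_normal_def L2_set_scale by simp

text \<open>The sign conditions are strict on the whole tube, so they cut out an open set, and only
  the norm condition distinguishes the open tube from the closed one.\<close>

lemma openin_tube: "openin (top_of_set (conf k n)) {x \<in> tube k n (T, U). L2_set (tube_normal n T x) {..<k - 2} < 1}"
proof -
  let ?O = "(\<Inter>j\<in>U. {x. x (Min T) < x j}) \<inter> (\<Inter>j\<in>{..<n} - T - U. {x. x j < x (Min T)}) \<inter>
     {x. L2_set (offset T x) {..<k - 2} < spacing n T x}"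
  have "open ?O"
    using signs(5) by (intro open_Int open_INT ballI open_Collect_less continuous_intros
        continuous_on_product_then_coordinatewise[OF continuous_on_offset]) auto
  moreover have "{x \<in> tube k n (T, U). L2_set (tube_normal n T x) {..<k - 2} < 1} = conf k n \<inter> ?O"
  proof (intro set_eqI iffI)
    fix x assume x: "x \<in> {x \<in> tube k n (T, U). L2_set (tube_normal n T x) {..<k - 2} < 1}"
    then have t: "x \<in> tube k n (T, U)"
      by simp
    note p = spacing_pos[OF t]
    have "L2_set (offset T x) {..<k - 2} < spacing n T x"
      using x norm_tube_normal[OF t] p by simp
    moreover have "x (Min T) < x j" if "j \<in> U" for j
      using that by (rule tube_less[OF t])
    moreover have "x j < x (Min T)" if "j \<in> {..<n} - T - U" for j
      using that by (rule tube_less[OF t])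
    ultimately show "x \<in> conf k n \<inter> ?O"
      using t by (auto simp: tube_iff)
  next
    fix x assume x: "x \<in> conf k n \<inter> ?O"
    then have t: "x \<in> tube k n (T, U)"
      by (simp add: tube_iff less_imp_le)
    then show "x \<in> {x \<in> tube k n (T, U). L2_set (tube_normal n T x) {..<k - 2} < 1}"
      using norm_tube_normal[OF t] spacing_pos[OF t] x by auto
  qed
  ultimately show ?thesis
    unfolding openin_open by blast
qed

lemma continuous_on_tube_normal: "continuous_on (tube k n (T, U)) (tube_normal n T)"
proof -
  have "continuous_on (tube k n (T, U)) (\<lambda>x i. (1 / spacing n T x) * offset T x i)"
    using spacing_pos by (intro continuous_intros) force
  then show ?thesis
    by (simp add: tube_normal_def[abs_def])
qed

lemma tube_normal_in:
  assumes "x \<in> tube k n (T, U)"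
  shows "tube_normal n T x \<in> disk (k - 2)"
proof -
  have "L2_set (tube_normal n T x) {..<k - 2} \<le> 1"
    using norm_tube_normal[OF assms] spacing_pos[OF assms] assms by (simp add: tube_iff)
  moreover have "tube_normal n T x i = 0" if "k - 2 \<le> i" for i
    using that by (simp add: tube_normal_def offset_def card_block)
  ultimately show ?thesis
    by (simp add: disk_def)
qed

lemma continuous_on_flatten: "continuous_on S (flatten T)"
proof (rule continuous_on_coordinatewise_then_product)
  fix i
  show "continuous_on S (\<lambda>x. flatten T x i)"
    unfolding flatten_def by (cases "i \<in> T") (auto intro!: continuous_intros)
qed

lemma flatten_in:
  assumes "x \<in> tube k n (T, U)"
  shows "flatten T x \<in> flat_cell n (T, U)"
proof -
  have "i \<notin> T" if "n \<le> i" for i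
    using block(1) that by auto
  then have z: "\<forall>i\<ge>n. flatten T x i = 0"
    using assms by (auto simp: flatten_def tube_iff conf_def)
  have nT: "j \<notin> T" if "j \<in> U" for j
    using signs(1) that by auto
  have "x (Min T) < x j" if "j \<in> U" for j
    using that by (rule tube_less[OF assms])
  moreover have "x j < x (Min T)" if "j \<in> {..<n} - T - U" for j
    using that by (rule tube_less[OF assms])
  ultimately show ?thesis
    using z nT block(5) by (intro flat_cellI) (simp_all add: flatten_def)
qed

lemma spacing_flatten: "spacing n T (flatten T x) = spacing n T x"
  using block(5) by (simp add: spacing_def flatten_def)

lemma spacing_flat_pos:
  assumes "y \<in> flat_cell n (T, U)"
  shows "0 < spacing n T y"
proof -
  have "y j \<noteq> y (Min T)" if "j \<in> {..<n} - T" for j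
    using flat_cellD(3,4)[OF assms, of j] that by (cases "j \<in> U") auto
  then show ?thesis
    unfolding spacing_def using signs(4) by simp
qed

lemma spread_T:
  assumes "i < k - 2"
  shows "spread n T (y, u) (enum_rest T i) = y (enum_rest T i) + spacing n T y * u i"
  using enum_rest_in[OF assms] inv_enum_rest[OF assms] by (simp add: spread_def card_block)

lemma spread_other: "i \<notin> T - {Min T} \<Longrightarrow> spread n T (y, u) i = y i"
  by (auto simp: spread_def)

lemma spacing_spread: "spacing n T (spread n T (y, u)) = spacing n T y"
proof -
  have "(\<lambda>j. \<bar>spread n T (y, u) j - spread n T (y, u) (Min T)\<bar>) ` ({..<n} - T) = (\<lambda>j. \<bar>y j - y (Min T)\<bar>) ` ({..<n} - T)"
    by (intro image_cong refl) (simp add: spread_other)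
  then show ?thesis
    by (simp add: spacing_def)
qed

lemma offset_spread:
  assumes "y \<in> flat_cell n (T, U)" "u \<in> disk (k - 2)"
  shows "offset T (spread n T (y, u)) = (\<lambda>i. spacing n T y * u i)"
proof
  fix i
  show "offset T (spread n T (y, u)) i = spacing n T y * u i"
  proof (cases "i < k - 2")
    case True
    then have "y (enum_rest T i) = y (Min T)"
      using flat_cellD(2)[OF assms(1)] enum_rest_in[OF True] by blast
    then show ?thesis
      using True by (simp add: offset_def card_block spread_T spread_other)
  next
    case False
    then show ?thesis
      using assms(2) by (simp add: offset_def card_block disk_def)
  qed
qed

lemma spread_in:
  assumes y: "y \<in> flat_cell n (T, U)" and u: "u \<in> disk (k - 2)"
  shows "spread n T (y, u) \<in> tube k n (T, U)"
proof -
  let ?x = "spread n T (y, u)"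
  note p = spacing_flat_pos[OF y]
  have "L2_set (offset T ?x) {..<k - 2} = spacing n T y * L2_set u {..<k - 2}"
    using p by (simp add: offset_spread[OF y u] L2_set_scale)
  also have "\<dots> \<le> spacing n T y * 1"
    using u p by (intro mult_left_mono) (auto simp: disk_def)
  finally have le: "L2_set (offset T ?x) {..<k - 2} \<le> spacing n T ?x"
    by (simp add: spacing_spread)
  have nT: "i \<notin> T" if "n \<le> i" for i
    using block(1) that by auto
  then have z: "\<forall>i\<ge>n. ?x i = 0"
    using flat_cellD(1)[OF y] by (simp add: spread_other)
  have "?x (Min T) \<le> ?x j" if "j \<in> U" for j
    using flat_cellD(3)[OF y that] that signs(1) by (subst (1 2) spread_other) auto
  moreover have "?x j \<le> ?x (Min T)" if "j \<in> {..<n} - T - U" for j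
    using flat_cellD(4)[OF y that] that by (simp add: spread_other)
  ultimately have "\<forall>j\<in>U. ?x (Min T) \<le> ?x j" "\<forall>j\<in>{..<n} - T - U. ?x j \<le> ?x (Min T)"
    by blast+
  then show ?thesis
    using in_conf[OF z _ le] p le by (simp add: tube_iff spacing_spread)
qed

lemma spread_flatten:
  assumes "x \<in> tube k n (T, U)"
  shows "spread n T (flatten T x, tube_normal n T x) = x"
proof
  fix i
  note p = spacing_pos[OF assms]
  show "spread n T (flatten T x, tube_normal n T x) i = x i"
  proof (cases "i \<in> T - {Min T}")
    case True
    then show ?thesis
      using enum_rest_inv[OF True] p
      by (simp add: spread_def spacing_flatten card_block tube_normal_def offset_def) (simp add: flatten_def)
  next
    case False
    then show ?thesis
      by (auto simp: spread_other flatten_def)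
  qed
qed

lemma normal_spread:
  assumes y: "y \<in> flat_cell n (T, U)" and u: "u \<in> disk (k - 2)"
  shows "tube_normal n T (spread n T (y, u)) = u"
  using spacing_flat_pos[OF y] by (simp add: tube_normal_def spacing_spread offset_spread[OF y u])

lemma continuous_on_spread: "continuous_on (flat_cell n (T, U) \<times> disk (k - 2)) (spread n T)"
proof (rule continuous_on_coordinatewise_then_product)
  fix i
  let ?S = "flat_cell n (T, U) \<times> disk (k - 2)"
  have s: "continuous_on ?S (\<lambda>z. spacing n T (fst z))"
    by (intro continuous_intros)
  show "continuous_on ?S (\<lambda>z. spread n T z i)"
    unfolding spread_def case_prod_beta
    by (cases "i \<in> T - {Min T}") (auto intro!: continuous_intros s)
qed

lemma flat_center_in: "flat_center n (T, U) \<in> flat_cell n (T, U)"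
proof -
  have 1: "flat_center n (T, U) i = 0" if "i \<in> T" for i
    using signs(1) that by (auto simp: flat_center_def)
  have 2: "flat_center n (T, U) i = 0" if "n \<le> i" for i
    using signs(1) that by (auto simp: flat_center_def)
  show ?thesis
  proof (rule flat_cellI)
    show "flat_center n (T, U) i = flat_center n (T, U) (Min T)" if "i \<in> T" for i
      using 1 that block(5) by simp
    show "flat_center n (T, U) (Min T) < flat_center n (T, U) j" if "j \<in> U" for j
      unfolding 1[OF block(5)] using that by (simp add: flat_center_def)
    show "flat_center n (T, U) j < flat_center n (T, U) (Min T)" if "j \<in> {..<n} - T - U" for j
      unfolding 1[OF block(5)] using that by (simp add: flat_center_def)
  qed (rule 2)
qed

lemma flat_contraction_in:
  assumes s: "s \<in> {0..1}" and y: "y \<in> flat_cell n (T, U)"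
  shows "flat_contraction n (T, U) (s, y) \<in> flat_cell n (T, U)"
proof -
  have c: "(1 - s) * p + s * q < (1 - s) * p' + s * q'" if "p < p'" "q < q'" for p q p' q' :: real
  proof (cases "s = 0")
    case False
    then have "s * q < s * q'" "(1 - s) * p \<le> (1 - s) * p'"
      using that s by (auto intro: mult_left_mono)
    then show ?thesis
      by linarith
  qed (use that in simp)
  show ?thesis
  proof (rule flat_cellI)
    show "flat_contraction n (T, U) (s, y) i = 0" if "n \<le> i" for i
      using flat_cellD(1)[OF y that] flat_cellD(1)[OF flat_center_in that] by (simp add: flat_contraction_def)
    show "flat_contraction n (T, U) (s, y) i = flat_contraction n (T, U) (s, y) (Min T)" if "i \<in> T" for i
      unfolding flat_contraction_def fst_conv snd_conv flat_cellD(2)[OF y that] flat_cellD(2)[OF flat_center_in that] ..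
    show "flat_contraction n (T, U) (s, y) (Min T) < flat_contraction n (T, U) (s, y) j" if "j \<in> U" for j
      unfolding flat_contraction_def fst_conv snd_conv
      by (rule c[OF flat_cellD(3)[OF y that] flat_cellD(3)[OF flat_center_in that]])
    show "flat_contraction n (T, U) (s, y) j < flat_contraction n (T, U) (s, y) (Min T)" if "j \<in> {..<n} - T - U" for j
      unfolding flat_contraction_def fst_conv snd_conv
      by (rule c[OF flat_cellD(4)[OF y that] flat_cellD(4)[OF flat_center_in that]])
  qed
qed

lemma continuous_on_flat_contraction: "continuous_on S (flat_contraction n c)"
  unfolding flat_contraction_def
  by (rule continuous_on_coordinatewise_then_product) (intro continuous_intros)

text \<open>The core of the tube is the cell. This identifies \<open>cell_complement\<close> with
  the set \<open>V\<close> of the collapsing argument.\<close>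

lemma normal_zero_iff:
  assumes "x \<in> conf k n"
  shows "x \<in> tube k n (T, U) \<and> L2_set (tube_normal n T x) {..<k - 2} = 0 \<longleftrightarrow> x \<in> cell n T U"
proof
  assume a: "x \<in> tube k n (T, U) \<and> L2_set (tube_normal n T x) {..<k - 2} = 0"
  then have t: "x \<in> tube k n (T, U)"
    by blast
  note p = spacing_pos[OF t]
  have "L2_set (offset T x) {..<k - 2} = 0"
    using a norm_tube_normal[OF t] p by auto
  then have "x i = x (Min T)" if "i \<in> T" for i
    using offset_le[OF that, of x] by linarith
  moreover have "x (Min T) < x j" if "j \<in> U" for j
    using that by (rule tube_less[OF t])
  moreover have "x j < x (Min T)" if "j \<in> {..<n} - T - U" for j
    using that by (rule tube_less[OF t])
  ultimately show "x \<in> cell n T U"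
    unfolding cell_def by blast
next
  assume "x \<in> cell n T U"
  then obtain a where a: "\<forall>i\<in>T. x i = a" "\<forall>i\<in>U. a < x i" "\<forall>i\<in>{..<n} - T - U. x i < a"
    unfolding cell_def by blast
  then have m: "x (Min T) = a"
    using block(5) by blast
  have "\<forall>i\<ge>n. x i = 0"
    using assms by (simp add: conf_def)
  then have f: "x \<in> flat_cell n (T, U)"
    unfolding m[symmetric] using a unfolding m by (intro flat_cellI) (simp_all add: m)
  have o: "offset T x = (\<lambda>_. 0)"
    using a(1) m enum_rest_in by (auto simp: offset_def card_block)
  then have t: "x \<in> tube k n (T, U)"
    using spacing_flat_pos[OF f] assms a m by (auto simp: tube_iff less_imp_le L2_set_def)
  then show "x \<in> tube k n (T, U) \<and> L2_set (tube_normal n T x) {..<k - 2} = 0"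
    using norm_tube_normal[OF t] o by (simp add: L2_set_def)
qed

end


section \<open>Disjointness of the tubes\<close>

definition near :: "nat \<Rightarrow> (nat \<Rightarrow> real) \<Rightarrow> nat set \<Rightarrow> nat set \<Rightarrow> real \<Rightarrow> real \<Rightarrow> bool" where
  "near n x T U a e \<longleftrightarrow> 0 < e \<and> (\<forall>i\<in>T. \<bar>x i - a\<bar> \<le> e) \<and> (\<forall>j\<in>U. a + 4 * e \<le> x j) \<and>
     (\<forall>j\<in>{..<n} - T - U. x j \<le> a - 4 * e)"

lemma nearD:
  assumes "near n x T U a e"
  shows "0 < e" "i \<in> T \<Longrightarrow> x i \<le> a + e" "i \<in> T \<Longrightarrow> a - e \<le> x i" "j \<in> U \<Longrightarrow> a + 4 * e \<le> x j"
    "j \<in> {..<n} - T - U \<Longrightarrow> x j \<le> a - 4 * e"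
  using assms unfolding near_def by (auto simp: abs_le_iff)

text \<open>Coordinates of \<open>T'\<close> differ by at most \<open>2 * e'\<close>, whereas
  \<open>x i\<close> and \<open>x t\<close> differ by at least \<open>4 * e - e\<close>. Together
  with the symmetric bound this rules out different overlapping blocks.\<close>

lemma near_overlap:
  assumes "near n x T U a e" "near n x T' U' a' e'" "t \<in> T" "t \<in> T'" "i \<in> T'" "i \<notin> T" "i < n"
  shows "3 * e \<le> 2 * e'"
proof -
  have "x i \<le> a' + e'" "a' - e' \<le> x i" "x t \<le> a' + e'" "a' - e' \<le> x t" "x t \<le> a + e" "a - e \<le> x t"
    using assms nearD(2,3) by blast+
  moreover have "a + 4 * e \<le> x i \<or> x i \<le> a - 4 * e"
    using nearD(4,5)[OF assms(1), of i] assms(6,7) by auto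
  ultimately show ?thesis
    by linarith
qed

text \<open>If \<open>T'\<close> separated \<open>T\<close>, its coordinates would lie between two
  coordinates of \<open>T\<close>, hence within \<open>e\<close> of \<open>a\<close>, where no
  coordinate outside \<open>T\<close> can be.\<close>

lemma near_one_side:
  assumes "near n x T U a e" "near n x T' U' a' e'" "T \<inter> T' = {}" "T \<subseteq> {..<n}" "T' \<subseteq> {..<n}" "T' \<noteq> {}"
  shows "T \<subseteq> U' \<or> T \<subseteq> {..<n} - T' - U'"
proof (rule ccontr)
  assume "\<not> ?thesis"
  then obtain s t where st: "s \<in> T" "t \<in> T" "s \<in> U'" "t \<notin> U'"
    using assms(3,4) by blast
  then have t: "t \<in> {..<n} - T' - U'"
    using assms(3,4) by blast
  obtain u where u: "u \<in> T'"
    using assms(6) by blast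
  have "a' + 4 * e' \<le> x s" "x t \<le> a' - 4 * e'" "x s \<le> a + e" "a - e \<le> x t" "x u \<le> a' + e'" "a' - e' \<le> x u"
    using nearD[OF assms(1)] nearD[OF assms(2)] st t u by blast+
  moreover have "a + 4 * e \<le> x u \<or> x u \<le> a - 4 * e"
    using nearD(4,5)[OF assms(1), of u] u assms(3,5) by blast
  moreover have "0 < e" "0 < e'"
    using assms(1,2) nearD(1) by blast+
  ultimately show False
    by linarith
qed

text \<open>Two-sidedness puts a coordinate above the upper block and another one below the lower
  block. With two disjoint blocks of size \<open>k - 1\<close> this makes \<open>2 * k\<close>
  indices, more than there are.\<close>

lemma near_above:
  assumes k: "3 \<le> k" "n < 2 * k" and m: "two_sided k n (T, U)" "two_sided k n (T', U')"
    and near: "near n x T U a e" "near n x T' U' a' e'" and dj: "T \<inter> T' = {}" and above: "T \<subseteq> U'"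
  shows False
proof -
  interpret T: two_sided_cell k n T U
    using k m by unfold_locales
  interpret T': two_sided_cell k n T' U'
    using k m by unfold_locales
  obtain t t' where t: "t \<in> T" "t' \<in> T'"
    using T.block(5) T'.block(5) by blast
  obtain l where l: "l \<in> {..<n} - T' - U'"
    using T'.signs(3) by blast
  have e: "0 < e" "0 < e'"
    using near nearD(1) by blast+
  have xt: "a' + 4 * e' \<le> x t" "x t \<le> a + e" "a - e \<le> x t" "x t' \<le> a' + e'" "a' - e' \<le> x t'" "x l \<le> a' - 4 * e'"
    using nearD[OF near(1)] nearD[OF near(2)] t l above by blast+
  have "T' \<subseteq> {..<n} - T - U"
  proof -
    have "\<not> T' \<subseteq> U"
    proof
      assume "T' \<subseteq> U"
      then have "a + 4 * e \<le> x t'"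
        using nearD(4)[OF near(1)] t by blast
      then show False
        using xt e by linarith
    qed
    then show ?thesis
      using near_one_side[OF near(2,1)] dj T.block T'.block by blast
  qed
  moreover obtain u where u: "u \<in> U"
    using T.signs(2) by blast
  ultimately have u': "u \<in> {..<n} - (T \<union> T')"
    using T.signs(1) by blast
  have l': "l \<in> {..<n} - (T \<union> T')"
    using l above by blast
  have "card (T \<union> T') = 2 * (k - 1)"
    using T.block T'.block dj by (simp add: card_Un_disjoint)
  then have "card ({..<n} - (T \<union> T')) \<le> 1"
    using T.block T'.block k by (simp add: card_Diff_subset)
  then have "x u = x l"
    using u' l' by (metis card_le_Suc0_iff_eq One_nat_def finite_Diff finite_lessThan)
  moreover have "a + 4 * e \<le> x u"
    using nearD(4)[OF near(1) u] .
  ultimately show False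
    using xt e by linarith
qed

text \<open>Different overlapping blocks violate each other's spacing, and disjoint ones would each
  lie below the other. For equal blocks both centres are close to \<open>x (Min T)\<close>, so no
  coordinate can be above one centre and below the other.\<close>

lemma near_unique:
  assumes k: "3 \<le> k" "n < 2 * k" and m: "two_sided k n (T, U)" "two_sided k n (T', U')"
    and near: "near n x T U a e" "near n x T' U' a' e'"
  shows "T = T' \<and> U = U'"
proof -
  interpret T: two_sided_cell k n T U
    using k m by unfold_locales
  interpret T': two_sided_cell k n T' U'
    using k m by unfold_locales
  have e: "0 < e" "0 < e'"
    using near nearD(1) by blast+
  have TT: "T = T'"
  proof (rule ccontr)
    assume ne: "T \<noteq> T'"
    show False
    proof (cases "T \<inter> T' = {}")
      case False
      then obtain t where t: "t \<in> T" "t \<in> T'"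
        by blast
      have "\<not> T \<subseteq> T'" "\<not> T' \<subseteq> T"
        using ne T.block T'.block card_subset_eq by metis+
      then obtain i j where "i \<in> T'" "i \<notin> T" "j \<in> T" "j \<notin> T'"
        by blast
      then have "3 * e \<le> 2 * e'" "3 * e' \<le> 2 * e"
        using near_overlap[OF near t] near_overlap[OF near(2,1) t(2,1)] T.block(1) T'.block(1) by blast+
      then show False
        using e by linarith
    next
      case True
      then have "\<not> T \<subseteq> U'" "\<not> T' \<subseteq> U"
        using near_above[OF k m near] near_above[OF k m(2,1) near(2,1)] by blast+
      then have *: "T \<subseteq> {..<n} - T' - U'" "T' \<subseteq> {..<n} - T - U"
        using near_one_side[OF near] near_one_side[OF near(2,1)] True T.block T'.block by blast+
      obtain t t' where t: "t \<in> T" "t' \<in> T'"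
        using T.block(5) T'.block(5) by blast
      have "t \<in> {..<n} - T' - U'" "t' \<in> {..<n} - T - U"
        using t * by blast+
      then have "x t \<le> a' - 4 * e'" "x t' \<le> a - 4 * e" "a - e \<le> x t" "a' - e' \<le> x t'"
        using nearD(5)[OF near(2)] nearD(5)[OF near(1)] nearD(3)[OF near(1) t(1)] nearD(3)[OF near(2) t(2)] by simp_all
      then show False
        using e by linarith
    qed
  qed
  have t: "x (Min T) \<le> a + e" "a - e \<le> x (Min T)" "x (Min T) \<le> a' + e'" "a' - e' \<le> x (Min T)"
    using nearD(2,3)[OF near(1)] nearD(2,3)[OF near(2)] T.block(5) TT by blast+
  have "j \<in> U'" if "j \<in> U" for j
  proof (rule ccontr)
    assume "j \<notin> U'"
    then have "x j \<le> a' - 4 * e'" "a + 4 * e \<le> x j"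
      using nearD(4)[OF near(1) that] nearD(5)[OF near(2), of j] that T.signs(1) TT by blast+
    then show False
      using t e by linarith
  qed
  moreover have "j \<in> U" if "j \<in> U'" for j
  proof (rule ccontr)
    assume "j \<notin> U"
    then have "x j \<le> a - 4 * e" "a' + 4 * e' \<le> x j"
      using nearD(4)[OF near(2) that] nearD(5)[OF near(1), of j] that T'.signs(1) TT by blast+
    then show False
      using t e by linarith
  qed
  ultimately show ?thesis
    using TT by blast
qed

lemma tube_near:
  assumes "3 \<le> k" "n < 2 * k" "two_sided k n (T, U)" "x \<in> tube k n (T, U)"
  shows "near n x T U (x (Min T)) (spacing n T x)"
proof -
  interpret two_sided_cell k n T U
    using assms by unfold_locales
  show ?thesis
    unfolding near_def using spacing_pos[OF assms(4)] tube_strict[OF assms(4)] by blast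
qed

lemma tubes_disjoint:
  assumes "3 \<le> k" "n < 2 * k" "two_sided k n c" "two_sided k n c'" "c \<noteq> c'"
  shows "tube k n c \<inter> tube k n c' = {}"
proof (rule ccontr)
  assume "tube k n c \<inter> tube k n c' \<noteq> {}"
  then obtain x where x: "x \<in> tube k n c" "x \<in> tube k n c'"
    by blast
  obtain T U T' U' where c: "c = (T, U)" "c' = (T', U')"
    by (metis prod.exhaust)
  show False
    using near_unique[OF assms(1,2) _ _ tube_near[OF assms(1,2)] tube_near[OF assms(1,2)]] assms(3-5) x
    unfolding c by blast
qed

section \<open>Assembling the homotopy equivalence\<close>

lemma cells_imp_two_sided: "\<lbrakk>3 \<le> k; c \<in> cells k r\<rbrakk> \<Longrightarrow> two_sided k (k + 1 + r) c"
  using cells_two_sided[of k "fst c" "snd c" r] by (cases c) (simp add: two_sided_def)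

lemma conf_homotopy_equivalent:
  assumes k: "3 \<le> k" and n: "n = k + 1 + r" and n2: "n < 2 * k"
  shows "top_of_set (conf k n) homotopy_equivalent_space sphere_wedge (beta k n) (k - 2)"
proof -
  let ?m = "beta k n"
  have m: "card (cells k r) = ?m"
    using card_cells[OF k] n by simp
  then obtain cs where cs: "bij_betw cs {..<?m} (cells k r)"
    using ex_bij_betw_nat_finite[OF finite_cells[OF k, of r]] by (auto simp: atLeast0LessThan)
  have cs_in: "cs c \<in> cells k r" if "c < ?m" for c
    using bij_betwE[OF cs] that by blast
  have two_sided: "two_sided k n (cs c)" if "c < ?m" for c
    using cells_imp_two_sided[OF k cs_in[OF that]] n by simp
  have loc: "two_sided_cell k n (fst (cs c)) (snd (cs c))" if "c < ?m" for c
    using k n2 two_sided[OF that] by unfold_locales simp_all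
  obtain K x\<^sub>0 where K: "continuous_on ({0..1::real} \<times> cell_complement k r) K" "K \<in> {0..1} \<times> cell_complement k r \<rightarrow> cell_complement k r"
    "\<And>x. K (0, x) = x" "\<And>x. K (1, x) = x\<^sub>0"
    using contractible_cell_complement[OF k, of r] unfolding contractible_def homotopic_with_def by auto
  \<comment> \<open>The disk model of the wedge asks for at least one sphere; the summand for
    \<open>i = k\<close> is positive.\<close>
  have pos: "0 < ?m"
    unfolding beta_def by (rule sum_pos2[of _ k]) (use n in auto)
  interpret disk_tubes "conf k n" ?m "k - 2" "\<lambda>c. tube k n (cs c)" "\<lambda>c. flat_cell n (cs c)"
    "\<lambda>c. tube_normal n (fst (cs c))" "\<lambda>c. flatten (fst (cs c))" "\<lambda>c. spread n (fst (cs c))"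
    "\<lambda>c. flat_contraction n (cs c)" "\<lambda>c. flat_center n (cs c)" "cell_complement k r" K x\<^sub>0
  proof
    fix c assume c: "c < ?m"
    interpret c: two_sided_cell k n "fst (cs c)" "snd (cs c)"
      by (rule loc[OF c])
    show "closedin (top_of_set (conf k n)) (tube k n (cs c))"
      using c.closedin_tube by simp
    show "openin (top_of_set (conf k n)) {x \<in> tube k n (cs c). L2_set (tube_normal n (fst (cs c)) x) {..<k - 2} < 1}"
      using c.openin_tube by simp
    show "continuous_on (tube k n (cs c)) (tube_normal n (fst (cs c)))"
      using c.continuous_on_tube_normal by simp
    show "continuous_on (tube k n (cs c)) (flatten (fst (cs c)))"
      using c.continuous_on_flatten by simp
    show "continuous_on (flat_cell n (cs c) \<times> disk (k - 2)) (spread n (fst (cs c)))"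
      using c.continuous_on_spread by simp
    show "continuous_on ({0..1} \<times> flat_cell n (cs c)) (flat_contraction n (cs c))"
      by (rule c.continuous_on_flat_contraction)
    show "flat_center n (cs c) \<in> flat_cell n (cs c)"
      using c.flat_center_in by simp
    fix x assume x: "x \<in> tube k n (cs c)"
    show "tube_normal n (fst (cs c)) x \<in> disk (k - 2)"
      using c.tube_normal_in x by simp
    show "flatten (fst (cs c)) x \<in> flat_cell n (cs c)"
      using c.flatten_in x by simp
    show "spread n (fst (cs c)) (flatten (fst (cs c)) x, tube_normal n (fst (cs c)) x) = x"
      using c.spread_flatten x by simp
  next
    fix c y w assume c: "c < ?m" and y: "y \<in> flat_cell n (cs c)" and w: "w \<in> disk (k - 2)"
    interpret c: two_sided_cell k n "fst (cs c)" "snd (cs c)"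
      by (rule loc[OF c])
    show "spread n (fst (cs c)) (y, w) \<in> tube k n (cs c)"
      using c.spread_in y w by simp
    show "tube_normal n (fst (cs c)) (spread n (fst (cs c)) (y, w)) = w"
      using c.normal_spread y w by simp
  next
    fix c t y assume c: "c < ?m" and y: "y \<in> flat_cell n (cs c)" and t: "t \<in> {0..1::real}"
    interpret c: two_sided_cell k n "fst (cs c)" "snd (cs c)"
      by (rule loc[OF c])
    show "flat_contraction n (cs c) (t, y) \<in> flat_cell n (cs c)"
      using c.flat_contraction_in[OF t] y by simp
  next
    fix c c' assume "c < ?m" "c' < ?m" "c \<noteq> c'"
    moreover from this have "cs c \<noteq> cs c'"
      using cs by (auto simp: bij_betw_def inj_on_def)
    ultimately show "tube k n (cs c) \<inter> tube k n (cs c') = {}"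
      by (intro tubes_disjoint[OF k n2] two_sided)
  next
    have "x \<in> cell_complement k r \<longleftrightarrow> (\<forall>c<?m. \<not> (x \<in> tube k n (cs c) \<and> L2_set (tube_normal n (fst (cs c)) x) {..<k - 2} = 0))"
      if x: "x \<in> conf k n" for x
    proof -
      have "x \<in> cell_complement k r \<longleftrightarrow> (\<forall>c\<in>cs ` {..<?m}. x \<notin> cell n (fst c) (snd c))"
        using x n cs by (auto simp: cell_complement_def bij_betw_def)
      also have "\<dots> \<longleftrightarrow> (\<forall>c<?m. x \<notin> cell n (fst (cs c)) (snd (cs c)))"
        by auto
      also have "\<dots> \<longleftrightarrow> (\<forall>c<?m. \<not> (x \<in> tube k n (cs c) \<and> L2_set (tube_normal n (fst (cs c)) x) {..<k - 2} = 0))"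
      proof -
        have "x \<in> cell n (fst (cs c)) (snd (cs c)) \<longleftrightarrow> x \<in> tube k n (cs c) \<and> L2_set (tube_normal n (fst (cs c)) x) {..<k - 2} = 0"
          if "c < ?m" for c
          using two_sided_cell.normal_zero_iff[OF loc[OF that] x] by simp
        then show ?thesis
          by blast
      qed
      finally show ?thesis .
    qed
    moreover have "cell_complement k r \<subseteq> conf k n"
      using n by (auto simp: cell_complement_def)
    ultimately show "cell_complement k r = conf k n - (\<Union>c<?m. {x \<in> tube k n (cs c). L2_set (tube_normal n (fst (cs c)) x) {..<k - 2} = 0})"
      by blast
  qed (use k pos K in \<open>auto simp: flat_contraction_def\<close>)
  show ?thesis
    by (rule homotopy_equivalent_sphere_wedge)
qed

theorem proposition5p1:
  fixes k n :: nat
  assumes "3 \<le> k" and "k < n" and "n < 2 * k"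
  shows "conf_space k n homotopy_equivalent_space sphere_wedge (beta k n) (k - 2)"
  unfolding conf_space_eq
  using conf_homotopy_equivalent[of k n "n - (k + 1)"] assms by simp

end
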